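(* Consider the Poisson cluster model with reporting delays $M(t)=\sum_{j=1}^{\infty}I_{\{T_j\le1\}}L_j(t-(T_j+D_j))$, $t\ge1$, with i.i.d. additive clusters $L_k$ whose law is given by $E[\mathrm{e}^{ixL(t)}]=\exp\{\int_{(0,t]\times\mathbb{R}}(\mathrm{e}^{ixv}-1)\,\nu(\mathrm{d}(u,v))\}$, and let $\widehat N(t)=\#\{k\ge1:T_k+D_k\le t,\ T_k\in[0,1]\}$ (full setting in the context). Let $\ell=0,1,2,\ldots$, $t\ge1$ and $s>0$. For $i=1,2$ put $$J_i=\int_0^tE\big[(L(t-u,t+s-u])^i\big]\,\frac{(\Lambda*F_D)(\mathrm{d}u)}{E[\widehat N(t)]},\qquad H_i=\int_0^1\int_{r=t-v}^{t+s-v}E\big[L^i(t+s-v-r)\big]\,\Lambda(\mathrm{d}v)\,F_D(\mathrm{d}r).$$ (i) If $E|L(u)|<\infty$ for all $u\ge0$, then the prediction $\widetilde M_\ell(t,t+s]:=E[M(t,t+s]\mid\widehat N(t)=\ell]$ is given by $$\widetilde M_\ell(t,t+s]=\ell J_1+H_1.$$ (ii) If $E[L^2(u)]<\infty$ for all $u\ge0$, then the conditional variance of $M(t,t+s]$ given $\{\widehat N(t)=\ell\}$ is $$\mathrm{Var}(M(t,t+s]\mid\widehat N(t)=\ell)=\ell J_2-\ell J_1^2+H_2.$$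
   Context: Model: $0<T_1<T_2<\cdots$ are the points of a non-homogeneous Poisson process $N$ on $[0,\infty)$ with locally finite mean measure $\Lambda$ (without atoms). The $L_j$ are i.i.d. copies of an additive process $L$ with $L_j(t)=0$ a.s. for $t\le0$; $(D_j)$ is an i.i.d. sequence of positive random variables with distribution $F_D$; $(T_j)$, $(L_j)$, $(D_j)$ are mutually independent (the $k$-th cluster starts at time $T_k+D_k$). $M(t,t+s]=M(t+s)-M(t)$ and $L(a,b]=L(b)-L(a)$. Additive process: stochastically continuous, independent (not necessarily stationary) increments, càdlàg paths, $L(0)=0$ a.s. Here $L$ is of pure jump type, with $\nu$ a measure on $(0,\infty)\times\mathbb{R}$ satisfying $\nu((0,t]\times\{0\})=0$, $\nu(\{t\}\times\mathbb{R})=0$ and $\int_{(0,t]\times\mathbb{R}}(|v|\wedge1)\,\nu(\mathrm{d}(u,v))<\infty$ for all $t$. $\widehat N(t)$ is Poisson with mean $E[\widehat N(t)]=\int_0^1F_D([0,t-v])\,\Lambda(\mathrm{d}v)$, assumed positive. In the convolution $\Lambda*F_D$ the measure $\Lambda$ is restricted to $[0,1]$, so $\Lambda*F_D$ is the image of $\Lambda|_{[0,1]}\times F_D$ under addition, and its mass on $[0,t]$ is $E[\widehat N(t)]$. *)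

theory Defs
  imports "HOL-Probability.Probability"
begin

definition cadlag :: "(real \<Rightarrow> real) \<Rightarrow> bool" where
  "cadlag f \<longleftrightarrow> (\<forall>t. continuous (at_right t) f \<and> (\<exists>l. (f \<longlongrightarrow> l) (at_left t)))"

(* X(a,b] = X(b) - X(a) *)
definition incr :: "(real \<Rightarrow> 'a \<Rightarrow> real) \<Rightarrow> real \<Rightarrow> real \<Rightarrow> 'a \<Rightarrow> real" where
  "incr X a b \<omega> = X b \<omega> - X a \<omega>"

(* The time axis of a process is the whole real line, since the clusters are evaluated at negative
   times; the additive structure is only required on [0,\<infinity>). The paths are cadlag for every
   \<omega>: P need not be complete, so otherwise evaluation at a random time could fail to be
   measurable. *)
definition additive_process :: "'a measure \<Rightarrow> (real \<Rightarrow> 'a \<Rightarrow> real) \<Rightarrow> bool" where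
  "additive_process P L \<longleftrightarrow>
     (\<forall>t. L t \<in> borel_measurable P) \<and>
     (AE \<omega> in P. L 0 \<omega> = 0) \<and>
     (\<forall>n \<tau>. (\<forall>i. 0 \<le> \<tau> i) \<and> mono \<tau> \<longrightarrow>
        prob_space.indep_vars P (\<lambda>_. borel) (\<lambda>i. incr L (\<tau> i) (\<tau> (Suc i))) {..<n::nat}) \<and>
     (\<forall>t\<ge>0. \<forall>\<epsilon>>0.
        ((\<lambda>s. measure P {\<omega> \<in> space P. \<bar>L s \<omega> - L t \<omega>\<bar> > \<epsilon>}) \<longlongrightarrow> 0) (at t within {0..})) \<and>
     (\<forall>\<omega>\<in>space P. cadlag (\<lambda>t. L t \<omega>))"

(* The points are indexed from 0, so T k is the (k+1)-st point. If there are fewer than k+1 points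
   (which can happen when the mean measure is finite), then T k is \<infinity>. *)
definition point_count :: "(nat \<Rightarrow> 'a \<Rightarrow> ereal) \<Rightarrow> real set \<Rightarrow> 'a \<Rightarrow> nat" where
  "point_count T A \<omega> = card {k. T k \<omega> \<in> ereal ` A}"

definition poisson_points :: "'a measure \<Rightarrow> (nat \<Rightarrow> 'a \<Rightarrow> ereal) \<Rightarrow> real measure \<Rightarrow> bool" where
  "poisson_points P T \<Lambda> \<longleftrightarrow>
     (\<forall>k. T k \<in> borel_measurable P) \<and>
     (AE \<omega> in P. 0 < T 0 \<omega>) \<and>
     (AE \<omega> in P. \<forall>k. T k \<omega> < T (Suc k) \<omega> \<or> (T k \<omega> = \<infinity> \<and> T (Suc k) \<omega> = \<infinity>)) \<and>
     (\<forall>b::real. AE \<omega> in P. finite {k. T k \<omega> \<le> ereal b}) \<and>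
     (\<forall>A\<in>sets borel. bounded A \<and> A \<subseteq> {0..} \<longrightarrow>
        (\<forall>n. measure P {\<omega> \<in> space P. point_count T A \<omega> = n} =
             measure \<Lambda> A ^ n / fact n * exp (- measure \<Lambda> A))) \<and>
     (\<forall>n A. (\<forall>i<n. A i \<in> sets borel \<and> bounded (A i) \<and> A i \<subseteq> {0..}) \<and>
              disjoint_family_on A {..<n::nat} \<longrightarrow>
        prob_space.indep_vars P (\<lambda>_. count_space UNIV) (\<lambda>i. point_count T (A i)) {..<n})"

(* the \<sigma>-algebra on P generated by X *)
definition sigma_gen :: "'a measure \<Rightarrow> 'b measure \<Rightarrow> ('a \<Rightarrow> 'b) \<Rightarrow> 'a set set" where
  "sigma_gen P N X = sets (vimage_algebra (space P) X N)"

(* L is a generic copy of the clusters Lc k; it only enters through expectations, and its joint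
   law with the other variables is irrelevant. *)
locale delayed_poisson_cluster = prob_space P
  for P :: "'a measure"
    and T :: "nat \<Rightarrow> 'a \<Rightarrow> ereal"
    and \<Lambda> :: "real measure"
    and L :: "real \<Rightarrow> 'a \<Rightarrow> real"
    and \<nu> :: "(real \<times> real) measure"
    and Lc :: "nat \<Rightarrow> real \<Rightarrow> 'a \<Rightarrow> real"
    and D :: "nat \<Rightarrow> 'a \<Rightarrow> real"
    and F\<^sub>D :: "real measure" +
  assumes sets_\<Lambda>: "sets \<Lambda> = sets borel"
    and \<Lambda>_neg: "emeasure \<Lambda> {..<0} = 0"
    and \<Lambda>_locally_finite: "\<And>b. emeasure \<Lambda> {0..b} < \<infinity>"
    and \<Lambda>_no_atoms: "\<And>x. emeasure \<Lambda> {x} = 0"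
    and points: "poisson_points P T \<Lambda>"
    and sets_\<nu>: "sets \<nu> = sets borel"
    and \<nu>_nonpos: "emeasure \<nu> ({..0} \<times> UNIV) = 0"
    and \<nu>_zero_jump: "\<And>t. emeasure \<nu> ({0<..t} \<times> {0}) = 0"
    and \<nu>_no_fixed_jump: "\<And>t. emeasure \<nu> ({t} \<times> UNIV) = 0"
    and \<nu>_integrable: "\<And>t. (\<integral>\<^sup>+p\<in>{0<..t} \<times> UNIV. ennreal (min \<bar>snd p\<bar> 1) \<partial>\<nu>) < \<infinity>"
    and L_additive: "additive_process P L"
    and L_law: "\<And>t x. 0 \<le> t \<Longrightarrow>
      (LINT \<omega>|P. iexp (x * L t \<omega>)) = exp (LINT p:({0<..t} \<times> UNIV)|\<nu>. iexp (x * snd p) - 1)"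
    and Lc_additive: "\<And>k. additive_process P (Lc k)"
    and Lc_nonpos: "\<And>k t. t \<le> 0 \<Longrightarrow> AE \<omega> in P. Lc k t \<omega> = 0"
    and Lc_copy: "\<And>k. distr P (Pi\<^sub>M UNIV (\<lambda>_. borel)) (\<lambda>\<omega> t. Lc k t \<omega>) =
                       distr P (Pi\<^sub>M UNIV (\<lambda>_. borel)) (\<lambda>\<omega> t. L t \<omega>)"
    and Lc_indep: "indep_vars (\<lambda>_. Pi\<^sub>M UNIV (\<lambda>_. borel)) (\<lambda>k \<omega> t. Lc k t \<omega>) UNIV"
    and D_pos: "\<And>k. AE \<omega> in P. 0 < D k \<omega>"
    and D_law: "\<And>k. distr P borel (D k) = F\<^sub>D"
    and D_indep: "indep_vars (\<lambda>_. borel) D UNIV"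
    and T_L_D_indep: "indep_sets
      (\<lambda>i. [sigma_gen P (Pi\<^sub>M UNIV (\<lambda>_. borel)) (\<lambda>\<omega> k. T k \<omega>),
            sigma_gen P (Pi\<^sub>M UNIV (\<lambda>_. borel)) (\<lambda>\<omega> (k, t). Lc k t \<omega>),
            sigma_gen P (Pi\<^sub>M UNIV (\<lambda>_. borel)) (\<lambda>\<omega> k. D k \<omega>)] ! i) {0, 1, 2}"

definition cluster_process ::
  "(nat \<Rightarrow> 'a \<Rightarrow> ereal) \<Rightarrow> (nat \<Rightarrow> real \<Rightarrow> 'a \<Rightarrow> real) \<Rightarrow> (nat \<Rightarrow> 'a \<Rightarrow> real) \<Rightarrow> real \<Rightarrow> 'a \<Rightarrow> real" where
  "cluster_process T Lc D t \<omega> =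
     (\<Sum>k. if T k \<omega> \<le> 1 then Lc k (t - (real_of_ereal (T k \<omega>) + D k \<omega>)) \<omega> else 0)"

definition reported_count ::
  "(nat \<Rightarrow> 'a \<Rightarrow> ereal) \<Rightarrow> (nat \<Rightarrow> 'a \<Rightarrow> real) \<Rightarrow> real \<Rightarrow> 'a \<Rightarrow> nat" where
  "reported_count T D t \<omega> = card {k. T k \<omega> + ereal (D k \<omega>) \<le> ereal t \<and> T k \<omega> \<in> {0..1}}"

(* expectation and variance under the conditional probability P( . | A) *)
definition cond_expectation :: "'a measure \<Rightarrow> 'a set \<Rightarrow> ('a \<Rightarrow> real) \<Rightarrow> real" where
  "cond_expectation P A X = (LINT \<omega>|uniform_measure P A. X \<omega>)"

definition cond_variance :: "'a measure \<Rightarrow> 'a set \<Rightarrow> ('a \<Rightarrow> real) \<Rightarrow> real" where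
  "cond_variance P A X = cond_expectation P A (\<lambda>\<omega>. (X \<omega> - cond_expectation P A X)\<^sup>2)"

(* e is the normalising constant, to be instantiated with the expected reported count at time t *)
definition J_int ::
  "'a measure \<Rightarrow> real measure \<Rightarrow> (real \<Rightarrow> 'a \<Rightarrow> real) \<Rightarrow> real measure \<Rightarrow> real \<Rightarrow> nat \<Rightarrow> real \<Rightarrow> real \<Rightarrow> real" where
  "J_int P \<Lambda> L F\<^sub>D e i t s =
     (LINT u:{0..t}|(density \<Lambda> (indicator {0..1}) \<star> F\<^sub>D).
        (LINT \<omega>|P. incr L (t - u) (t + s - u) \<omega> ^ i)) / e"

definition H_int ::
  "'a measure \<Rightarrow> real measure \<Rightarrow> (real \<Rightarrow> 'a \<Rightarrow> real) \<Rightarrow> real measure \<Rightarrow> nat \<Rightarrow> real \<Rightarrow> real \<Rightarrow> real" where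
  "H_int P \<Lambda> L F\<^sub>D i t s =
     (LINT v:{0..1}|\<Lambda>. LINT r:{t - v..t + s - v}|F\<^sub>D. LINT \<omega>|P. L (t + s - v - r) \<omega> ^ i)"

end

theory Submission
  imports Defs
begin

text \<open>The increment \<open>X = M(t,t+s]\<close> is the sum, over the points with \<open>T_k \<le> 1\<close>, of
\<open>y_k = L_k(t+s-T_k-D_k) - L_k(t-T_k-D_k)\<close>, and the reported count \<open>N\<close> is the number of these
points with \<open>T_k + D_k \<le> t\<close>. Marked with their delays and clusters, the points form a Poisson
process. Let \<open>\<rho>\<close> be the product of \<open>\<Lambda>\<close> restricted to \<open>[0,1]\<close> with \<open>F_D\<close>. The whole proof rests on
one formula, \<open>expectation_mark_prod\<close>: for a function \<open>\<psi>\<close> of a point, its delay and its cluster path,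
the product of \<open>\<psi>\<close> over the points in \<open>[0,1]\<close> has expectation \<open>exp (\<integral> (E \<psi> - 1) d\<rho>)\<close>. It holds
because the clusters and then the delays, being i.i.d. and independent of the points, can be averaged
out factor by factor (\<open>expectation_prod_indep_marks\<close>), which leaves the classical product
functional of a Poisson process (\<open>poisson_functional\<close>).

Let \<open>h\<close> be the indicator of \<open>v + d \<le> t\<close>. Take \<open>\<psi> = z^h (1 + x y + x^2 y^2/2)\<close>. As a
function of \<open>x\<close>, the product equals \<open>z^N (1 + x X + x^2 X^2/2)\<close> up to \<open>x^3\<close> times the
product of \<open>1 + |y| + y^2/2\<close>, which is integrable by the same formula. The right-hand side is
\<open>exp (m (z-1) + x (z J'_1 + H_1) + x^2 (z J'_2 + H_2)/2)\<close>, where \<open>m = E N\<close>, and \<open>J'_i\<close> and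
\<open>H_i\<close> integrate \<open>E y^i\<close> over \<open>v + d \<le> t\<close> and over \<open>v + d > t\<close>. Comparison of the
coefficients of \<open>x\<close> and \<open>x^2\<close> gives
\<open>E (z^N X) = (z J'_1 + H_1) exp (m (z-1))\<close> and
\<open>E (z^N X^2) = (z J'_2 + H_2 + (z J'_1 + H_1)^2) exp (m (z-1))\<close>
(\<open>first_moment_marks\<close>, \<open>second_moment_marks\<close>). The coefficients of \<open>z^l\<close> in these identities,
divided by \<open>P(N = l) = exp(-m) m^l / l!\<close>, are the conditional moments
(\<open>expectation_on_level_from_genfun\<close>):
\<open>E (X | N = l) = H_1 + l J'_1/m\<close>, and the conditional second moment is
\<open>H_2 + H_1^2 + (J'_2 + 2 J'_1 H_1) l/m + J'_1^2 l (l-1)/m^2\<close>. Since \<open>l (l-1) - l^2 = -l\<close>, the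
variance is the claimed one with \<open>J_i = J'_i/m\<close>.

The formula for products needs the moments of the increments to be bounded uniformly in the starting
time of the cluster, whereas only finiteness for each fixed time is given. This is where
the independence and the stochastic continuity of the increments enter
(\<open>additive_process_moment_bounded\<close>). The right-continuity of the paths makes the evaluation of a
cluster at a random time measurable (\<open>path_value\<close>), and the absence of atoms of \<open>\<Lambda>\<close> removes
the ambiguity on the line \<open>v + d = t\<close>, which belongs to the integration domains of both \<open>J\<close> and \<open>H\<close>.\<close>

section \<open>Taylor remainders and coefficients of power series\<close>

text \<open>Expanding the product, every term of degree at least two in \<open>x\<close> is dominated by \<open>x\<^sup>2\<close> times
the corresponding term with absolute values and \<open>x = 1\<close>. The bound is stated with the low-order terms
subtracted on the right as well, because only this form is preserved when a factor is added.\<close>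

lemma prod_one_plus_first_order:
  fixes y :: "'k \<Rightarrow> real"
  assumes "finite I" and x: "0 \<le> x" "x \<le> 1"
  shows "\<bar>(\<Prod>k\<in>I. 1 + x * y k) - 1 - x * (\<Sum>k\<in>I. y k)\<bar>
           \<le> x\<^sup>2 * ((\<Prod>k\<in>I. 1 + \<bar>y k\<bar>) - 1 - (\<Sum>k\<in>I. \<bar>y k\<bar>))"
  using \<open>finite I\<close>
proof (induction I)
  case (insert j I)
  define R where "R = (\<Prod>k\<in>I. 1 + x * y k) - 1 - x * (\<Sum>k\<in>I. y k)"
  define Q where "Q = (\<Prod>k\<in>I. 1 + \<bar>y k\<bar>) - 1 - (\<Sum>k\<in>I. \<bar>y k\<bar>)"
  have sum_le: "\<bar>\<Sum>k\<in>I. y k\<bar> \<le> (\<Sum>k\<in>I. \<bar>y k\<bar>)"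
    by (rule sum_abs)
  have fac: "\<bar>1 + x * y j\<bar> \<le> 1 + \<bar>y j\<bar>"
  proof -
    have "\<bar>x * y j\<bar> \<le> 1 * \<bar>y j\<bar>"
      unfolding abs_mult using x by (intro mult_mono) auto
    then show ?thesis by linarith
  qed
  have "(\<Prod>k\<in>insert j I. 1 + x * y k) - 1 - x * (\<Sum>k\<in>insert j I. y k)
      = R * (1 + x * y j) + x\<^sup>2 * ((\<Sum>k\<in>I. y k) * y j)"
    using insert.hyps by (simp add: R_def algebra_simps power2_eq_square)
  also have "\<bar>\<dots>\<bar> \<le> \<bar>R\<bar> * \<bar>1 + x * y j\<bar> + x\<^sup>2 * (\<bar>\<Sum>k\<in>I. y k\<bar> * \<bar>y j\<bar>)"
    by (rule order_trans[OF abs_triangle_ineq]) (simp add: abs_mult)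
  also have "\<dots> \<le> (x\<^sup>2 * Q) * (1 + \<bar>y j\<bar>) + x\<^sup>2 * ((\<Sum>k\<in>I. \<bar>y k\<bar>) * \<bar>y j\<bar>)"
    using insert.IH sum_le fac unfolding R_def[symmetric] Q_def[symmetric]
    by (intro add_mono mult_mono) auto
  also have "\<dots> = x\<^sup>2 * ((\<Prod>k\<in>insert j I. 1 + \<bar>y k\<bar>) - 1 - (\<Sum>k\<in>insert j I. \<bar>y k\<bar>))"
    using insert.hyps by (simp add: Q_def algebra_simps power2_eq_square)
  finally show ?case .
qed auto

text \<open>The factors \<open>1 + x y + x\<^sup>2 y\<^sup>2 / 2\<close> are the second-order Taylor polynomials of \<open>exp (x y)\<close>, so their
product agrees to second order with \<open>exp (x \<Sum>y)\<close>. Unlike the exponential they have a finite mean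
as soon as \<open>y\<close> has a second moment.\<close>

lemma prod_one_plus_second_order:
  fixes y :: "'k \<Rightarrow> real"
  assumes "finite I" and x: "0 \<le> x" "x \<le> 1"
  shows "\<bar>(\<Prod>k\<in>I. 1 + x * y k + x\<^sup>2 * (y k)\<^sup>2 / 2) - 1 - x * (\<Sum>k\<in>I. y k) - x\<^sup>2 * (\<Sum>k\<in>I. y k)\<^sup>2 / 2\<bar>
           \<le> x ^ 3 * ((\<Prod>k\<in>I. 1 + \<bar>y k\<bar> + (y k)\<^sup>2 / 2) - 1 - (\<Sum>k\<in>I. \<bar>y k\<bar>) - (\<Sum>k\<in>I. \<bar>y k\<bar>)\<^sup>2 / 2)"
  using \<open>finite I\<close>
proof (induction I)
  case (insert j I)
  define S where "S = (\<Sum>k\<in>I. y k)"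
  define A where "A = (\<Sum>k\<in>I. \<bar>y k\<bar>)"
  define p where "p = (\<Prod>k\<in>I. 1 + x * y k + x\<^sup>2 * (y k)\<^sup>2 / 2)"
  define q where "q = (\<Prod>k\<in>I. 1 + \<bar>y k\<bar> + (y k)\<^sup>2 / 2)"
  define R where "R = p - 1 - x * S - x\<^sup>2 * S\<^sup>2 / 2"
  define Q where "Q = q - 1 - A - A\<^sup>2 / 2"
  have SA: "\<bar>S\<bar> \<le> A" "0 \<le> A" unfolding S_def A_def by (auto intro: sum_nonneg)
  have IH: "\<bar>R\<bar> \<le> x ^ 3 * Q"
    using insert.IH by (simp add: R_def Q_def p_def q_def S_def A_def)
  have fac: "\<bar>1 + x * y j + x\<^sup>2 * (y j)\<^sup>2 / 2\<bar> \<le> 1 + \<bar>y j\<bar> + (y j)\<^sup>2 / 2"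
  proof -
    have "\<bar>x * y j\<bar> \<le> 1 * \<bar>y j\<bar>"
      unfolding abs_mult using x by (intro mult_mono) auto
    moreover have "x\<^sup>2 * (y j)\<^sup>2 \<le> 1 * (y j)\<^sup>2"
      using x by (intro mult_right_mono) (auto simp: power_le_one)
    moreover have "0 \<le> x\<^sup>2 * (y j)\<^sup>2" by simp
    ultimately show ?thesis by linarith
  qed
  have S2: "S\<^sup>2 \<le> A\<^sup>2" using SA by (metis abs_le_square_iff abs_of_nonneg)
  have x43: "x ^ 4 \<le> x ^ 3" using x by (intro power_decreasing) auto
  have expand: "p * (1 + x * y j + x\<^sup>2 * (y j)\<^sup>2 / 2) - 1 - x * (y j + S) - x\<^sup>2 * (y j + S)\<^sup>2 / 2
      = R * (1 + x * y j + x\<^sup>2 * (y j)\<^sup>2 / 2)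
          + (x ^ 3 * (S * (y j)\<^sup>2 / 2) + x ^ 3 * (S\<^sup>2 * y j / 2) + x ^ 4 * (S\<^sup>2 * (y j)\<^sup>2 / 4))"
    unfolding R_def by (simp add: field_simps eval_nat_numeral)
  have "\<bar>p * (1 + x * y j + x\<^sup>2 * (y j)\<^sup>2 / 2) - 1 - x * (y j + S) - x\<^sup>2 * (y j + S)\<^sup>2 / 2\<bar>
      \<le> \<bar>R\<bar> * \<bar>1 + x * y j + x\<^sup>2 * (y j)\<^sup>2 / 2\<bar>
          + (x ^ 3 * (\<bar>S\<bar> * (y j)\<^sup>2 / 2) + x ^ 3 * (S\<^sup>2 * \<bar>y j\<bar> / 2) + x ^ 4 * (S\<^sup>2 * (y j)\<^sup>2 / 4))"
    unfolding expand using x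
    by (intro order_trans[OF abs_triangle_ineq] add_mono) (simp_all add: abs_mult)
  also have "\<dots> \<le> (x ^ 3 * Q) * (1 + \<bar>y j\<bar> + (y j)\<^sup>2 / 2)
          + (x ^ 3 * (A * (y j)\<^sup>2 / 2) + x ^ 3 * (A\<^sup>2 * \<bar>y j\<bar> / 2) + x ^ 3 * (A\<^sup>2 * (y j)\<^sup>2 / 4))"
  proof (intro add_mono)
    show "\<bar>R\<bar> * \<bar>1 + x * y j + x\<^sup>2 * (y j)\<^sup>2 / 2\<bar> \<le> (x ^ 3 * Q) * (1 + \<bar>y j\<bar> + (y j)\<^sup>2 / 2)"
      by (rule mult_mono[OF IH fac order_trans[OF abs_ge_zero IH] abs_ge_zero])
    show "x ^ 3 * (\<bar>S\<bar> * (y j)\<^sup>2 / 2) \<le> x ^ 3 * (A * (y j)\<^sup>2 / 2)"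
      using x SA(1) by (intro mult_left_mono divide_right_mono mult_right_mono) simp_all
    show "x ^ 3 * (S\<^sup>2 * \<bar>y j\<bar> / 2) \<le> x ^ 3 * (A\<^sup>2 * \<bar>y j\<bar> / 2)"
      using x S2 by (intro mult_left_mono divide_right_mono mult_right_mono) simp_all
    show "x ^ 4 * (S\<^sup>2 * (y j)\<^sup>2 / 4) \<le> x ^ 3 * (A\<^sup>2 * (y j)\<^sup>2 / 4)"
    proof (rule mult_mono[OF x43])
      show "S\<^sup>2 * (y j)\<^sup>2 / 4 \<le> A\<^sup>2 * (y j)\<^sup>2 / 4"
        using S2 by (intro divide_right_mono mult_right_mono) simp_all
    qed (use x in simp_all)
  qed
  also have "\<dots> = x ^ 3 * (q * (1 + \<bar>y j\<bar> + (y j)\<^sup>2 / 2) - 1 - (\<bar>y j\<bar> + A) - (\<bar>y j\<bar> + A)\<^sup>2 / 2)"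
  proof -
    have "(x ^ 3 * Q) * (1 + Y + Y\<^sup>2 / 2)
          + (x ^ 3 * (A * Y\<^sup>2 / 2) + x ^ 3 * (A\<^sup>2 * Y / 2) + x ^ 3 * (A\<^sup>2 * Y\<^sup>2 / 4))
        = x ^ 3 * (q * (1 + Y + Y\<^sup>2 / 2) - 1 - (Y + A) - (Y + A)\<^sup>2 / 2)" for Y
    proof -
      have "Q * (1 + Y + Y\<^sup>2 / 2) + (A * Y\<^sup>2 / 2 + A\<^sup>2 * Y / 2 + A\<^sup>2 * Y\<^sup>2 / 4)
          = q * (1 + Y + Y\<^sup>2 / 2) - 1 - (Y + A) - (Y + A)\<^sup>2 / 2"
        unfolding Q_def
        by (simp add: algebra_simps power2_eq_square add_divide_distrib diff_divide_distrib)
      from arg_cong[OF this, of "\<lambda>w. x ^ 3 * w"] show ?thesis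
        by (simp only: distrib_left mult.assoc times_divide_eq_right)
    qed
    from this[of "\<bar>y j\<bar>"] show ?thesis by (simp only: power2_abs)
  qed
  finally show ?case
    using insert.hyps by (simp add: S_def A_def p_def q_def mult.commute)
qed auto

lemma exp_second_order:
  fixes b c :: real
  shows "\<exists>K. \<forall>x. 0 \<le> x \<longrightarrow> x \<le> 1 \<longrightarrow>
    \<bar>exp (x * b + x\<^sup>2 * c / 2) - 1 - x * b - x\<^sup>2 * (c + b\<^sup>2) / 2\<bar> \<le> K * x ^ 3"
proof (intro exI allI impI)
  fix x :: real assume x: "0 \<le> x" "x \<le> 1"
  define u where "u = x * b + x\<^sup>2 * c / 2"
  define k where "k = \<bar>b\<bar> + \<bar>c\<bar>"
  have x2: "x\<^sup>2 \<le> x" using x by (simp add: power2_eq_square mult_left_le)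
  have x43: "x ^ 4 \<le> x ^ 3" using x by (intro power_decreasing) auto
  have u: "\<bar>u\<bar> \<le> x * k"
  proof -
    have "\<bar>u\<bar> \<le> x * \<bar>b\<bar> + x\<^sup>2 * \<bar>c\<bar> / 2"
      unfolding u_def using x by (intro order_trans[OF abs_triangle_ineq]) (simp add: abs_mult)
    also have "\<dots> \<le> x * \<bar>b\<bar> + x * \<bar>c\<bar>"
    proof -
      have "x\<^sup>2 * \<bar>c\<bar> \<le> x * \<bar>c\<bar>" using x2 by (rule mult_right_mono) simp
      moreover have "0 \<le> x\<^sup>2 * \<bar>c\<bar>" by simp
      ultimately show ?thesis by linarith
    qed
    finally show ?thesis by (simp add: k_def algebra_simps)
  qed
  have k0: "0 \<le> k" by (simp add: k_def)
  obtain t where t: "\<bar>t\<bar> \<le> \<bar>u\<bar>" "exp u = (\<Sum>m<3. u ^ m / fact m) + (exp t / fact 3) * u ^ 3"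
    using Maclaurin_exp_le[of u 3] by blast
  have eu: "exp u = 1 + u + u\<^sup>2 / 2 + exp t / 6 * u ^ 3"
    using t(2) by (simp add: eval_nat_numeral lessThan_Suc)
  have "t \<le> k"
  proof -
    have "\<bar>u\<bar> \<le> 1 * k" using u mult_right_mono[OF x(2) k0] by linarith
    then show ?thesis using t(1) by linarith
  qed
  then have "\<bar>exp t / 6 * u ^ 3\<bar> \<le> exp k / 6 * (x * k) ^ 3"
    unfolding abs_mult power_abs using u by (intro mult_mono power_mono) auto
  then have rem: "\<bar>exp t / 6 * u ^ 3\<bar> \<le> (exp k / 6 * k ^ 3) * x ^ 3"
    by (simp add: power_mult_distrib mult_ac)
  have "exp u - 1 - x * b - x\<^sup>2 * (c + b\<^sup>2) / 2
      = exp t / 6 * u ^ 3 + (x ^ 3 * (b * c / 2) + x ^ 4 * (c\<^sup>2 / 8))"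
    unfolding eu unfolding u_def by (simp add: field_simps eval_nat_numeral)
  also have "\<bar>\<dots>\<bar> \<le> \<bar>exp t / 6 * u ^ 3\<bar> + (x ^ 3 * \<bar>b * c / 2\<bar> + x ^ 4 * (c\<^sup>2 / 8))"
    using x by (intro order_trans[OF abs_triangle_ineq] add_mono) (simp_all add: abs_mult)
  also have "\<dots> \<le> (exp k / 6 * k ^ 3) * x ^ 3 + (x ^ 3 * \<bar>b * c / 2\<bar> + x ^ 3 * (c\<^sup>2 / 8))"
    using rem x43 by (intro add_mono mult_right_mono) auto
  also have "\<dots> = (exp k / 6 * k ^ 3 + \<bar>b * c / 2\<bar> + c\<^sup>2 / 8) * x ^ 3"
    by (simp add: algebra_simps)
  finally show "\<bar>exp (x * b + x\<^sup>2 * c / 2) - 1 - x * b - x\<^sup>2 * (c + b\<^sup>2) / 2\<bar>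
     \<le> (exp (\<bar>b\<bar> + \<bar>c\<bar>) / 6 * (\<bar>b\<bar> + \<bar>c\<bar>) ^ 3 + \<bar>b * c / 2\<bar> + c\<^sup>2 / 8) * x ^ 3"
    by (simp add: u_def k_def)
qed

text \<open>This is how coefficients of \<open>x ^ n\<close> are compared: two expansions that agree up to \<open>O(x ^ (n + 1))\<close> and
in their lower coefficients agree in the next one.\<close>

lemma eq_zero_if_higher_order:
  fixes c K :: real
  assumes "\<And>x. 0 < x \<Longrightarrow> x \<le> 1 \<Longrightarrow> x ^ n * \<bar>c\<bar> \<le> K * x ^ Suc n"
  shows "c = 0"
proof (rule ccontr)
  assume c: "c \<noteq> 0"
  have le: "\<bar>c\<bar> \<le> K * x" if "0 < x" "x \<le> 1" for x
    using assms[OF that] that by (simp add: mult.left_commute)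
  then have K: "0 < K" using c le[of 1] by auto
  define x where "x = min 1 (\<bar>c\<bar> / (2 * K))"
  have "0 < x" "x \<le> 1" using c K by (auto simp: x_def)
  moreover have "K * x \<le> \<bar>c\<bar> / 2"
    using K mult_left_mono[of x "\<bar>c\<bar> / (2 * K)" K] by (simp add: x_def)
  ultimately show False using le c by fastforce
qed

lemma powser_zero_imp_coeff_zero:
  fixes a :: "nat \<Rightarrow> real"
  assumes "\<And>x. x \<noteq> 0 \<Longrightarrow> \<bar>x\<bar> < 1 \<Longrightarrow> (\<lambda>n. a n * x ^ n) sums 0"
  shows "a n = 0"
  using assms
proof (induction n arbitrary: a)
  case 0
  have "((\<lambda>x::real. 0) \<longlongrightarrow> a 0) (at 0)"
    using 0 by (intro powser_limit_0_strong[of 1]) auto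
  then show ?case by (metis LIM_const_eq)
next
  case (Suc n)
  have "((\<lambda>x::real. 0) \<longlongrightarrow> a 0) (at 0)"
    using Suc.prems by (intro powser_limit_0_strong[of 1]) auto
  then have a0: "a 0 = 0" by (metis LIM_const_eq)
  show ?case
  proof (rule Suc.IH[of "\<lambda>n. a (Suc n)"])
    fix x :: real assume x: "x \<noteq> 0" "\<bar>x\<bar> < 1"
    have "(\<lambda>n. a (Suc n) * x ^ Suc n) sums 0"
      using Suc.prems[OF x] a0 by (subst sums_Suc_iff) simp
    then have "(\<lambda>n. (1 / x) * (a (Suc n) * x ^ Suc n)) sums ((1 / x) * 0)"
      by (rule sums_mult)
    then show "(\<lambda>n. a (Suc n) * x ^ n) sums 0" using x by simp
  qed
qed

section \<open>Generating functions and conditioning on a count\<close>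

context prob_space
begin

lemma expectation_by_nat_values:
  fixes R :: "'a \<Rightarrow> nat" and f :: "nat \<Rightarrow> 'a \<Rightarrow> real"
  assumes [measurable]: "R \<in> measurable M (count_space UNIV)"
    and f: "\<And>n. integrable M (\<lambda>\<omega>. indicator {\<omega>\<in>space M. R \<omega> = n} \<omega> * f n \<omega>)"
    and s: "summable (\<lambda>n. expectation (\<lambda>\<omega>. \<bar>indicator {\<omega>\<in>space M. R \<omega> = n} \<omega> * f n \<omega>\<bar>))"
  shows "integrable M (\<lambda>\<omega>. f (R \<omega>) \<omega>)"
    and "(\<lambda>n. expectation (\<lambda>\<omega>. indicator {\<omega>\<in>space M. R \<omega> = n} \<omega> * f n \<omega>)) sums expectation (\<lambda>\<omega>. f (R \<omega>) \<omega>)"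
proof -
  let ?f = "\<lambda>n \<omega>. indicator {\<omega>\<in>space M. R \<omega> = n} \<omega> * f n \<omega>"
  have eq: "(\<lambda>n. ?f n \<omega>) sums f (R \<omega>) \<omega>" if "\<omega> \<in> space M" for \<omega>
  proof -
    have "(\<lambda>n. ?f n \<omega>) = (\<lambda>n. if n = R \<omega> then f n \<omega> else 0)"
      using that by (auto simp: indicator_def fun_eq_iff)
    then show ?thesis using sums_single[of "R \<omega>" "\<lambda>n. f n \<omega>"] by simp
  qed
  have ae: "AE \<omega> in M. summable (\<lambda>n. norm (?f n \<omega>))"
  proof (rule AE_I2)
    fix \<omega> assume "\<omega> \<in> space M"
    show "summable (\<lambda>n. norm (?f n \<omega>))"
      by (rule summable_finite[of "{R \<omega>}"]) (auto simp: indicator_def)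
  qed
  have cong: "(\<Sum>n. ?f n \<omega>) = f (R \<omega>) \<omega>" if "\<omega> \<in> space M" for \<omega>
    using sums_unique[OF eq[OF that]] by simp
  have "integrable M (\<lambda>\<omega>. \<Sum>n. ?f n \<omega>)"
    using s by (intro integrable_suminf f ae) simp
  then show "integrable M (\<lambda>\<omega>. f (R \<omega>) \<omega>)"
    by (rule Bochner_Integration.integrable_cong[THEN iffD1, OF refl cong, rotated])
  have "(\<lambda>n. expectation (?f n)) sums expectation (\<lambda>\<omega>. \<Sum>n. ?f n \<omega>)"
    using s by (intro sums_integral f ae) simp
  also have "expectation (\<lambda>\<omega>. \<Sum>n. ?f n \<omega>) = expectation (\<lambda>\<omega>. f (R \<omega>) \<omega>)"
    by (intro Bochner_Integration.integral_cong refl cong)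
  finally show "(\<lambda>n. expectation (?f n)) sums expectation (\<lambda>\<omega>. f (R \<omega>) \<omega>)" .
qed

lemma poisson_genfun:
  fixes R :: "'a \<Rightarrow> nat" and c m :: real
  assumes [measurable]: "R \<in> measurable M (count_space UNIV)"
    and p: "\<And>n. prob {\<omega>\<in>space M. R \<omega> = n} = m ^ n / fact n * exp (- m)"
  shows "integrable M (\<lambda>\<omega>. c ^ R \<omega>)"
    and "expectation (\<lambda>\<omega>. c ^ R \<omega>) = exp ((c - 1) * m)"
proof -
  have e: "expectation (\<lambda>\<omega>. indicator {\<omega>\<in>space M. R \<omega> = n} \<omega> * d) = exp (- m) * ((d * m ^ n) /\<^sub>R fact n)"
    for n and d :: real
    by (simp add: p measure_def[symmetric] field_simps)
  have e': "expectation (\<lambda>\<omega>. indicator {\<omega>\<in>space M. R \<omega> = n} \<omega> * c ^ n) = exp (- m) * ((c * m) ^ n /\<^sub>R fact n)" for n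
    by (simp only: e power_mult_distrib)
  have ab: "expectation (\<lambda>\<omega>. \<bar>indicator {\<omega>\<in>space M. R \<omega> = n} \<omega> * c ^ n\<bar>) = exp (- m) * ((\<bar>c\<bar> * m) ^ n /\<^sub>R fact n)" for n
    using e[of n "\<bar>c\<bar> ^ n"] by (simp only: abs_mult power_abs abs_indicator power_mult_distrib)
  have i: "integrable M (\<lambda>\<omega>. indicator {\<omega>\<in>space M. R \<omega> = n} \<omega> * c ^ n)" for n
    by (intro integrable_mult_left integrable_real_indicator) (auto simp: emeasure_eq_measure)
  have s: "(\<lambda>n. exp (- m) * ((d * m) ^ n /\<^sub>R fact n)) sums (exp (- m) * exp (d * m))" for d
    by (intro sums_mult exp_converges)
  note E = expectation_by_nat_values[OF assms(1), of "\<lambda>n _. c ^ n", OF i]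
  show "integrable M (\<lambda>\<omega>. c ^ R \<omega>)"
    by (rule E(1)) (simp only: ab sums_summable[OF s])
  have "(\<lambda>n. exp (- m) * ((c * m) ^ n /\<^sub>R fact n)) sums expectation (\<lambda>\<omega>. c ^ R \<omega>)"
    unfolding e'[symmetric] by (rule E(2)) (simp only: ab sums_summable[OF s])
  from sums_unique2[OF this s] show "expectation (\<lambda>\<omega>. c ^ R \<omega>) = exp ((c - 1) * m)"
    by (simp add: exp_add[symmetric] algebra_simps)
qed

text \<open>If \<open>R\<close> is Poisson with mean \<open>m\<close>, then multiplying its generating function \<open>exp ((z - 1) m)\<close> by \<open>z\<close>
shifts the Poisson weights by one, and the shifted weight at \<open>l\<close> is \<open>l / m\<close> times the weight
at \<open>l\<close>. Quadratic prefactors suffice because only the first two moments of \<open>V\<close> given \<open>R\<close> are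
needed, and these are polynomials in \<open>l\<close> of degree at most two.\<close>

lemma expectation_on_level_from_genfun:
  fixes R :: "'a \<Rightarrow> nat" and V :: "'a \<Rightarrow> real" and m c0 c1 c2 :: real
  assumes [measurable]: "R \<in> measurable M (count_space UNIV)"
    and V: "integrable M V" and m: "0 < m"
    and gf: "\<And>z. \<bar>z\<bar> < 1 \<Longrightarrow>
      expectation (\<lambda>\<omega>. z ^ R \<omega> * V \<omega>) = (c0 + c1 * z + c2 * z\<^sup>2) * exp ((z - 1) * m)"
  shows "expectation (\<lambda>\<omega>. indicator {\<omega>\<in>space M. R \<omega> = l} \<omega> * V \<omega>)
    = m ^ l / fact l * exp (- m) * (c0 + c1 * (real l / m) + c2 * (real l * (real l - 1) / m\<^sup>2))"
proof -
  define v where "v n = expectation (\<lambda>\<omega>. indicator {\<omega>\<in>space M. R \<omega> = n} \<omega> * V \<omega>)" for n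
  define p where "p n = m ^ n / fact n * exp (- m)" for n
  define q where "q n = p n * (c0 + c1 * (real n / m) + c2 * (real n * (real n - 1) / m\<^sup>2))" for n
  have i: "integrable M (\<lambda>\<omega>. indicator {\<omega>\<in>space M. R \<omega> = n} \<omega> * V \<omega>)" for n
    using integrable_mult_indicator[OF _ V, of "{\<omega>\<in>space M. R \<omega> = n}"] by simp
  have v: "(\<lambda>n. v n * z ^ n) sums expectation (\<lambda>\<omega>. z ^ R \<omega> * V \<omega>)" if z: "\<bar>z\<bar> < 1" for z
  proof -
    have i': "integrable M (\<lambda>\<omega>. indicator {\<omega>\<in>space M. R \<omega> = n} \<omega> * (z ^ n * V \<omega>))" for n
      using integrable_mult_left[OF i[of n], of "z ^ n"] by (simp add: mult_ac)
    have "(\<lambda>n. expectation (\<lambda>\<omega>. indicator {\<omega>\<in>space M. R \<omega> = n} \<omega> * (z ^ n * V \<omega>)))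
        sums expectation (\<lambda>\<omega>. z ^ R \<omega> * V \<omega>)"
    proof (rule expectation_by_nat_values(2)[OF assms(1), of "\<lambda>n \<omega>. z ^ n * V \<omega>", OF i'])
      show "summable (\<lambda>n. expectation (\<lambda>\<omega>. \<bar>indicator {\<omega>\<in>space M. R \<omega> = n} \<omega> * (z ^ n * V \<omega>)\<bar>))"
      proof (rule summable_comparison_test'[of "\<lambda>n. expectation (\<lambda>\<omega>. \<bar>V \<omega>\<bar>) * \<bar>z\<bar> ^ n" 0])
        show "summable (\<lambda>n. expectation (\<lambda>\<omega>. \<bar>V \<omega>\<bar>) * \<bar>z\<bar> ^ n)"
          using z by (intro summable_mult summable_geometric) simp
        fix n :: nat
        have "expectation (\<lambda>\<omega>. \<bar>indicator {\<omega>\<in>space M. R \<omega> = n} \<omega> * (z ^ n * V \<omega>)\<bar>)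
            \<le> expectation (\<lambda>\<omega>. \<bar>V \<omega>\<bar> * \<bar>z\<bar> ^ n)"
          using V i'[of n]
          by (intro integral_mono integrable_abs integrable_mult_left)
            (auto simp: abs_mult indicator_def power_abs mult.commute)
        then show "norm (expectation (\<lambda>\<omega>. \<bar>indicator {\<omega>\<in>space M. R \<omega> = n} \<omega> * (z ^ n * V \<omega>)\<bar>))
            \<le> expectation (\<lambda>\<omega>. \<bar>V \<omega>\<bar>) * \<bar>z\<bar> ^ n"
          by simp
      qed
    qed
    also have "(\<lambda>n. expectation (\<lambda>\<omega>. indicator {\<omega>\<in>space M. R \<omega> = n} \<omega> * (z ^ n * V \<omega>))) = (\<lambda>n. v n * z ^ n)"
    proof
      fix n
      have "expectation (\<lambda>\<omega>. indicator {\<omega>\<in>space M. R \<omega> = n} \<omega> * (z ^ n * V \<omega>))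
          = expectation (\<lambda>\<omega>. (indicator {\<omega>\<in>space M. R \<omega> = n} \<omega> * V \<omega>) * z ^ n)"
        by (intro Bochner_Integration.integral_cong) (auto simp: mult_ac)
      then show "expectation (\<lambda>\<omega>. indicator {\<omega>\<in>space M. R \<omega> = n} \<omega> * (z ^ n * V \<omega>)) = v n * z ^ n"
        by (simp add: v_def)
    qed
    finally show ?thesis .
  qed
  have p0: "(\<lambda>n. p n * z ^ n) sums exp ((z - 1) * m)" for z
  proof -
    have "(\<lambda>n. exp (- m) * ((z * m) ^ n /\<^sub>R fact n)) sums (exp (- m) * exp (z * m))"
      by (intro sums_mult exp_converges)
    moreover have "exp (- m) * ((z * m) ^ n /\<^sub>R fact n) = p n * z ^ n" for n
      by (simp add: p_def power_mult_distrib divide_inverse mult_ac)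
    moreover have "exp (- m) * exp (z * m) = exp ((z - 1) * m)"
      by (simp add: exp_add[symmetric] algebra_simps)
    ultimately show ?thesis by (simp only:)
  qed
  have shift: "(\<lambda>n. (case n of 0 \<Rightarrow> 0 | Suc k \<Rightarrow> f k) * z ^ n) sums (z * s)"
    if "(\<lambda>n. f n * z ^ n) sums s" for f :: "nat \<Rightarrow> real" and z s
  proof -
    have "(\<lambda>n. z * (f n * z ^ n)) sums (z * s)" by (rule sums_mult[OF that])
    then show ?thesis
      using sums_Suc[of "\<lambda>n. (case n of 0 \<Rightarrow> 0 | Suc k \<Rightarrow> f k) * z ^ n" "z * s"]
      by (simp add: mult.left_commute)
  qed
  \<comment> \<open>The recursion of the Poisson weights, which turns the shifts below into polynomial factors.\<close>
  have pS: "p (Suc k) * (real (Suc k) / m) = p k" for k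
    using m by (simp add: p_def fact_Suc del: of_nat_Suc)
  have p1: "(\<lambda>n. (p n * (real n / m)) * z ^ n) sums (z * exp ((z - 1) * m))" for z
  proof -
    have "(case n of 0 \<Rightarrow> 0 | Suc k \<Rightarrow> p k) = p n * (real n / m)" for n
      using pS by (cases n) (simp_all del: of_nat_Suc)
    then show ?thesis using shift[OF p0[of z]] by simp
  qed
  have p2: "(\<lambda>n. (p n * (real n * (real n - 1) / m\<^sup>2)) * z ^ n) sums (z * (z * exp ((z - 1) * m)))" for z
  proof -
    have "(case n of 0 \<Rightarrow> 0 | Suc k \<Rightarrow> p k * (real k / m)) = p n * (real n * (real n - 1) / m\<^sup>2)" for n
    proof (cases n)
      case (Suc k)
      have "p (Suc k) * (real (Suc k) * (real (Suc k) - 1) / m\<^sup>2) = p (Suc k) * (real (Suc k) / m) * (real k / m)"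
        by (simp add: power2_eq_square)
      then show ?thesis by (simp only: Suc nat.case pS)
    qed simp
    then show ?thesis using shift[OF p1[of z]] by simp
  qed
  have q: "(\<lambda>n. q n * z ^ n) sums ((c0 + c1 * z + c2 * z\<^sup>2) * exp ((z - 1) * m))" for z
  proof -
    have "(\<lambda>n. c0 * (p n * z ^ n) + c1 * ((p n * (real n / m)) * z ^ n)
           + c2 * ((p n * (real n * (real n - 1) / m\<^sup>2)) * z ^ n))
        sums (c0 * exp ((z - 1) * m) + c1 * (z * exp ((z - 1) * m)) + c2 * (z * (z * exp ((z - 1) * m))))"
      by (intro sums_add sums_mult p0 p1 p2)
    moreover have "c0 * (p n * z ^ n) + c1 * ((p n * (real n / m)) * z ^ n)
           + c2 * ((p n * (real n * (real n - 1) / m\<^sup>2)) * z ^ n) = q n * z ^ n" for n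
      by (simp add: q_def algebra_simps)
    ultimately show ?thesis by (simp add: algebra_simps power2_eq_square)
  qed
  have "v l - q l = 0"
  proof (rule powser_zero_imp_coeff_zero[where a = "\<lambda>n. v n - q n"])
    fix z :: real assume z: "\<bar>z\<bar> < 1"
    have "(\<lambda>n. v n * z ^ n - q n * z ^ n) sums
        (expectation (\<lambda>\<omega>. z ^ R \<omega> * V \<omega>) - (c0 + c1 * z + c2 * z\<^sup>2) * exp ((z - 1) * m))"
      by (intro sums_diff v q z)
    then show "(\<lambda>n. (v n - q n) * z ^ n) sums 0"
      by (simp add: gf[OF z] left_diff_distrib)
  qed
  then show ?thesis by (simp add: v_def q_def p_def)
qed

lemma uniform_measure_expectation:
  fixes V :: "'a \<Rightarrow> real"
  assumes A: "A \<in> events" and pos: "0 < prob A" and V: "integrable M V"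
  shows "integrable (uniform_measure M A) V"
    and "(\<integral>\<omega>. V \<omega> \<partial>uniform_measure M A) = expectation (\<lambda>\<omega>. indicator A \<omega> * V \<omega>) / prob A"
proof -
  have u: "uniform_measure M A = density M (\<lambda>\<omega>. ennreal (indicator A \<omega> / prob A))"
  proof -
    have "indicator A \<omega> / emeasure M A = ennreal (indicator A \<omega> / prob A)" for \<omega>
      using pos by (auto simp: emeasure_eq_measure divide_ennreal[symmetric] ennreal_indicator)
    then show ?thesis unfolding uniform_measure_def by simp
  qed
  have m: "(\<lambda>\<omega>. indicator A \<omega> / prob A :: real) \<in> borel_measurable M"
    using A by simp
  have Vm: "V \<in> borel_measurable M" using V by simp
  have i: "integrable M (\<lambda>\<omega>. indicator A \<omega> / prob A * V \<omega>)"
    using integrable_mult_right[OF integrable_mult_indicator[OF A V], of "1 / prob A"] by simp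
  show "integrable (uniform_measure M A) V"
    unfolding u by (subst integrable_real_density[OF m _ Vm]) (use i pos in auto)
  have "(\<integral>\<omega>. V \<omega> \<partial>uniform_measure M A) = expectation (\<lambda>\<omega>. indicator A \<omega> / prob A * V \<omega>)"
    unfolding u by (rule integral_real_density[OF m _ Vm]) (use pos in auto)
  also have "\<dots> = expectation (\<lambda>\<omega>. (indicator A \<omega> * V \<omega>) / prob A)"
    by simp
  also have "\<dots> = expectation (\<lambda>\<omega>. indicator A \<omega> * V \<omega>) / prob A"
    by (rule integral_divide_zero)
  finally show "(\<integral>\<omega>. V \<omega> \<partial>uniform_measure M A) = expectation (\<lambda>\<omega>. indicator A \<omega> * V \<omega>) / prob A" .
qed

end

section \<open>Evaluating a path at a random time\<close>

text \<open>Evaluation of a function at a point is not measurable jointly in the point and the function for the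
product \<open>\<sigma>\<close>-algebra on all functions. This limit along dyadic points to the right of \<open>u\<close> is, since it
involves countably many coordinates only, and it is the value at \<open>u\<close> of a right-continuous function.\<close>

definition path_value :: "real \<Rightarrow> (real \<Rightarrow> real) \<Rightarrow> real" where
  "path_value u p = lim (\<lambda>n. p (real_of_int (\<lfloor>u * 2 ^ n\<rfloor> + 1) / 2 ^ n))"

lemma path_value_measurable:
  "(\<lambda>(u, p). path_value u p) \<in> borel_measurable (borel \<Otimes>\<^sub>M (\<Pi>\<^sub>M _\<in>UNIV. borel))"
proof -
  have "(\<lambda>x :: real \<times> (real \<Rightarrow> real). snd x (real_of_int (\<lfloor>fst x * 2 ^ n\<rfloor> + 1) / 2 ^ n))
      \<in> borel_measurable (borel \<Otimes>\<^sub>M (\<Pi>\<^sub>M _\<in>UNIV. borel :: real measure))" for n :: nat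
  \<comment> \<open>For fixed n the path is read at countably many dyadic points, one for each value of the floor.\<close>
  proof (rule measurable_compose_countable[where f = "\<lambda>i x :: real \<times> (real \<Rightarrow> real). snd x (real_of_int (i + 1) / 2 ^ n)"
        and g = "\<lambda>x :: real \<times> (real \<Rightarrow> real). \<lfloor>fst x * 2 ^ n\<rfloor>"])
    fix i :: int
    show "(\<lambda>x. snd x (real_of_int (i + 1) / 2 ^ n))
        \<in> borel_measurable (borel \<Otimes>\<^sub>M (\<Pi>\<^sub>M _\<in>UNIV. borel :: real measure))"
      by (rule measurable_compose[OF measurable_snd measurable_component_singleton]) simp
  qed measurable
  then show ?thesis
    unfolding path_value_def case_prod_beta by (rule borel_measurable_lim_metric)
qed

lemma path_value_eq:
  assumes "continuous (at_right u) p"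
  shows "path_value u p = p u"
proof -
  let ?d = "\<lambda>n::nat. real_of_int (\<lfloor>u * 2 ^ n\<rfloor> + 1) / 2 ^ n"
  have gt: "u < ?d n" for n
  proof -
    have "u * 2 ^ n < real_of_int (\<lfloor>u * 2 ^ n\<rfloor> + 1)" by linarith
    then show ?thesis by (simp add: field_simps)
  qed
  have le: "?d n \<le> u + (1 / 2) ^ n" for n
  proof -
    have "real_of_int (\<lfloor>u * 2 ^ n\<rfloor> + 1) \<le> u * 2 ^ n + 1" by linarith
    then have "?d n \<le> (u * 2 ^ n + 1) / 2 ^ n" by (rule divide_right_mono) simp
    then show ?thesis by (simp add: add_divide_distrib power_one_over)
  qed
  have "(\<lambda>n. u + (1 / 2) ^ n) \<longlonglongrightarrow> u + 0"
    by (intro tendsto_add tendsto_const LIMSEQ_power_zero) simp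
  then have "?d \<longlonglongrightarrow> u"
    using gt le by (intro tendsto_sandwich[where f = "\<lambda>_. u" and g = ?d and h = "\<lambda>n. u + (1 / 2) ^ n"])
      (auto intro: always_eventually less_imp_le)
  then have "filterlim ?d (at_right u) sequentially"
    unfolding filterlim_at using gt by (auto intro!: always_eventually simp: less_imp_neq[symmetric])
  moreover have "(p \<longlongrightarrow> p u) (at_right u)"
    using assms by (simp add: continuous_within)
  ultimately have "(\<lambda>n. p (?d n)) \<longlonglongrightarrow> p u"
    by (rule filterlim_compose[rotated])
  then show ?thesis unfolding path_value_def by (rule limI)
qed

section \<open>Uniform moment bounds for additive processes\<close>

lemma power_add_le:
  fixes a c :: real assumes "0 \<le> a" "0 \<le> c"
  shows "(a + c) ^ i \<le> 2 ^ i * (a ^ i + c ^ i)"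
proof -
  have "(a + c) ^ i \<le> (2 * max a c) ^ i" using assms by (intro power_mono) auto
  also have "\<dots> = 2 ^ i * (max a c) ^ i" by (simp add: power_mult_distrib)
  also have "(max a c) ^ i \<le> a ^ i + c ^ i" using assms by (auto simp: max_def)
  finally show ?thesis by simp
qed

context prob_space
begin

lemma tail_prob_small:
  fixes X :: "'a \<Rightarrow> real"
  assumes [measurable]: "X \<in> borel_measurable M" and e: "0 < e"
  shows "\<exists>c. prob {\<omega>\<in>space M. \<bar>X \<omega>\<bar> > c} < e"
proof -
  let ?A = "\<lambda>n::nat. {\<omega>\<in>space M. \<bar>X \<omega>\<bar> > real n}"
  have "(\<lambda>n. prob (?A n)) \<longlonglongrightarrow> prob (\<Inter>n. ?A n)"
    by (rule finite_Lim_measure_decseq) (auto simp: decseq_def)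
  moreover have "(\<Inter>n. ?A n) = {}"
  proof (intro equals0I)
    fix \<omega> assume \<omega>: "\<omega> \<in> (\<Inter>n. ?A n)"
    obtain n :: nat where n: "\<bar>X \<omega>\<bar> < real n" using reals_Archimedean2 by blast
    have "\<omega> \<in> ?A n" using \<omega> by (rule INT_D) simp
    then show False using n by simp
  qed
  ultimately have "(\<lambda>n. prob (?A n)) \<longlonglongrightarrow> 0" by simp
  then have "eventually (\<lambda>n. prob (?A n) < e) sequentially"
    using e by (rule order_tendstoD)
  then obtain n where "prob (?A n) < e" by (auto simp: eventually_sequentially)
  then show ?thesis by blast
qed

text \<open>Stochastic continuity bounds the tails uniformly in a neighbourhood of each time, and compactness of the
interval makes the bound uniform. The constant 1/4 leaves room for differences of two
values to exceed \<open>2 c\<close> with probability at most 1/2.\<close>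

lemma additive_process_tight:
  assumes L: "additive_process M L" and b: "0 \<le> b"
  shows "\<exists>c. \<forall>u\<in>{0..b}. prob {\<omega>\<in>space M. \<bar>L u \<omega>\<bar> > c} \<le> 1 / 4"
proof -
  have [measurable]: "L u \<in> borel_measurable M" for u
    using L by (simp add: additive_process_def)
  have cont: "((\<lambda>s. prob {\<omega>\<in>space M. \<bar>L s \<omega> - L x \<omega>\<bar> > 1}) \<longlongrightarrow> 0) (at x within {0..})" if "0 \<le> x" for x
    using L that by (auto simp: additive_process_def)
  have "\<exists>c. \<forall>u\<in>{0..b}. 0 \<le> u \<longrightarrow> prob {\<omega>\<in>space M. \<bar>L u \<omega>\<bar> > c} \<le> 1 / 4"
  \<comment> \<open>Bisection: the property of an interval is inherited by unions of adjacent intervals and holds locally.\<close>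
  proof (rule Bolzano[OF b, of "\<lambda>v w. \<exists>c. \<forall>u\<in>{v..w}. 0 \<le> u \<longrightarrow> prob {\<omega>\<in>space M. \<bar>L u \<omega>\<bar> > c} \<le> 1 / 4"])
    fix v w x assume "\<exists>c. \<forall>u\<in>{v..w}. 0 \<le> u \<longrightarrow> prob {\<omega>\<in>space M. \<bar>L u \<omega>\<bar> > c} \<le> 1 / 4"
      and "\<exists>c. \<forall>u\<in>{w..x}. 0 \<le> u \<longrightarrow> prob {\<omega>\<in>space M. \<bar>L u \<omega>\<bar> > c} \<le> 1 / 4"
    then obtain c d where c: "\<And>u. u \<in> {v..w} \<Longrightarrow> 0 \<le> u \<Longrightarrow> prob {\<omega>\<in>space M. \<bar>L u \<omega>\<bar> > c} \<le> 1 / 4"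
      and d: "\<And>u. u \<in> {w..x} \<Longrightarrow> 0 \<le> u \<Longrightarrow> prob {\<omega>\<in>space M. \<bar>L u \<omega>\<bar> > d} \<le> 1 / 4" by blast
    have mono: "prob {\<omega>\<in>space M. \<bar>L u \<omega>\<bar> > max c d} \<le> prob {\<omega>\<in>space M. \<bar>L u \<omega>\<bar> > c}"
      "prob {\<omega>\<in>space M. \<bar>L u \<omega>\<bar> > max c d} \<le> prob {\<omega>\<in>space M. \<bar>L u \<omega>\<bar> > d}" for u
      by (auto intro!: finite_measure_mono)
    show "\<exists>c. \<forall>u\<in>{v..x}. 0 \<le> u \<longrightarrow> prob {\<omega>\<in>space M. \<bar>L u \<omega>\<bar> > c} \<le> 1 / 4"
    proof (intro exI[of _ "max c d"] ballI impI)
      fix u assume u: "u \<in> {v..x}" "0 \<le> u"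
      show "prob {\<omega>\<in>space M. \<bar>L u \<omega>\<bar> > max c d} \<le> 1 / 4"
      proof (cases "u \<le> w")
        case True then show ?thesis using c[of u] mono(1)[of u] u by simp
      next
        case False then show ?thesis using d[of u] mono(2)[of u] u by simp
      qed
    qed
  next
    fix x assume x: "0 \<le> x" "x \<le> b"
    obtain c where c: "prob {\<omega>\<in>space M. \<bar>L x \<omega>\<bar> > c} < 1 / 8"
      using tail_prob_small[of "L x" "1 / 8"] by auto
    have "eventually (\<lambda>s. prob {\<omega>\<in>space M. \<bar>L s \<omega> - L x \<omega>\<bar> > 1} < 1 / 8) (at x within {0..})"
      by (rule order_tendstoD[OF cont[OF x(1)]]) simp
    then obtain d where d: "d > 0" "\<And>s. 0 \<le> s \<Longrightarrow> s \<noteq> x \<Longrightarrow> dist s x < d \<Longrightarrow>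
        prob {\<omega>\<in>space M. \<bar>L s \<omega> - L x \<omega>\<bar> > 1} < 1 / 8"
      unfolding eventually_at by auto
    have near: "prob {\<omega>\<in>space M. \<bar>L s \<omega> - L x \<omega>\<bar> > 1} < 1 / 8" if "0 \<le> s" "dist s x < d" for s
      using d(2)[OF that(1) _ that(2)] by (cases "s = x") auto
    have bd: "prob {\<omega>\<in>space M. \<bar>L u \<omega>\<bar> > c + 1} \<le> 1 / 4"
      if vw: "v \<le> x \<and> x \<le> w \<and> w - v < d" and u: "u \<in> {v..w}" "0 \<le> u" for v w u
    proof -
      have "prob {\<omega>\<in>space M. \<bar>L u \<omega>\<bar> > c + 1}
          \<le> prob ({\<omega>\<in>space M. \<bar>L u \<omega> - L x \<omega>\<bar> > 1} \<union> {\<omega>\<in>space M. \<bar>L x \<omega>\<bar> > c})"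
        by (intro finite_measure_mono) auto
      also have "\<dots> \<le> prob {\<omega>\<in>space M. \<bar>L u \<omega> - L x \<omega>\<bar> > 1} + prob {\<omega>\<in>space M. \<bar>L x \<omega>\<bar> > c}"
        by (rule measure_Un_le) auto
      also have "\<dots> \<le> 1 / 8 + 1 / 8"
      proof (intro add_mono)
        have "\<bar>u - x\<bar> < d" using vw u by auto
        then show "prob {\<omega>\<in>space M. \<bar>L u \<omega> - L x \<omega>\<bar> > 1} \<le> 1 / 8"
          using near[of u] u by (simp add: dist_real_def)
      qed (use c in simp)
      finally show ?thesis by simp
    qed
    show "\<exists>d>0. \<forall>v w. v \<le> x \<and> x \<le> w \<and> w - v < d \<longrightarrow>
        (\<exists>c. \<forall>u\<in>{v..w}. 0 \<le> u \<longrightarrow> prob {\<omega>\<in>space M. \<bar>L u \<omega>\<bar> > c} \<le> 1 / 4)"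
    proof (rule exI[of _ d], intro conjI allI impI)
      fix v w assume "v \<le> x \<and> x \<le> w \<and> w - v < d"
      then show "\<exists>c. \<forall>u\<in>{v..w}. 0 \<le> u \<longrightarrow> prob {\<omega>\<in>space M. \<bar>L u \<omega>\<bar> > c} \<le> 1 / 4"
        by (intro exI[of _ "c + 1"] ballI impI bd)
    qed (rule d(1))
  qed
  then show ?thesis by auto
qed

text \<open>On the event that \<open>\<bar>X 1\<bar> \<le> c\<close>, which has probability at least 1/2 and is independent of \<open>X 0\<close>, the
summand \<open>X 0\<close> is at most \<open>\<bar>X 0 + X 1\<bar> + c\<close>.\<close>

lemma moment_le_moment_sum_indep:
  fixes X :: "nat \<Rightarrow> 'a \<Rightarrow> real"
  assumes ind: "indep_vars (\<lambda>_. borel) X {..<2}"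
    and c: "prob {\<omega>\<in>space M. \<bar>X 1 \<omega>\<bar> > c} \<le> 1 / 2"
    and X0: "integrable M (\<lambda>\<omega>. \<bar>X 0 \<omega>\<bar> ^ i)"
    and sum: "integrable M (\<lambda>\<omega>. (\<bar>X 0 \<omega> + X 1 \<omega>\<bar> + c) ^ i)"
  shows "expectation (\<lambda>\<omega>. \<bar>X 0 \<omega>\<bar> ^ i) \<le> 2 * expectation (\<lambda>\<omega>. (\<bar>X 0 \<omega> + X 1 \<omega>\<bar> + c) ^ i)"
proof -
  have [measurable]: "X 0 \<in> borel_measurable M" "X 1 \<in> borel_measurable M"
    using ind by (auto simp: indep_vars_def)
  define f :: "nat \<Rightarrow> real \<Rightarrow> real" where "f k x = (if k = 0 then \<bar>x\<bar> ^ i else indicator {x. \<bar>x\<bar> \<le> c} x)" for k x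
  have [measurable]: "f k \<in> borel_measurable borel" for k
    by (cases "k = 0") (auto simp: f_def[abs_def])
  have ind': "indep_vars (\<lambda>_. borel) (\<lambda>k \<omega>. f k (X k \<omega>)) {..<2}"
    by (rule indep_vars_compose2[OF ind]) simp
  have set2: "{..<2::nat} = {0, 1}" by auto
  have int: "integrable M (\<lambda>\<omega>. f k (X k \<omega>))" if "k \<in> {..<2}" for k
  proof (cases "k = 0")
    case True then show ?thesis using X0 by (simp add: f_def)
  next
    case False
    then have "k = 1" using that by auto
    moreover have "integrable M (\<lambda>\<omega>. f 1 (X 1 \<omega>))"
    proof (rule integrable_const_bound[where B = 1])
      show "AE \<omega> in M. norm (f 1 (X 1 \<omega>)) \<le> 1" by (simp add: f_def indicator_def)
    qed measurable
    ultimately show ?thesis by simp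
  qed
  let ?I = "\<lambda>\<omega>. indicator {x. \<bar>x\<bar> \<le> c} (X 1 \<omega>) :: real"
  define A where "A = {\<omega>\<in>space M. \<bar>X 1 \<omega>\<bar> > c}"
  have A[measurable]: "A \<in> events" unfolding A_def by measurable
  have "expectation ?I = expectation (indicator (space M - A) :: 'a \<Rightarrow> real)"
    by (intro Bochner_Integration.integral_cong) (auto simp: indicator_def A_def)
  then have "expectation ?I = 1 - prob A"
    by (simp add: prob_compl[OF A] Int_absorb2)
  moreover have "prob A \<le> 1 / 2" using c by (simp only: A_def)
  ultimately have half: "1 / 2 \<le> expectation ?I"
    by linarith
  have "1 / 2 * expectation (\<lambda>\<omega>. \<bar>X 0 \<omega>\<bar> ^ i)
      \<le> expectation ?I * expectation (\<lambda>\<omega>. \<bar>X 0 \<omega>\<bar> ^ i)"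
    by (rule mult_right_mono[OF half]) (simp add: Bochner_Integration.integral_nonneg)
  also have "\<dots> = (\<Prod>k\<in>{..<2}. expectation (\<lambda>\<omega>. f k (X k \<omega>)))"
    by (simp add: set2 f_def)
  also have "\<dots> = expectation (\<lambda>\<omega>. \<Prod>k\<in>{..<2}. f k (X k \<omega>))"
    by (rule indep_vars_lebesgue_integral[symmetric]) (auto intro: ind' int)
  also have "\<dots> \<le> expectation (\<lambda>\<omega>. (\<bar>X 0 \<omega> + X 1 \<omega>\<bar> + c) ^ i)"
  proof (rule integral_mono_AE)
    show "integrable M (\<lambda>\<omega>. \<Prod>k\<in>{..<2}. f k (X k \<omega>))"
      by (rule indep_vars_integrable) (auto intro: ind' int)
    show "AE \<omega> in M. (\<Prod>k\<in>{..<2}. f k (X k \<omega>)) \<le> (\<bar>X 0 \<omega> + X 1 \<omega>\<bar> + c) ^ i"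
    proof (rule AE_I2)
      fix \<omega>
      show "(\<Prod>k\<in>{..<2}. f k (X k \<omega>)) \<le> (\<bar>X 0 \<omega> + X 1 \<omega>\<bar> + c) ^ i"
      proof (cases "\<bar>X 1 \<omega>\<bar> \<le> c")
        case True
        then have "\<bar>X 0 \<omega>\<bar> ^ i \<le> (\<bar>X 0 \<omega> + X 1 \<omega>\<bar> + c) ^ i" by (intro power_mono) auto
        then show ?thesis using True by (simp add: set2 f_def)
      next
        case False
        have "0 \<le> c" 
        proof (rule ccontr)
          assume "\<not> 0 \<le> c"
          then have "{\<omega>\<in>space M. \<bar>X 1 \<omega>\<bar> > c} = space M" by auto
          then show False using \<open>prob {\<omega>\<in>space M. \<bar>X 1 \<omega>\<bar> > c} \<le> 1 / 2\<close> by (simp add: prob_space)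
        qed
        then show ?thesis using False by (simp add: set2 f_def)
      qed
    qed
  qed (rule sum)
  finally show ?thesis by simp
qed

text \<open>The value at the right end point is the value at \<open>u\<close> plus an independent increment, and this increment
is bounded by \<open>2 c\<close> with probability at least 1/2, uniformly in \<open>u\<close>. Hence the moment at \<open>u\<close> is controlled
by the moment at the right end point.\<close>

lemma additive_process_moment_bounded:
  assumes L: "additive_process M L" and b: "0 \<le> b"
    and int: "\<And>u. 0 \<le> u \<Longrightarrow> integrable M (\<lambda>\<omega>. \<bar>L u \<omega>\<bar> ^ i)"
  shows "\<exists>C. \<forall>u\<in>{0..b}. expectation (\<lambda>\<omega>. \<bar>L u \<omega>\<bar> ^ i) \<le> C"
proof -
  have [measurable]: "L u \<in> borel_measurable M" for u
    using L by (simp add: additive_process_def)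
  have L0: "AE \<omega> in M. L 0 \<omega> = 0"
    using L by (simp add: additive_process_def)
  obtain c where c: "\<And>u. u \<in> {0..b} \<Longrightarrow> prob {\<omega>\<in>space M. \<bar>L u \<omega>\<bar> > c} \<le> 1 / 4"
    using additive_process_tight[OF L b] by blast
  have c0: "0 \<le> c"
  proof (rule ccontr)
    assume "\<not> 0 \<le> c"
    then have "{\<omega>\<in>space M. \<bar>L 0 \<omega>\<bar> > c} = space M" by auto
    then show False using c[of 0] b by (simp add: prob_space)
  qed
  have intb: "integrable M (\<lambda>\<omega>. (\<bar>L b \<omega>\<bar> + 2 * c) ^ i)"
  proof (rule Bochner_Integration.integrable_bound)
    show "integrable M (\<lambda>\<omega>. 2 ^ i * (\<bar>L b \<omega>\<bar> ^ i + (2 * c) ^ i))"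
      by (intro integrable_mult_right Bochner_Integration.integrable_add int b) simp
    show "AE \<omega> in M. norm ((\<bar>L b \<omega>\<bar> + 2 * c) ^ i) \<le> norm (2 ^ i * (\<bar>L b \<omega>\<bar> ^ i + (2 * c) ^ i))"
      using power_add_le[of _ "2 * c" i] c0 by (intro AE_I2) auto
  qed measurable
  show ?thesis
  proof (intro exI ballI)
    fix u assume u: "u \<in> {0..b}"
    \<comment> \<open>The first two increments along this grid are L u and L b - L u, up to the null event that L 0 is not 0.\<close>
    define \<tau> where "\<tau> n = (if n = 0 then 0 else if n = 1 then u else b)" for n :: nat
    have "mono \<tau>" using u by (intro monoI) (auto simp: \<tau>_def)
    then have ind: "indep_vars (\<lambda>_. borel) (\<lambda>k. incr L (\<tau> k) (\<tau> (Suc k))) {..<2}"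
    proof -
      have "\<forall>i. 0 \<le> \<tau> i" using u b by (auto simp: \<tau>_def)
      then show ?thesis using L \<open>mono \<tau>\<close> unfolding additive_process_def by blast
    qed
    have ae0: "AE \<omega> in M. incr L (\<tau> 0) (\<tau> (Suc 0)) \<omega> = L u \<omega>"
      using L0 by eventually_elim (simp add: incr_def \<tau>_def)
    have ae1: "AE \<omega> in M. incr L (\<tau> 0) (\<tau> (Suc 0)) \<omega> + incr L (\<tau> 1) (\<tau> (Suc 1)) \<omega> = L b \<omega>"
      using L0 by eventually_elim (simp add: incr_def \<tau>_def)
    have [measurable]: "incr L x y \<in> borel_measurable M" for x y
      unfolding incr_def[abs_def] by measurable
    have "expectation (\<lambda>\<omega>. \<bar>L u \<omega>\<bar> ^ i) = expectation (\<lambda>\<omega>. \<bar>incr L (\<tau> 0) (\<tau> (Suc 0)) \<omega>\<bar> ^ i)"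
      by (rule integral_cong_AE) (use ae0 in \<open>auto elim!: eventually_mono\<close>)
    also have "\<dots> \<le> 2 * expectation (\<lambda>\<omega>. (\<bar>incr L (\<tau> 0) (\<tau> (Suc 0)) \<omega> + incr L (\<tau> 1) (\<tau> (Suc 1)) \<omega>\<bar> + 2 * c) ^ i)"
    proof (rule moment_le_moment_sum_indep[OF ind])
      have "prob {\<omega>\<in>space M. \<bar>incr L (\<tau> 1) (\<tau> (Suc 1)) \<omega>\<bar> > 2 * c}
          \<le> prob ({\<omega>\<in>space M. \<bar>L b \<omega>\<bar> > c} \<union> {\<omega>\<in>space M. \<bar>L u \<omega>\<bar> > c})"
        by (intro finite_measure_mono) (auto simp: incr_def \<tau>_def)
      also have "\<dots> \<le> prob {\<omega>\<in>space M. \<bar>L b \<omega>\<bar> > c} + prob {\<omega>\<in>space M. \<bar>L u \<omega>\<bar> > c}"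
        by (rule measure_Un_le) auto
      also have "\<dots> \<le> 1 / 4 + 1 / 4" using u b by (intro add_mono c) auto
      finally show "prob {\<omega>\<in>space M. \<bar>incr L (\<tau> 1) (\<tau> (Suc 1)) \<omega>\<bar> > 2 * c} \<le> 1 / 2" by simp
      show "integrable M (\<lambda>\<omega>. \<bar>incr L (\<tau> 0) (\<tau> (Suc 0)) \<omega>\<bar> ^ i)"
        by (rule integrable_cong_AE_imp[OF int[of u]]) (use ae0 u in \<open>auto elim!: eventually_mono\<close>)
      show "integrable M (\<lambda>\<omega>. (\<bar>incr L (\<tau> 0) (\<tau> (Suc 0)) \<omega> + incr L (\<tau> 1) (\<tau> (Suc 1)) \<omega>\<bar> + 2 * c) ^ i)"
        by (rule integrable_cong_AE_imp[OF intb]) (use ae1 in \<open>auto elim!: eventually_mono\<close>)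
    qed
    also have "expectation (\<lambda>\<omega>. (\<bar>incr L (\<tau> 0) (\<tau> (Suc 0)) \<omega> + incr L (\<tau> 1) (\<tau> (Suc 1)) \<omega>\<bar> + 2 * c) ^ i)
        = expectation (\<lambda>\<omega>. (\<bar>L b \<omega>\<bar> + 2 * c) ^ i)"
      by (rule integral_cong_AE) (use ae1 in \<open>auto elim!: eventually_mono\<close>)
    finally show "expectation (\<lambda>\<omega>. \<bar>L u \<omega>\<bar> ^ i) \<le> 2 * expectation (\<lambda>\<omega>. (\<bar>L b \<omega>\<bar> + 2 * c) ^ i)" .
  qed
qed


section \<open>Averaging out independent marks\<close>

text \<open>For a fixed value of \<open>U\<close> the factors are independent, so the expectation of the product is the product of
the expectations; Fubini's theorem then integrates over \<open>U\<close>. The number of factors may depend on \<open>U\<close>,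
but not on the marks \<open>V\<close>. Integrability holds because the absolute values have conditional
expectation at most \<open>K ^ n (U \<omega>)\<close>.\<close>

lemma
  fixes U :: "'a \<Rightarrow> 'u" and V :: "nat \<Rightarrow> 'a \<Rightarrow> 'v" and g :: "nat \<Rightarrow> 'u \<Rightarrow> 'v \<Rightarrow> real"
  assumes U[measurable]: "U \<in> measurable M S"
    and UV: "distr M (S \<Otimes>\<^sub>M (\<Pi>\<^sub>M _\<in>UNIV. R)) (\<lambda>\<omega>. (U \<omega>, \<lambda>k. V k \<omega>)) =
      distr M S U \<Otimes>\<^sub>M distr M (\<Pi>\<^sub>M _\<in>UNIV. R) (\<lambda>\<omega> k. V k \<omega>)"
    and V: "indep_vars (\<lambda>_. R) V UNIV"
    and Q: "\<And>k. distr M R (V k) = Q"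
    and n[measurable]: "n \<in> measurable S (count_space UNIV)"
    and g[measurable]: "\<And>k. (\<lambda>(u, v). g k u v) \<in> borel_measurable (S \<Otimes>\<^sub>M R)"
    and gi: "\<And>k u. u \<in> space S \<Longrightarrow> integrable Q (g k u)"
    and gK: "\<And>k u. u \<in> space S \<Longrightarrow> (\<integral>v. \<bar>g k u v\<bar> \<partial>Q) \<le> K"
    and K: "integrable M (\<lambda>\<omega>. K ^ n (U \<omega>))"
  shows integrable_prod_indep_marks: "integrable M (\<lambda>\<omega>. \<Prod>k<n (U \<omega>). g k (U \<omega>) (V k \<omega>))"
    and expectation_prod_indep_marks: "expectation (\<lambda>\<omega>. \<Prod>k<n (U \<omega>). g k (U \<omega>) (V k \<omega>)) =
      expectation (\<lambda>\<omega>. \<Prod>k<n (U \<omega>). \<integral>v. g k (U \<omega>) v \<partial>Q)"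
proof -
  let ?R = "\<Pi>\<^sub>M _\<in>(UNIV :: nat set). R"
  have Vk[measurable]: "V k \<in> measurable M R" for k
    using V by (auto simp: indep_vars_def)
  have Vm[measurable]: "(\<lambda>\<omega> k. V k \<omega>) \<in> measurable M ?R"
    by (rule measurable_PiM_single') (auto simp: space_PiM dest: measurable_space[OF Vk])
  have sQ[measurable_cong]: "sets Q = sets R" using Q[of 0] by (metis sets_distr)
  define MU where "MU = distr M S U"
  define MV where "MV = distr M ?R (\<lambda>\<omega> k. V k \<omega>)"
  interpret MU: prob_space MU unfolding MU_def by (rule prob_space_distr) simp
  interpret MV: prob_space MV unfolding MV_def by (rule prob_space_distr) simp
  interpret pair_sigma_finite MU MV ..
  have joint: "distr M (S \<Otimes>\<^sub>M ?R) (\<lambda>\<omega>. (U \<omega>, \<lambda>k. V k \<omega>)) = MU \<Otimes>\<^sub>M MV"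
    using UV by (simp add: MU_def MV_def)
  have sM[measurable_cong]: "sets MU = sets S" "sets MV = sets ?R"
    by (simp_all add: MU_def MV_def)
  have spU: "space MU = space S" by (simp add: MU_def)
  have gu[measurable]: "g k u \<in> borel_measurable R" if "u \<in> space S" for k u
    using measurable_compose[OF measurable_Pair1'[OF that] g[of k]] by simp
  \<comment> \<open>Expectations under the law MV of the sequence are expectations in M, where the coordinates are independent.\<close>
  have inner: "integrable MV (\<lambda>v. \<Prod>k<m. h k (v k)) \<and>
      (\<integral>v. (\<Prod>k<m. h k (v k)) \<partial>MV) = (\<Prod>k<m. \<integral>v. h k v \<partial>Q)"
    if h[measurable]: "\<And>k. h k \<in> borel_measurable R" and hi: "\<And>k. integrable Q (h k)"
    for m and h :: "nat \<Rightarrow> 'v \<Rightarrow> real"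
  proof -
    have ind: "indep_vars (\<lambda>_. borel) (\<lambda>k \<omega>. h k (V k \<omega>)) {..<m}"
      by (rule indep_vars_compose2[OF indep_vars_subset[OF V]]) auto
    have i: "integrable M (\<lambda>\<omega>. h k (V k \<omega>))" for k
      using hi[of k] unfolding Q[of k, symmetric] by (subst (asm) integrable_distr_eq) auto
    have e: "expectation (\<lambda>\<omega>. h k (V k \<omega>)) = (\<integral>v. h k v \<partial>Q)" for k
      unfolding Q[of k, symmetric] by (subst integral_distr) auto
    have m[measurable]: "(\<lambda>v. \<Prod>k<m. h k (v k)) \<in> borel_measurable ?R"
      by measurable
    show ?thesis
      unfolding MV_def
      using indep_vars_integrable[OF _ ind i] indep_vars_lebesgue_integral[OF _ ind i]
      by (simp add: integrable_distr_eq integral_distr e)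
  qed
  define f where "f x = (\<Prod>k<n (fst x). g k (fst x) (snd x k))" for x :: "'u \<times> (nat \<Rightarrow> 'v)"
  have f[measurable]: "f \<in> borel_measurable (S \<Otimes>\<^sub>M ?R)"
    unfolding f_def[abs_def]
  proof (rule measurable_compose_countable[where f = "\<lambda>m x. \<Prod>k<m. g k (fst x) (snd x k)"
        and g = "\<lambda>x. n (fst x)"])
    fix m
    show "(\<lambda>x. \<Prod>k<m. g k (fst x) (snd x k)) \<in> borel_measurable (S \<Otimes>\<^sub>M ?R)"
    proof (intro borel_measurable_prod)
      fix k
      have "(\<lambda>x :: 'u \<times> (nat \<Rightarrow> 'v). (fst x, snd x k)) \<in> measurable (S \<Otimes>\<^sub>M ?R) (S \<Otimes>\<^sub>M R)" by measurable
      from measurable_compose[OF this g[of k]]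
      show "(\<lambda>x. g k (fst x) (snd x k)) \<in> borel_measurable (S \<Otimes>\<^sub>M ?R)" by simp
    qed
  qed measurable
  have f_fst: "integrable MV (\<lambda>v. f (u, v))" "(\<integral>v. f (u, v) \<partial>MV) = (\<Prod>k<n u. \<integral>v. g k u v \<partial>Q)"
    if "u \<in> space S" for u
    using inner[of "\<lambda>k. g k u" "n u"] gi that gu by (auto simp: f_def)
  have f_abs: "(\<integral>v. norm (f (u, v)) \<partial>MV) = (\<Prod>k<n u. \<integral>v. \<bar>g k u v\<bar> \<partial>Q)" if "u \<in> space S" for u
    using inner[of "\<lambda>k v. \<bar>g k u v\<bar>" "n u"] gi that gu by (auto simp: f_def abs_prod)
  have KU: "integrable MU (\<lambda>u. K ^ n u)"
    unfolding MU_def using K by (subst integrable_distr_eq) auto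
  have f_int: "integrable (MU \<Otimes>\<^sub>M MV) f"
  proof (rule Fubini_integrable)
    show "integrable MU (\<lambda>u. \<integral>v. norm (f (u, v)) \<partial>MV)"
    proof (rule Bochner_Integration.integrable_bound[OF KU])
      show "AE u in MU. norm (\<integral>v. norm (f (u, v)) \<partial>MV) \<le> norm (K ^ n u)"
      proof (rule AE_I2)
        fix u assume "u \<in> space MU"
        then have u: "u \<in> space S" by (simp add: spU)
        have "(\<Prod>k<n u. \<integral>v. \<bar>g k u v\<bar> \<partial>Q) \<le> (\<Prod>k<n u. K)"
          using gK[OF u] by (intro prod_mono) auto
        moreover have "0 \<le> (\<Prod>k<n u. \<integral>v. \<bar>g k u v\<bar> \<partial>Q)" by (intro prod_nonneg) auto
        ultimately show "norm (\<integral>v. norm (f (u, v)) \<partial>MV) \<le> norm (K ^ n u)"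
          unfolding f_abs[OF u] by auto
      qed
    qed measurable
    show "AE u in MU. integrable MV (\<lambda>v. f (u, v))"
      using f_fst(1) by (intro AE_I2) (simp add: spU)
  qed measurable
  then show "integrable M (\<lambda>\<omega>. \<Prod>k<n (U \<omega>). g k (U \<omega>) (V k \<omega>))"
    unfolding joint[symmetric] by (subst (asm) integrable_distr_eq) (auto simp: f_def)
  have "expectation (\<lambda>\<omega>. \<Prod>k<n (U \<omega>). g k (U \<omega>) (V k \<omega>)) = (\<integral>x. f x \<partial>(MU \<Otimes>\<^sub>M MV))"
    unfolding joint[symmetric] by (subst integral_distr) (auto simp: f_def)
  also have "\<dots> = (\<integral>u. \<integral>v. f (u, v) \<partial>MV \<partial>MU)"
    by (rule integral_fst'[OF f_int, symmetric])
  also have "\<dots> = expectation (\<lambda>\<omega>. \<integral>v. f (U \<omega>, v) \<partial>MV)"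
    unfolding MU_def by (rule integral_distr) measurable
  also have "\<dots> = expectation (\<lambda>\<omega>. \<Prod>k<n (U \<omega>). \<integral>v. g k (U \<omega>) v \<partial>Q)"
    using measurable_space[OF U] by (intro Bochner_Integration.integral_cong refl f_fst(2)) auto
  finally show "expectation (\<lambda>\<omega>. \<Prod>k<n (U \<omega>). g k (U \<omega>) (V k \<omega>)) =
      expectation (\<lambda>\<omega>. \<Prod>k<n (U \<omega>). \<integral>v. g k (U \<omega>) v \<partial>Q)" .
qed

end

section \<open>The product functional of the Poisson points\<close>

definition early_count :: "(nat \<Rightarrow> ereal) \<Rightarrow> nat" where
  "early_count \<tau> = card {k. \<tau> k \<le> 1}"

lemma finite_down_closed_eq_lessThan_card:
  fixes A :: "nat set"
  assumes "finite A" and "\<And>k j. k \<in> A \<Longrightarrow> j \<le> k \<Longrightarrow> j \<in> A"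
  shows "A = {..<card A}"
proof (cases "A = {}")
  case False
  have "A = {..Max A}"
    using assms Max_in[OF assms(1) False] by (auto intro: Max_ge)
  then show ?thesis by (metis card_atMost lessThan_Suc_atMost)
qed simp

lemma early_count_measurable [measurable]:
  "early_count \<in> measurable (\<Pi>\<^sub>M _\<in>UNIV. borel) (count_space UNIV)"
  unfolding early_count_def[abs_def] by measurable

lemma le_one_iff_mem_ereal_image:
  fixes t :: ereal
  assumes "0 < t"
  shows "t \<le> 1 \<longleftrightarrow> t \<in> ereal ` {0..1}"
  using assms by (cases t) (auto simp: one_ereal_def)

context prob_space
begin

lemma point_count_measurable:
  assumes [measurable]: "\<And>k. T k \<in> borel_measurable M" "A \<in> sets borel"
  shows "point_count T A \<in> measurable M (count_space UNIV)"
proof -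
  have "{\<omega> \<in> space M. T k \<omega> \<in> ereal ` A} = {\<omega> \<in> space M. \<bar>T k \<omega>\<bar> \<noteq> \<infinity> \<and> real_of_ereal (T k \<omega>) \<in> A}" for k
    by (auto simp: image_iff)
  then have "{\<omega> \<in> space M. k \<in> {k. T k \<omega> \<in> ereal ` A}} \<in> sets M" for k
    by simp
  then show ?thesis unfolding point_count_def[abs_def] by (rule measurable_card)
qed

text \<open>The points increase strictly until they become infinite, so those in \<open>[0,1]\<close> are an initial segment of
the sequence, and products and sums over them run over \<open>k < early_count\<close>.\<close>

lemma AE_early_points:
  assumes "poisson_points M T \<Lambda>"
  shows "AE \<omega> in M. {k. T k \<omega> \<le> 1} = {..<early_count (\<lambda>k. T k \<omega>)} \<and>
    (\<forall>k. 0 < T k \<omega>)"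
proof -
  have "AE \<omega> in M. 0 < T 0 \<omega>"
    and "AE \<omega> in M. \<forall>k. T k \<omega> < T (Suc k) \<omega> \<or> (T k \<omega> = \<infinity> \<and> T (Suc k) \<omega> = \<infinity>)"
    and "AE \<omega> in M. finite {k. T k \<omega> \<le> ereal 1}"
    using assms unfolding poisson_points_def by blast+
  then show ?thesis
  proof eventually_elim
    case (elim \<omega>)
    have step: "T k \<omega> \<le> T (Suc k) \<omega>" for k using elim(2)[rule_format, of k] by auto
    have mono: "T j \<omega> \<le> T k \<omega>" if "j \<le> k" for j k
      using that step by (rule lift_Suc_mono_le[rotated])
    have fin: "finite {k. T k \<omega> \<le> 1}" using elim(3) by (simp add: one_ereal_def)
    have "{k. T k \<omega> \<le> 1} = {..<early_count (\<lambda>k. T k \<omega>)}"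
      unfolding early_count_def
      by (rule finite_down_closed_eq_lessThan_card[OF fin]) (auto intro: order_trans[OF mono])
    moreover have "0 < T k \<omega>" for k
      using elim(1) mono[of 0 k] by (rule less_le_trans) simp
    ultimately show ?case by blast
  qed
qed

lemma poisson_points_count_prob:
  assumes "poisson_points M T \<Lambda>" and "A \<in> sets borel" "bounded A" "A \<subseteq> {0..}"
  shows "prob {\<omega> \<in> space M. point_count T A \<omega> = n} = measure \<Lambda> A ^ n / fact n * exp (- measure \<Lambda> A)"
proof -
  have "\<forall>A\<in>sets borel. bounded A \<and> A \<subseteq> {0..} \<longrightarrow>
      (\<forall>n. prob {\<omega> \<in> space M. point_count T A \<omega> = n} = measure \<Lambda> A ^ n / fact n * exp (- measure \<Lambda> A))"
    using assms(1) unfolding poisson_points_def by (elim conjE) assumption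
  then show ?thesis using assms(2-) by auto
qed

lemma poisson_points_count_indep:
  fixes n :: nat
  assumes "poisson_points M T \<Lambda>"
    and "\<And>i. i < n \<Longrightarrow> A i \<in> sets borel" "\<And>i. i < n \<Longrightarrow> bounded (A i)" "\<And>i. i < n \<Longrightarrow> A i \<subseteq> {0..}"
    and "disjoint_family_on A {..<n}"
  shows "indep_vars (\<lambda>_. count_space UNIV) (\<lambda>i. point_count T (A i)) {..<n}"
proof -
  have "\<forall>n A. (\<forall>i<n. A i \<in> sets borel \<and> bounded (A i) \<and> A i \<subseteq> {0..}) \<and>
      disjoint_family_on A {..<n::nat} \<longrightarrow>
      indep_vars (\<lambda>_. count_space UNIV) (\<lambda>i. point_count T (A i)) {..<n}"
    using assms(1) unfolding poisson_points_def by (elim conjE) assumption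
  from this[rule_format, of n A] show ?thesis using assms(2-) by auto
qed

lemma early_count_power_integrable:
  fixes K :: real
  assumes T: "poisson_points M T \<Lambda>"
  shows "integrable M (\<lambda>\<omega>. K ^ early_count (\<lambda>k. T k \<omega>))"
proof -
  have [measurable]: "T k \<in> borel_measurable M" for k
    using T by (simp add: poisson_points_def)
  have [measurable]: "(\<lambda>\<omega> k. T k \<omega>) \<in> measurable M (\<Pi>\<^sub>M _\<in>UNIV. borel)"
    by (rule measurable_PiM_single') auto
  have p: "prob {\<omega> \<in> space M. point_count T {0..1} \<omega> = n}
      = measure \<Lambda> {0..1} ^ n / fact n * exp (- measure \<Lambda> {0..1})" for n
    by (rule poisson_points_count_prob[OF T]) auto
  have "integrable M (\<lambda>\<omega>. K ^ point_count T {0..1} \<omega>)"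
    by (rule poisson_genfun(1)[OF point_count_measurable p]) auto
  moreover have "AE \<omega> in M. K ^ point_count T {0..1} \<omega> = K ^ early_count (\<lambda>k. T k \<omega>)"
    using AE_early_points[OF T]
  proof eventually_elim
    case (elim \<omega>)
    then have "{k. T k \<omega> \<in> ereal ` {0..1}} = {k. T k \<omega> \<le> 1}"
      by (simp add: le_one_iff_mem_ereal_image)
    then show ?case by (simp add: point_count_def early_count_def)
  qed
  ultimately show ?thesis
    by (subst integrable_cong_AE[symmetric]) (auto intro!: borel_measurable_power)
qed

lemma prod_early_points_measurable:
  fixes \<phi> :: "real \<Rightarrow> real"
  assumes T[measurable]: "\<And>k. T k \<in> borel_measurable M"
    and \<phi>[measurable]: "\<phi> \<in> borel_measurable borel"
  shows "(\<lambda>\<omega>. \<Prod>k<early_count (\<lambda>k. T k \<omega>). \<phi> (real_of_ereal (T k \<omega>))) \<in> borel_measurable M"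
proof (rule measurable_compose_countable[where f = "\<lambda>n \<omega>. \<Prod>k<n. \<phi> (real_of_ereal (T k \<omega>))"
      and g = "\<lambda>\<omega>. early_count (\<lambda>k. T k \<omega>)"])
  have [measurable]: "(\<lambda>\<omega> k. T k \<omega>) \<in> measurable M (\<Pi>\<^sub>M _\<in>UNIV. borel)"
    by (rule measurable_PiM_single') auto
  show "(\<lambda>\<omega>. early_count (\<lambda>k. T k \<omega>)) \<in> measurable M (count_space UNIV)"
    by measurable
qed measurable

text \<open>For a simple function \<open>\<phi>\<close> the product depends on the points only through their numbers in the level sets
of \<open>\<phi>\<close>. These are independent Poisson variables, and each contributes its generating function.\<close>

lemma poisson_functional_simple:
  fixes \<phi> :: "real \<Rightarrow> real"
  assumes T: "poisson_points M T \<Lambda>"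
    and s\<Lambda>: "sets \<Lambda> = sets borel" and fin: "emeasure \<Lambda> {0..1} < \<infinity>"
    and \<phi>: "simple_function borel \<phi>"
  shows "expectation (\<lambda>\<omega>. \<Prod>k<early_count (\<lambda>k. T k \<omega>). \<phi> (real_of_ereal (T k \<omega>)))
    = exp (\<integral>x. \<phi> x - 1 \<partial>density \<Lambda> (indicator {0..1}))"
proof -
  note [measurable_cong] = s\<Lambda>
  have \<phi>m[measurable]: "\<phi> \<in> borel_measurable borel"
    using \<phi> by (rule borel_measurable_simple_function)
  have T_m[measurable]: "T k \<in> borel_measurable M" for k
    using T by (simp add: poisson_points_def)
  have finR: "finite (range \<phi>)" using \<phi> by (simp add: simple_function_def)
  define n where "n = card (range \<phi>)"
  obtain h where h: "bij_betw h {..<n} (range \<phi>)"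
    using ex_bij_betw_nat_finite[OF finR] by (auto simp: n_def atLeast0LessThan)
  \<comment> \<open>The level sets, numbered by {..<n} because independence of the counts is given for such families.\<close>
  define C where "C j = {x\<in>{0..1}. \<phi> x = h j}" for j
  have C[measurable]: "C j \<in> sets borel" for j unfolding C_def by measurable
  have Cb: "bounded (C j)" "C j \<subseteq> {0..}" "C j \<subseteq> {0..1}" for j
    by (auto simp: C_def intro: bounded_subset[OF bounded_closed_interval[of 0 "1::real"]])
  have disj: "disjoint_family_on C {..<n}"
    using h by (auto simp: disjoint_family_on_def C_def bij_betw_def inj_on_def)
  have finC: "emeasure \<Lambda> (C j) < \<infinity>" for j
    using fin emeasure_mono[OF Cb(3)[of j], of \<Lambda>] s\<Lambda> by (auto simp: less_top[symmetric] top_unique)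
  define N where "N j = point_count T (C j)" for j
  have Nm: "N j \<in> measurable M (count_space UNIV)" for j
    unfolding N_def by (rule point_count_measurable) auto
  have Np: "prob {\<omega> \<in> space M. N j \<omega> = m} = measure \<Lambda> (C j) ^ m / fact m * exp (- measure \<Lambda> (C j))" for j m
    unfolding N_def by (rule poisson_points_count_prob[OF T C Cb(1,2)])
  have ind: "indep_vars (\<lambda>_. count_space UNIV) N {..<n}"
    unfolding N_def by (rule poisson_points_count_indep[OF T C Cb(1,2) disj])
  have ind': "indep_vars (\<lambda>_. borel) (\<lambda>j \<omega>. h j ^ N j \<omega>) {..<n}"
    by (rule indep_vars_compose2[OF ind]) simp
  have ae: "AE \<omega> in M. (\<Prod>k<early_count (\<lambda>k. T k \<omega>). \<phi> (real_of_ereal (T k \<omega>))) = (\<Prod>j<n. h j ^ N j \<omega>)"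
    using AE_early_points[OF T]
  proof eventually_elim
    case (elim \<omega>)
    define I where "I = {..<early_count (\<lambda>k. T k \<omega>)}"
    define r where "r k = real_of_ereal (T k \<omega>)" for k
    have I_iff: "k \<in> I \<longleftrightarrow> T k \<omega> \<in> ereal ` {0..1}" for k
    proof -
      have "k \<in> I \<longleftrightarrow> T k \<omega> \<le> 1" using elim by (auto simp: I_def)
      also have "\<dots> \<longleftrightarrow> T k \<omega> \<in> ereal ` {0..1}" using elim by (intro le_one_iff_mem_ereal_image) auto
      finally show ?thesis .
    qed
    have mem: "T k \<omega> \<in> ereal ` A \<longleftrightarrow> k \<in> I \<and> r k \<in> A" if "A \<subseteq> {0..1}" for k A
      using that by (auto simp: r_def I_iff)
    have r01: "r k \<in> {0..1}" if "k \<in> I" for k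
      using that by (auto simp: r_def I_iff)
    have Nj: "N j \<omega> = card {k\<in>I. \<phi> (r k) = h j}" for j
      unfolding N_def point_count_def mem[OF Cb(3)]
      by (rule arg_cong[where f = card]) (use r01 in \<open>auto simp: C_def\<close>)
    have "(\<Prod>k\<in>I. \<phi> (r k)) = (\<Prod>c\<in>range \<phi>. \<Prod>k\<in>{k\<in>I. \<phi> (r k) = c}. \<phi> (r k))"
      by (rule prod.group[symmetric]) (auto simp: I_def finR)
    also have "\<dots> = (\<Prod>c\<in>range \<phi>. c ^ card {k\<in>I. \<phi> (r k) = c})"
    proof (rule prod.cong[OF refl])
      fix c
      have "(\<Prod>k\<in>{k\<in>I. \<phi> (r k) = c}. \<phi> (r k)) = (\<Prod>k\<in>{k\<in>I. \<phi> (r k) = c}. c)"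
        by (rule prod.cong) auto
      then show "(\<Prod>k\<in>{k\<in>I. \<phi> (r k) = c}. \<phi> (r k)) = c ^ card {k\<in>I. \<phi> (r k) = c}" by simp
    qed
    also have "\<dots> = (\<Prod>j<n. h j ^ card {k\<in>I. \<phi> (r k) = h j})"
      by (rule prod.reindex_bij_betw[OF h, symmetric])
    finally show ?case by (simp add: Nj I_def r_def)
  qed
  have "expectation (\<lambda>\<omega>. \<Prod>k<early_count (\<lambda>k. T k \<omega>). \<phi> (real_of_ereal (T k \<omega>)))
      = expectation (\<lambda>\<omega>. \<Prod>j<n. h j ^ N j \<omega>)"
  proof (rule integral_cong_AE[OF _ _ ae])
    show "(\<lambda>\<omega>. \<Prod>j<n. h j ^ N j \<omega>) \<in> borel_measurable M"
      using Nm by (intro borel_measurable_prod measurable_compose[OF Nm]) simp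
  qed (intro prod_early_points_measurable T_m \<phi>m)
  also have "\<dots> = (\<Prod>j<n. expectation (\<lambda>\<omega>. h j ^ N j \<omega>))"
    by (rule indep_vars_lebesgue_integral[OF _ ind']) (auto intro: poisson_genfun(1)[OF Nm Np])
  also have "\<dots> = (\<Prod>j<n. exp ((h j - 1) * measure \<Lambda> (C j)))"
    by (intro prod.cong refl poisson_genfun(2)[OF Nm Np])
  also have "\<dots> = exp (\<Sum>j<n. (h j - 1) * measure \<Lambda> (C j))"
    by (simp add: exp_sum)
  also have "(\<Sum>j<n. (h j - 1) * measure \<Lambda> (C j)) = (\<integral>x. \<phi> x - 1 \<partial>density \<Lambda> (indicator {0..1}))"
  proof -
    have pt: "indicator {0..1} x * (\<phi> x - 1) = (\<Sum>j<n. (h j - 1) * indicator (C j) x)" for x :: real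
    proof (cases "x \<in> {0..1}")
      case True
      have "\<phi> x \<in> h ` {..<n}" using h by (simp add: bij_betw_def)
      then obtain i where i: "i < n" "h i = \<phi> x" by (metis imageE lessThan_iff)
      have eq: "h j = \<phi> x \<longleftrightarrow> j = i" if "j < n" for j
        using h i that by (auto simp: bij_betw_def inj_on_def)
      have "(\<Sum>j<n. (h j - 1) * indicator (C j) x) = (\<Sum>j<n. if j = i then h i - 1 else 0)"
      proof (rule sum.cong[OF refl])
        fix j assume "j \<in> {..<n}"
        then have "x \<in> C j \<longleftrightarrow> j = i" using True eq[of j] by (auto simp: C_def)
        then show "(h j - 1) * indicator (C j) x = (if j = i then h i - 1 else 0)"
          by (simp add: indicator_def)
      qed
      then show ?thesis using True i by (simp add: indicator_def)
    qed (auto simp: C_def indicator_def)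
    have i: "integrable \<Lambda> (\<lambda>x. (h j - 1) * indicator (C j) x)" for j
      using finC[of j] by (intro integrable_mult_right integrable_real_indicator) (auto simp: s\<Lambda>)
    have "(\<integral>x. \<phi> x - 1 \<partial>density \<Lambda> (\<lambda>x. ennreal (indicator {0..1} x))) = (\<integral>x. indicator {0..1} x * (\<phi> x - 1) \<partial>\<Lambda>)"
      by (rule integral_real_density) auto
    then have "(\<integral>x. \<phi> x - 1 \<partial>density \<Lambda> (indicator {0..1})) = (\<integral>x. indicator {0..1} x * (\<phi> x - 1) \<partial>\<Lambda>)"
      by (simp only: ennreal_indicator)
    also have "\<dots> = (\<Sum>j<n. \<integral>x. (h j - 1) * indicator (C j) x \<partial>\<Lambda>)"
      unfolding pt by (rule Bochner_Integration.integral_sum) (rule i)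
    also have "\<dots> = (\<Sum>j<n. (h j - 1) * measure \<Lambda> (C j))"
      using s\<Lambda>[THEN sets_eq_imp_space_eq] by simp
    finally show ?thesis by simp
  qed
  finally show ?thesis .
qed

text \<open>Both sides are continuous under bounded pointwise limits. On the left the dominating function is
\<open>(2 K) ^ n\<close>, with \<open>n\<close> the Poisson number of points, whose generating function is finite everywhere.\<close>

lemma poisson_functional:
  fixes \<phi> :: "real \<Rightarrow> real"
  assumes T: "poisson_points M T \<Lambda>"
    and s\<Lambda>: "sets \<Lambda> = sets borel" and fin: "emeasure \<Lambda> {0..1} < \<infinity>"
    and \<phi>[measurable]: "\<phi> \<in> borel_measurable borel" and K: "\<And>x. \<bar>\<phi> x\<bar> \<le> K"
  shows "expectation (\<lambda>\<omega>. \<Prod>k<early_count (\<lambda>k. T k \<omega>). \<phi> (real_of_ereal (T k \<omega>)))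
    = exp (\<integral>x. \<phi> x - 1 \<partial>density \<Lambda> (indicator {0..1}))"
proof -
  note [measurable_cong] = s\<Lambda>
  have T_m[measurable]: "T k \<in> borel_measurable M" for k
    using T by (simp add: poisson_points_def)
  let ?F = "\<lambda>\<phi> \<omega>. \<Prod>k<early_count (\<lambda>k. T k \<omega>). \<phi> (real_of_ereal (T k \<omega>)) :: real"
  let ?D = "density \<Lambda> (indicator {0..1})"
  have finD: "finite_measure ?D"
    using fin by (intro finite_measureI) (simp add: emeasure_density s\<Lambda>[THEN sets_eq_imp_space_eq])
  \<comment> \<open>The factor 2 in the bound is that of the approximation lemma for functions with values in a metric space.\<close>
  obtain s where s: "\<And>i. simple_function borel (s i)" "\<And>x. (\<lambda>i. s i x) \<longlonglongrightarrow> \<phi> x"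
    "\<And>i x. \<bar>s i x\<bar> \<le> 2 * \<bar>\<phi> x\<bar>"
    using borel_measurable_implies_sequence_metric[OF \<phi>, of 0] by (auto simp: dist_real_def)
  have sm[measurable]: "s i \<in> borel_measurable borel" for i
    by (rule borel_measurable_simple_function[OF s(1)])
  have sK: "\<bar>s i x\<bar> \<le> 2 * K" for i x using s(3)[of i x] K[of x] by linarith
  have bound: "\<bar>?F f \<omega>\<bar> \<le> c ^ early_count (\<lambda>k. T k \<omega>)" if "\<And>x. \<bar>f x\<bar> \<le> c" for f c \<omega>
  proof -
    have "\<bar>?F f \<omega>\<bar> \<le> (\<Prod>k<early_count (\<lambda>k. T k \<omega>). c)"
      unfolding abs_prod using that by (intro prod_mono) auto
    then show ?thesis by simp
  qed
  have "(\<lambda>i. expectation (?F (s i))) \<longlonglongrightarrow> expectation (?F \<phi>)"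
  proof (rule integral_dominated_convergence[OF _ _ early_count_power_integrable[OF T, of "2 * K"]])
    show "?F \<phi> \<in> borel_measurable M" "?F (s i) \<in> borel_measurable M" for i
      by (rule prod_early_points_measurable[OF T_m \<phi>] prod_early_points_measurable[OF T_m sm])+
    show "AE \<omega> in M. (\<lambda>i. ?F (s i) \<omega>) \<longlonglongrightarrow> ?F \<phi> \<omega>"
      by (intro AE_I2 tendsto_prod s(2))
    show "AE \<omega> in M. norm (?F (s i) \<omega>) \<le> (2 * K) ^ early_count (\<lambda>k. T k \<omega>)" for i
      using bound[of "s i" "2 * K", OF sK] by simp
  qed
  moreover have "(\<lambda>i. exp (\<integral>x. s i x - 1 \<partial>?D)) \<longlonglongrightarrow> exp (\<integral>x. \<phi> x - 1 \<partial>?D)"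
  proof (intro tendsto_exp integral_dominated_convergence[where w = "\<lambda>_. 2 * K + 1"])
    show "integrable ?D (\<lambda>_. 2 * K + 1)" using finD by (simp add: finite_measure.integrable_const)
    show "AE x in ?D. (\<lambda>i. s i x - 1) \<longlonglongrightarrow> \<phi> x - 1"
      by (intro AE_I2 tendsto_diff s(2) tendsto_const)
    show "AE x in ?D. norm (s i x - 1) \<le> 2 * K + 1" for i
    proof (rule AE_I2)
      fix x show "norm (s i x - 1) \<le> 2 * K + 1" using sK[of i x] by (simp add: abs_if split: if_splits)
    qed
  qed measurable
  ultimately show "expectation (?F \<phi>) = exp (\<integral>x. \<phi> x - 1 \<partial>?D)"
    unfolding poisson_functional_simple[OF T s\<Lambda> fin s(1)] by (rule LIMSEQ_unique)
qed

end

section \<open>Independence of points, delays and clusters\<close>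

context prob_space
begin

lemma distr_pair_if_rectangles_indep:
  assumes X[measurable]: "X \<in> measurable M S" and Y[measurable]: "Y \<in> measurable M R"
    and ind: "\<And>A B. A \<in> sets S \<Longrightarrow> B \<in> sets R \<Longrightarrow>
      prob ((X -` A \<inter> space M) \<inter> (Y -` B \<inter> space M)) = prob (X -` A \<inter> space M) * prob (Y -` B \<inter> space M)"
  shows "distr M (S \<Otimes>\<^sub>M R) (\<lambda>\<omega>. (X \<omega>, Y \<omega>)) = distr M S X \<Otimes>\<^sub>M distr M R Y"
proof (rule pair_measure_eqI[symmetric])
  show "sigma_finite_measure (distr M S X)" "sigma_finite_measure (distr M R Y)"
    by (simp_all add: prob_space_imp_sigma_finite prob_space_distr)
  show "sets (distr M S X \<Otimes>\<^sub>M distr M R Y) = sets (distr M (S \<Otimes>\<^sub>M R) (\<lambda>\<omega>. (X \<omega>, Y \<omega>)))"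
    by (simp cong: sets_pair_measure_cong)
  fix A B assume "A \<in> sets (distr M S X)" "B \<in> sets (distr M R Y)"
  then have [measurable]: "A \<in> sets S" "B \<in> sets R" by auto
  have "(\<lambda>\<omega>. (X \<omega>, Y \<omega>)) -` (A \<times> B) \<inter> space M = (X -` A \<inter> space M) \<inter> (Y -` B \<inter> space M)" by auto
  then show "emeasure (distr M S X) A * emeasure (distr M R Y) B
      = emeasure (distr M (S \<Otimes>\<^sub>M R) (\<lambda>\<omega>. (X \<omega>, Y \<omega>))) (A \<times> B)"
    by (simp add: emeasure_distr emeasure_eq_measure ind ennreal_mult')
qed

end

context delayed_poisson_cluster
begin

abbreviation points_space :: "(nat \<Rightarrow> ereal) measure" where
  "points_space \<equiv> \<Pi>\<^sub>M _\<in>UNIV. borel"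

abbreviation path_space :: "(real \<Rightarrow> real) measure" where
  "path_space \<equiv> \<Pi>\<^sub>M _\<in>UNIV. borel"

abbreviation delays_space :: "(nat \<Rightarrow> real) measure" where
  "delays_space \<equiv> \<Pi>\<^sub>M _\<in>UNIV. borel"

abbreviation clusters_space :: "(nat \<Rightarrow> real \<Rightarrow> real) measure" where
  "clusters_space \<equiv> \<Pi>\<^sub>M _\<in>UNIV. path_space"

abbreviation (input) cluster :: "nat \<Rightarrow> 'a \<Rightarrow> real \<Rightarrow> real" where
  "cluster k \<omega> \<equiv> (\<lambda>t. Lc k t \<omega>)"

lemma T_measurable [measurable]: "T k \<in> borel_measurable P"
  using points by (simp add: poisson_points_def)

lemma D_measurable [measurable]: "D k \<in> borel_measurable P"
  using D_indep by (auto simp: indep_vars_def)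

lemma L_measurable [measurable]: "L t \<in> borel_measurable P"
  using L_additive by (simp add: additive_process_def)

lemma Lc_measurable [measurable]: "Lc k t \<in> borel_measurable P"
  using Lc_additive by (simp add: additive_process_def)

lemma T_seq_measurable [measurable]: "(\<lambda>\<omega> k. T k \<omega>) \<in> measurable P points_space"
  by (rule measurable_PiM_single') auto

lemma D_seq_measurable [measurable]: "(\<lambda>\<omega> k. D k \<omega>) \<in> measurable P delays_space"
  by (rule measurable_PiM_single') auto

lemma cluster_measurable [measurable]: "cluster k \<in> measurable P path_space"
  by (rule measurable_PiM_single') auto

lemma L_path_measurable [measurable]: "(\<lambda>\<omega> t. L t \<omega>) \<in> measurable P path_space"
  by (rule measurable_PiM_single') auto

lemma cluster_seq_measurable: "(\<lambda>\<omega> k. cluster k \<omega>) \<in> measurable P clusters_space"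
  by (rule measurable_PiM_single') (auto simp: space_PiM)

text \<open>The independence assumption concerns the \<open>\<sigma>\<close>-algebras generated by the three families. The form needed for
averaging out the marks in two steps is that of joint laws: (points, delays) against clusters, and then points
against delays.\<close>

lemma T_D_indep_clusters:
  "distr P ((points_space \<Otimes>\<^sub>M delays_space) \<Otimes>\<^sub>M clusters_space)
      (\<lambda>\<omega>. ((\<lambda>k. T k \<omega>, \<lambda>k. D k \<omega>), \<lambda>k. cluster k \<omega>))
    = distr P (points_space \<Otimes>\<^sub>M delays_space) (\<lambda>\<omega>. (\<lambda>k. T k \<omega>, \<lambda>k. D k \<omega>))
      \<Otimes>\<^sub>M distr P clusters_space (\<lambda>\<omega> k. cluster k \<omega>)"
  and T_indep_D:
  "distr P (points_space \<Otimes>\<^sub>M delays_space) (\<lambda>\<omega>. (\<lambda>k. T k \<omega>, \<lambda>k. D k \<omega>))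
    = distr P points_space (\<lambda>\<omega> k. T k \<omega>) \<Otimes>\<^sub>M distr P delays_space (\<lambda>\<omega> k. D k \<omega>)"
proof -
  define VT where "VT = vimage_algebra (space P) (\<lambda>\<omega> k. T k \<omega>) points_space"
  define VL where "VL = vimage_algebra (space P) (\<lambda>\<omega> (k, t). Lc k t \<omega>) (\<Pi>\<^sub>M _\<in>(UNIV :: (nat \<times> real) set). borel :: real measure)"
  define VD where "VD = vimage_algebra (space P) (\<lambda>\<omega> k. D k \<omega>) delays_space"
  \<comment> \<open>Indices 0, 1 and 2 stand for points, clusters and delays.\<close>
  define E where "E i = [sets VT, sets VL, sets VD] ! i" for i
  have ind: "indep_sets E {0, 1, 2}"
    using T_L_D_indep unfolding E_def[abs_def] VT_def VL_def VD_def sigma_gen_def .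
  have sp: "space VT = space P" "space VL = space P" "space VD = space P"
    by (simp_all add: VT_def VL_def VD_def)
  have TV: "(\<lambda>\<omega> k. T k \<omega>) \<in> measurable VT points_space"
    unfolding VT_def by (rule measurable_vimage_algebra1) (simp add: space_PiM)
  have DV: "(\<lambda>\<omega> k. D k \<omega>) \<in> measurable VD delays_space"
    unfolding VD_def by (rule measurable_vimage_algebra1) (simp add: space_PiM)
  have LV: "(\<lambda>\<omega> (k, t). Lc k t \<omega>) \<in> measurable VL (\<Pi>\<^sub>M _\<in>(UNIV :: (nat \<times> real) set). borel :: real measure)"
    unfolding VL_def by (rule measurable_vimage_algebra1) (simp add: space_PiM)
  have LV1: "(\<lambda>\<omega>. Lc k t \<omega>) \<in> borel_measurable VL" for k t
    using measurable_compose[OF LV measurable_component_singleton[of "(k, t)"]] by simp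
  have LV2: "(\<lambda>\<omega> k. cluster k \<omega>) \<in> measurable VL clusters_space"
  proof (rule measurable_PiM_single')
    show "(\<lambda>\<omega>. cluster k \<omega>) \<in> measurable VL path_space" for k
      by (rule measurable_PiM_single') (auto intro: LV1)
  qed (auto simp: space_PiM)
  have sub: "sets VT \<subseteq> Pow (space P)" "sets VL \<subseteq> Pow (space P)" "sets VD \<subseteq> Pow (space P)"
    using sets.space_closed[of VT] sets.space_closed[of VL] sets.space_closed[of VD] by (simp_all add: sp)
  define W where "W = sigma (space P) (sets VT \<union> sets VD)"
  have sW: "sets W = sigma_sets (space P) (sets VT \<union> sets VD)" "space W = space P"
    unfolding W_def using sub by (simp_all add: sets_measure_of space_measure_of)
  have TW: "(\<lambda>\<omega> k. T k \<omega>) \<in> measurable W points_space"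
    by (rule measurable_mono[THEN subsetD, OF order_refl refl _ _ TV])
      (auto simp: sW sp intro: sigma_sets.Basic)
  have DW: "(\<lambda>\<omega> k. D k \<omega>) \<in> measurable W delays_space"
    by (rule measurable_mono[THEN subsetD, OF order_refl refl _ _ DV])
      (auto simp: sW sp intro: sigma_sets.Basic)
  have TDW: "(\<lambda>\<omega>. (\<lambda>k. T k \<omega>, \<lambda>k. D k \<omega>)) \<in> measurable W (points_space \<Otimes>\<^sub>M delays_space)"
    using TW DW by (rule measurable_Pair)
  define I where "I j = (if j = 0 then {0, 2} else {1 :: nat})" for j :: nat
  have *: "indep_sets (\<lambda>j. sigma_sets (space P) (\<Union>i\<in>I j. E i)) {0, 1}"
  proof (rule indep_sets_collect_sigma)
    have "(\<Union>j\<in>{0, 1}. I j) = {0, 1, 2}" by (auto simp: I_def)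
    then show "indep_sets E (\<Union>j\<in>{0, 1}. I j)" using ind by (simp only:)
    show "Int_stable (E i)" if "j \<in> {0, 1}" "i \<in> I j" for i j
      using that by (auto simp: I_def E_def Int_stable_def split: if_splits)
    show "disjoint_family_on I {0, 1}" by (auto simp: disjoint_family_on_def I_def)
  qed
  have pair: "prob (\<Inter>j\<in>{0, 1}. A j) = (\<Prod>j\<in>{0, 1}. prob (A j))"
    if "\<forall>j\<in>{0, 1}. A j \<in> sigma_sets (space P) (\<Union>i\<in>I j. E i)" for A :: "nat \<Rightarrow> 'a set"
    by (rule indep_setsD[OF * _ _ _ that]) auto
  show "distr P ((points_space \<Otimes>\<^sub>M delays_space) \<Otimes>\<^sub>M clusters_space)
      (\<lambda>\<omega>. ((\<lambda>k. T k \<omega>, \<lambda>k. D k \<omega>), \<lambda>k. cluster k \<omega>))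
    = distr P (points_space \<Otimes>\<^sub>M delays_space) (\<lambda>\<omega>. (\<lambda>k. T k \<omega>, \<lambda>k. D k \<omega>))
      \<Otimes>\<^sub>M distr P clusters_space (\<lambda>\<omega> k. cluster k \<omega>)"
  proof (rule distr_pair_if_rectangles_indep)
    fix A B assume A: "A \<in> sets (points_space \<Otimes>\<^sub>M delays_space)" and B: "B \<in> sets clusters_space"
    define a where "a = (\<lambda>\<omega>. (\<lambda>k. T k \<omega>, \<lambda>k. D k \<omega>)) -` A \<inter> space P"
    define b where "b = (\<lambda>\<omega> k. cluster k \<omega>) -` B \<inter> space P"
    have a: "a \<in> sigma_sets (space P) (\<Union>i\<in>I 0. E i)"
      using measurable_sets[OF TDW A] by (simp add: a_def sW I_def E_def)
    have b: "b \<in> sigma_sets (space P) (\<Union>i\<in>I 1. E i)"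
      using measurable_sets[OF LV2 B] by (simp add: b_def sp I_def E_def sigma_sets.Basic)
    show "prob (a \<inter> b) = prob a * prob b"
      using pair[of "\<lambda>j. if j = 0 then a else b"] a b by (simp add: Int_commute)
  qed (measurable, rule cluster_seq_measurable)
  show "distr P (points_space \<Otimes>\<^sub>M delays_space) (\<lambda>\<omega>. (\<lambda>k. T k \<omega>, \<lambda>k. D k \<omega>))
    = distr P points_space (\<lambda>\<omega> k. T k \<omega>) \<Otimes>\<^sub>M distr P delays_space (\<lambda>\<omega> k. D k \<omega>)"
  proof (rule distr_pair_if_rectangles_indep)
    fix A B assume A: "A \<in> sets points_space" and B: "B \<in> sets delays_space"
    define a where "a = (\<lambda>\<omega> k. T k \<omega>) -` A \<inter> space P"
    define b where "b = (\<lambda>\<omega> k. D k \<omega>) -` B \<inter> space P"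
    have a: "a \<in> sets VT" using measurable_sets[OF TV A] by (simp add: a_def sp)
    have b: "b \<in> sets VD" using measurable_sets[OF DV B] by (simp add: b_def sp)
    have "prob (\<Inter>j\<in>{0, 2 :: nat}. if j = 0 then a else b) = (\<Prod>j\<in>{0, 2 :: nat}. prob (if j = 0 then a else b))"
      by (rule indep_setsD[OF ind]) (use a b in \<open>auto simp: E_def\<close>)
    then show "prob (a \<inter> b) = prob a * prob b" by (simp add: Int_commute)
  qed measurable
qed

section \<open>Products over the marked points\<close>

definition path_law :: "(real \<Rightarrow> real) measure" where
  "path_law = distr P path_space (\<lambda>\<omega> t. L t \<omega>)"

definition early_intensity :: "real measure" where
  "early_intensity = density \<Lambda> (indicator {0..1})"

text \<open>The intensity measure of the pairs of an early point and its delay.\<close>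

definition delayed_intensity :: "(real \<times> real) measure" where
  "delayed_intensity = early_intensity \<Otimes>\<^sub>M F\<^sub>D"

abbreviation num_early :: "'a \<Rightarrow> nat" where
  "num_early \<omega> \<equiv> early_count (\<lambda>k. T k \<omega>)"

abbreviation mark_prod :: "(real \<Rightarrow> real \<Rightarrow> (real \<Rightarrow> real) \<Rightarrow> real) \<Rightarrow> 'a \<Rightarrow> real" where
  "mark_prod \<psi> \<omega> \<equiv> (\<Prod>k<num_early \<omega>. \<psi> (real_of_ereal (T k \<omega>)) (D k \<omega>) (cluster k \<omega>))"

abbreviation mark_sum :: "(real \<Rightarrow> real \<Rightarrow> (real \<Rightarrow> real) \<Rightarrow> real) \<Rightarrow> 'a \<Rightarrow> real" where
  "mark_sum \<psi> \<omega> \<equiv> (\<Sum>k<num_early \<omega>. \<psi> (real_of_ereal (T k \<omega>)) (D k \<omega>) (cluster k \<omega>))"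

abbreviation mark_measurable :: "(real \<Rightarrow> real \<Rightarrow> (real \<Rightarrow> real) \<Rightarrow> real) \<Rightarrow> bool" where
  "mark_measurable \<psi> \<equiv> (\<lambda>(v, d, p). \<psi> v d p) \<in> borel_measurable (borel \<Otimes>\<^sub>M borel \<Otimes>\<^sub>M path_space)"

lemma sets_path_law [measurable_cong]: "sets path_law = sets path_space"
  by (simp add: path_law_def)

lemma prob_space_path_law: "prob_space path_law"
  unfolding path_law_def by (rule prob_space_distr) measurable

lemma sets_F\<^sub>D [measurable_cong]: "sets F\<^sub>D = sets borel"
  using D_law[of 0] by (metis sets_distr)

lemma prob_space_F\<^sub>D: "prob_space F\<^sub>D"
  unfolding D_law[of 0, symmetric] by (rule prob_space_distr) measurable

lemma sets_early_intensity [measurable_cong]: "sets early_intensity = sets borel"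
  by (simp add: early_intensity_def sets_\<Lambda>)

lemma finite_early_intensity: "finite_measure early_intensity"
proof -
  note [measurable_cong] = sets_\<Lambda>
  have "emeasure early_intensity (space early_intensity) = emeasure \<Lambda> {0..1}"
    unfolding early_intensity_def
    by (subst emeasure_density) (auto simp: sets_\<Lambda>[THEN sets_eq_imp_space_eq] sets_\<Lambda>)
  then show ?thesis
    using \<Lambda>_locally_finite[of 1] by (intro finite_measureI) simp
qed

lemma sets_delayed_intensity [measurable_cong]: "sets delayed_intensity = sets (borel \<Otimes>\<^sub>M borel)"
  unfolding delayed_intensity_def by (intro sets_pair_measure_cong sets_early_intensity sets_F\<^sub>D)

lemma finite_delayed_intensity: "finite_measure delayed_intensity"
  unfolding delayed_intensity_def
  by (intro finite_measure_pair_measure finite_early_intensity prob_space.finite_measure prob_space_F\<^sub>D)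

lemma mark_measurable_fix:
  assumes "mark_measurable \<psi>"
  shows "\<psi> v d \<in> borel_measurable path_space"
proof -
  have "(\<lambda>p. (v, d, p)) \<in> measurable path_space (borel \<Otimes>\<^sub>M borel \<Otimes>\<^sub>M path_space)" by measurable
  from measurable_compose[OF this assms] show ?thesis by simp
qed

lemma mark_measurable_mean:
  assumes "mark_measurable \<psi>"
  shows "(\<lambda>(v, d). \<integral>p. \<psi> v d p \<partial>path_law) \<in> borel_measurable (borel \<Otimes>\<^sub>M borel)"
proof -
  interpret path_law: prob_space path_law by (rule prob_space_path_law)
  have "(\<lambda>x. (fst (fst x), snd (fst x), snd x)) \<in>
      measurable ((borel \<Otimes>\<^sub>M borel) \<Otimes>\<^sub>M path_law) (borel \<Otimes>\<^sub>M borel \<Otimes>\<^sub>M path_space)"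
    by measurable
  from measurable_compose[OF this assms]
  have "(\<lambda>x. \<psi> (fst (fst x)) (snd (fst x)) (snd x)) \<in> borel_measurable ((borel \<Otimes>\<^sub>M borel) \<Otimes>\<^sub>M path_law)"
    by simp
  then have "(\<lambda>x. \<integral>p. \<psi> (fst x) (snd x) p \<partial>path_law) \<in> borel_measurable (borel \<Otimes>\<^sub>M borel)"
    by (intro path_law.borel_measurable_lebesgue_integral) (simp add: case_prod_beta)
  then show ?thesis by (simp add: case_prod_beta)
qed

lemma mark_measurable_at_points:
  assumes "mark_measurable \<psi>"
  shows "(\<lambda>\<omega>. \<psi> (real_of_ereal (T k \<omega>)) (D k \<omega>) (cluster k \<omega>)) \<in> borel_measurable P"
proof -
  have "(\<lambda>\<omega>. (real_of_ereal (T k \<omega>), D k \<omega>, cluster k \<omega>)) \<in> measurable P (borel \<Otimes>\<^sub>M borel \<Otimes>\<^sub>M path_space)"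
    by measurable
  from measurable_compose[OF this assms] show ?thesis by simp
qed

lemma mark_sum_measurable:
  assumes "mark_measurable \<psi>"
  shows "mark_sum \<psi> \<in> borel_measurable P"
  by (rule measurable_compose_countable[where g = num_early and
        f = "\<lambda>n \<omega>. \<Sum>k<n. \<psi> (real_of_ereal (T k \<omega>)) (D k \<omega>) (cluster k \<omega>)"])
    (intro borel_measurable_sum mark_measurable_at_points[OF assms], measurable)

lemma mark_prod_measurable:
  assumes "mark_measurable \<psi>"
  shows "mark_prod \<psi> \<in> borel_measurable P"
  by (rule measurable_compose_countable[where g = num_early and
        f = "\<lambda>n \<omega>. \<Prod>k<n. \<psi> (real_of_ereal (T k \<omega>)) (D k \<omega>) (cluster k \<omega>)"])
    (intro borel_measurable_prod mark_measurable_at_points[OF assms], measurable)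

text \<open>The Laplace-type functional of the marked Poisson process. The clusters are averaged out
first, given points and delays, then the delays, given the points; what remains is a product over the
points alone.\<close>

lemma
  assumes \<psi>: "mark_measurable \<psi>"
    and int: "\<And>v d. integrable path_law (\<psi> v d)"
    and K: "\<And>v d. (\<integral>p. \<bar>\<psi> v d p\<bar> \<partial>path_law) \<le> K"
  shows integrable_mark_prod: "integrable P (mark_prod \<psi>)"
    and expectation_mark_prod: "expectation (mark_prod \<psi>)
      = exp (\<integral>(v, d). (\<integral>p. \<psi> v d p \<partial>path_law) - 1 \<partial>delayed_intensity)"
proof -
  interpret FD: prob_space F\<^sub>D by (rule prob_space_F\<^sub>D)
  interpret EI: finite_measure early_intensity by (rule finite_early_intensity)
  interpret EF: pair_sigma_finite early_intensity F\<^sub>D ..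
  define m where "m v d = (\<integral>p. \<psi> v d p \<partial>path_law)" for v d
  define m' where "m' v = (\<integral>d. m v d \<partial>F\<^sub>D)" for v
  have m_bound: "\<bar>m v d\<bar> \<le> K" for v d
    unfolding m_def using integral_abs_bound[of path_law "\<psi> v d"] K[of v d] by linarith
  have m_meas[measurable]: "(\<lambda>(v, d). m v d) \<in> borel_measurable (borel \<Otimes>\<^sub>M borel)"
    unfolding m_def by (rule mark_measurable_mean[OF \<psi>])
  have m_int: "integrable F\<^sub>D (m v)" for v
    by (rule FD.integrable_const_bound[where B = K]) (use m_bound in auto)
  have m'_meas[measurable]: "m' \<in> borel_measurable borel"
    unfolding m'_def by (rule FD.borel_measurable_lebesgue_integral) measurable
  have abs_le: "(\<integral>d. \<bar>m v d\<bar> \<partial>F\<^sub>D) \<le> K" for v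
    by (rule FD.integral_le_const) (use m_int m_bound in auto)
  have m'_bound: "\<bar>m' v\<bar> \<le> K" for v
    unfolding m'_def using integral_abs_bound[of F\<^sub>D "m v"] abs_le[of v] by linarith
  have KN: "integrable P (\<lambda>\<omega>. K ^ num_early \<omega>)"
    by (rule early_count_power_integrable[OF points])
  have V: "indep_vars (\<lambda>_. path_space) cluster UNIV" by (rule Lc_indep)
  have Q: "distr P path_space (cluster k) = path_law" for k
    unfolding path_law_def by (rule Lc_copy)
  have g1: "(\<lambda>(u, p). \<psi> (real_of_ereal (fst u k)) (snd u k) p) \<in>
      borel_measurable ((points_space \<Otimes>\<^sub>M delays_space) \<Otimes>\<^sub>M path_space)" for k
  proof -
    have "(\<lambda>x. (real_of_ereal (fst (fst x) k), snd (fst x) k, snd x)) \<in>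
        measurable ((points_space \<Otimes>\<^sub>M delays_space) \<Otimes>\<^sub>M path_space) (borel \<Otimes>\<^sub>M borel \<Otimes>\<^sub>M path_space)"
      by measurable
    from measurable_compose[OF this \<psi>] show ?thesis by (simp add: case_prod_beta)
  qed
  have n1: "(\<lambda>u. early_count (fst u)) \<in> measurable (points_space \<Otimes>\<^sub>M delays_space) (count_space UNIV)"
    by measurable
  have TD: "(\<lambda>\<omega>. (\<lambda>k. T k \<omega>, \<lambda>k. D k \<omega>)) \<in> measurable P (points_space \<Otimes>\<^sub>M delays_space)"
    by measurable
  have KN1: "integrable P (\<lambda>\<omega>. K ^ early_count (fst (\<lambda>k. T k \<omega>, \<lambda>k. D k \<omega>)))"
    using KN by simp
  note avg1 = TD T_D_indep_clusters V Q n1 g1 int K KN1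
  show "integrable P (mark_prod \<psi>)"
    using integrable_prod_indep_marks[OF avg1] by simp
  have e1: "expectation (mark_prod \<psi>) = expectation (\<lambda>\<omega>. \<Prod>k<num_early \<omega>. m (real_of_ereal (T k \<omega>)) (D k \<omega>))"
    using expectation_prod_indep_marks[OF avg1] by (simp add: m_def)
  have g2: "(\<lambda>(\<tau>, d). m (real_of_ereal (\<tau> k)) d) \<in> borel_measurable (points_space \<Otimes>\<^sub>M borel)" for k
  proof -
    have "(\<lambda>x. (real_of_ereal (fst x k), snd x)) \<in> measurable (points_space \<Otimes>\<^sub>M borel) (borel \<Otimes>\<^sub>M borel)"
      by measurable
    from measurable_compose[OF this m_meas] show ?thesis by (simp add: case_prod_beta)
  qed
  have "expectation (\<lambda>\<omega>. \<Prod>k<num_early \<omega>. m (real_of_ereal (T k \<omega>)) (D k \<omega>))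
      = expectation (\<lambda>\<omega>. \<Prod>k<num_early \<omega>. m' (real_of_ereal (T k \<omega>)))"
    unfolding m'_def
    by (rule expectation_prod_indep_marks[where U = "\<lambda>\<omega> k. T k \<omega>" and n = early_count
          and g = "\<lambda>k \<tau>. m (real_of_ereal (\<tau> k))", OF T_seq_measurable T_indep_D D_indep D_law
          early_count_measurable g2 m_int abs_le KN])
  also have "\<dots> = exp (\<integral>v. m' v - 1 \<partial>early_intensity)"
    unfolding early_intensity_def
    by (rule poisson_functional[OF points sets_\<Lambda> _ m'_meas m'_bound]) (rule \<Lambda>_locally_finite)
  also have "(\<integral>v. m' v - 1 \<partial>early_intensity) = (\<integral>v. \<integral>d. m v d - 1 \<partial>F\<^sub>D \<partial>early_intensity)"
    using m_int by (simp add: m'_def FD.prob_space)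
  also have "\<dots> = (\<integral>x. m (fst x) (snd x) - 1 \<partial>delayed_intensity)"
  proof -
    have "integrable (early_intensity \<Otimes>\<^sub>M F\<^sub>D) (\<lambda>x. m (fst x) (snd x) - 1)"
    proof (rule finite_measure.integrable_const_bound[where B = "K + 1"])
      show "finite_measure (early_intensity \<Otimes>\<^sub>M F\<^sub>D)"
        using finite_delayed_intensity by (simp add: delayed_intensity_def)
      show "AE x in early_intensity \<Otimes>\<^sub>M F\<^sub>D. norm (m (fst x) (snd x) - 1) \<le> K + 1"
      proof (rule AE_I2)
        fix x :: "real \<times> real"
        show "norm (m (fst x) (snd x) - 1) \<le> K + 1"
          using m_bound[of "fst x" "snd x"] by (simp add: abs_if split: if_splits)
      qed
      show "(\<lambda>x. m (fst x) (snd x) - 1) \<in> borel_measurable (early_intensity \<Otimes>\<^sub>M F\<^sub>D)"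
        using m_meas by (intro borel_measurable_diff) (simp_all add: case_prod_beta cong: measurable_cong_sets)
    qed
    from EF.integral_fst'[OF this] show ?thesis by (simp add: delayed_intensity_def)
  qed
  finally show "expectation (mark_prod \<psi>)
      = exp (\<integral>(v, d). (\<integral>p. \<psi> v d p \<partial>path_law) - 1 \<partial>delayed_intensity)"
    unfolding e1 by (simp add: m_def split_beta')
qed


section \<open>Moments of sums over the marked points\<close>

lemma mark_measurable_iff:
  "mark_measurable \<psi> \<longleftrightarrow>
    (\<lambda>z. \<psi> (fst z) (fst (snd z)) (snd (snd z))) \<in> borel_measurable (borel \<Otimes>\<^sub>M borel \<Otimes>\<^sub>M path_space)"
  by (simp add: split_beta')

lemma integrable_delayed_intensity_bounded:
  fixes f :: "real \<times> real \<Rightarrow> real"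
  assumes "f \<in> borel_measurable (borel \<Otimes>\<^sub>M borel)" and "\<And>z. \<bar>f z\<bar> \<le> c"
  shows "integrable delayed_intensity f"
  by (rule finite_measure.integrable_const_bound[OF finite_delayed_intensity, where B = c])
    (use assms in \<open>simp_all cong: measurable_cong_sets add: measurable_cong_sets[OF sets_delayed_intensity refl]\<close>)

text \<open>Comparison of the coefficients of \<open>x\<close> in the expectation of the product of \<open>a (1 + x y)\<close>. The bounded
weight \<open>a\<close> is later \<open>z\<close> or 1 according to whether the point has been reported, so that its product is
\<open>z\<close> to the power of the reported count.\<close>

lemma first_moment_marks:
  fixes y :: "real \<Rightarrow> real \<Rightarrow> (real \<Rightarrow> real) \<Rightarrow> real" and a :: "real \<Rightarrow> real \<Rightarrow> real"
  assumes y: "mark_measurable y"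
    and y_int: "\<And>v d. integrable path_law (y v d)"
    and C: "\<And>v d. (\<integral>p. \<bar>y v d p\<bar> \<partial>path_law) \<le> C"
    and a: "(\<lambda>z. a (fst z) (snd z)) \<in> borel_measurable (borel \<Otimes>\<^sub>M borel)"
    and a1: "\<And>v d. \<bar>a v d\<bar> \<le> 1"
  defines "A \<equiv> \<integral>z. a (fst z) (snd z) - 1 \<partial>delayed_intensity"
    and "B \<equiv> \<integral>z. a (fst z) (snd z) * (\<integral>p. y (fst z) (snd z) p \<partial>path_law) \<partial>delayed_intensity"
  shows "integrable P (mark_sum y)"
    and "expectation (mark_prod (\<lambda>v d p. a v d)) = exp A"
    and "expectation (\<lambda>\<omega>. mark_prod (\<lambda>v d p. a v d) \<omega> * mark_sum y \<omega>) = B * exp A"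
proof -
  interpret path_law: prob_space path_law by (rule prob_space_path_law)
  have am[measurable]: "(\<lambda>z. a (fst z) (fst (snd z))) \<in> borel_measurable (borel \<Otimes>\<^sub>M borel \<Otimes>\<^sub>M path_space)"
  proof -
    have "(\<lambda>z. (fst z, fst (snd z))) \<in> measurable (borel \<Otimes>\<^sub>M borel \<Otimes>\<^sub>M path_space) (borel \<Otimes>\<^sub>M borel)"
      by measurable
    from measurable_compose[OF this a] show ?thesis by simp
  qed
  have ym[measurable]: "(\<lambda>z. y (fst z) (fst (snd z)) (snd (snd z))) \<in> borel_measurable (borel \<Otimes>\<^sub>M borel \<Otimes>\<^sub>M path_space)"
    using y unfolding mark_measurable_iff .
  define m where "m v d = (\<integral>p. y v d p \<partial>path_law)" for v d
  have m_meas: "(\<lambda>z. m (fst z) (snd z)) \<in> borel_measurable (borel \<Otimes>\<^sub>M borel)"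
    using mark_measurable_mean[OF y] by (simp add: m_def split_beta')
  have m_bound: "\<bar>m v d\<bar> \<le> C" for v d
    unfolding m_def using integral_abs_bound[of path_law "y v d"] C[of v d] by linarith
  have am_int: "integrable delayed_intensity (\<lambda>z. a (fst z) (snd z) * m (fst z) (snd z))"
  proof (rule integrable_delayed_intensity_bounded)
    show "\<bar>a (fst z) (snd z) * m (fst z) (snd z)\<bar> \<le> 1 * C" for z
      unfolding abs_mult by (intro mult_mono a1 m_bound) auto
  qed (intro borel_measurable_times a m_meas)
  have a_int: "integrable delayed_intensity (\<lambda>z. a (fst z) (snd z) - 1)"
  proof (rule integrable_delayed_intensity_bounded)
    show "\<bar>a (fst z) (snd z) - 1\<bar> \<le> 2" for z using a1[of "fst z" "snd z"] by linarith
  qed (intro borel_measurable_diff a borel_measurable_const)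
  let ?W = "mark_prod (\<lambda>v d p. a v d)"
  let ?S = "mark_sum y"
  let ?Q = "mark_prod (\<lambda>v d p. 1 + \<bar>y v d p\<bar>)"
  have W_meas: "?W \<in> borel_measurable P"
    by (rule mark_prod_measurable) (simp add: mark_measurable_iff am)
  have S_meas: "?S \<in> borel_measurable P" by (rule mark_sum_measurable[OF y])
  have W1: "\<bar>?W \<omega>\<bar> \<le> 1" for \<omega>
    unfolding abs_prod by (intro prod_le_1 conjI abs_ge_zero a1)
  \<comment> \<open>The product of 1 + |y| is integrable and dominates both the sum of y and all Taylor remainders.\<close>
  have Q_int: "integrable P ?Q"
  proof (rule integrable_mark_prod[where K = "1 + C"])
    show "mark_measurable (\<lambda>v d p. 1 + \<bar>y v d p\<bar>)" unfolding mark_measurable_iff by measurable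
    show "integrable path_law (\<lambda>p. 1 + \<bar>y v d p\<bar>)" for v d
      using y_int[of v d] by simp
    show "(\<integral>p. \<bar>1 + \<bar>y v d p\<bar>\<bar> \<partial>path_law) \<le> 1 + C" for v d
      using y_int[of v d] C[of v d] by (simp add: path_law.prob_space)
  qed
  have S_le_Q: "\<bar>?S \<omega>\<bar> \<le> ?Q \<omega>" for \<omega>
  proof -
    have "0 \<le> ?Q \<omega> - 1 - mark_sum (\<lambda>v d p. \<bar>y v d p\<bar>) \<omega>"
      using prod_one_plus_first_order[of "{..<num_early \<omega>}" 1
          "\<lambda>k. y (real_of_ereal (T k \<omega>)) (D k \<omega>) (cluster k \<omega>)"]
      by (simp add: order_trans[OF abs_ge_zero])
    moreover have "\<bar>?S \<omega>\<bar> \<le> mark_sum (\<lambda>v d p. \<bar>y v d p\<bar>) \<omega>" by (rule sum_abs)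
    ultimately show ?thesis by linarith
  qed
  show S_int: "integrable P ?S"
    by (rule Bochner_Integration.integrable_bound[OF Q_int S_meas])
      (intro AE_I2, use S_le_Q in \<open>auto intro: order_trans[OF _ abs_ge_self]\<close>)
  have W_int: "integrable P ?W"
    by (rule integrable_const_bound[where B = 1]) (use W1 W_meas in auto)
  have WS_int: "integrable P (\<lambda>\<omega>. ?W \<omega> * ?S \<omega>)"
  proof (rule Bochner_Integration.integrable_bound[OF S_int])
    show "AE \<omega> in P. norm (?W \<omega> * ?S \<omega>) \<le> norm (?S \<omega>)"
      using W1 by (intro AE_I2) (simp add: abs_mult mult_left_le_one_le)
  qed (intro borel_measurable_times W_meas S_meas)
  define \<psi> where "\<psi> x v d p = a v d * (1 + x * y v d p)" for x v d p
  have \<psi>_int: "integrable path_law (\<psi> x v d)" for x v d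
    unfolding \<psi>_def using y_int[of v d] by simp
  have \<psi>_E: "integrable P (mark_prod (\<psi> x)) \<and> expectation (mark_prod (\<psi> x)) = exp (A + x * B)"
    if x: "0 \<le> x" "x \<le> 1" for x
  proof -
    have \<psi>m: "mark_measurable (\<psi> x)" unfolding mark_measurable_iff \<psi>_def by measurable
    have \<psi>K: "(\<integral>p. \<bar>\<psi> x v d p\<bar> \<partial>path_law) \<le> 1 + C" for v d
    proof -
      have "(\<integral>p. \<bar>\<psi> x v d p\<bar> \<partial>path_law) \<le> (\<integral>p. 1 + \<bar>y v d p\<bar> \<partial>path_law)"
      proof (rule integral_mono)
        fix p
        have "\<bar>x * y v d p\<bar> \<le> 1 * \<bar>y v d p\<bar>" unfolding abs_mult using x by (intro mult_mono) auto
        then have "\<bar>1 + x * y v d p\<bar> \<le> 1 + \<bar>y v d p\<bar>" by linarith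
        then have "\<bar>a v d\<bar> * \<bar>1 + x * y v d p\<bar> \<le> 1 * (1 + \<bar>y v d p\<bar>)" by (intro mult_mono a1) auto
        then show "\<bar>\<psi> x v d p\<bar> \<le> 1 + \<bar>y v d p\<bar>" by (simp add: \<psi>_def abs_mult)
      qed (use \<psi>_int[of x v d] y_int[of v d] in auto)
      also have "\<dots> \<le> 1 + C" using y_int[of v d] C[of v d] by (simp add: path_law.prob_space)
      finally show ?thesis .
    qed
    have mean: "(\<integral>p. \<psi> x v d p \<partial>path_law) = a v d + x * (a v d * m v d)" for v d
      unfolding \<psi>_def m_def using y_int[of v d] by (simp add: path_law.prob_space algebra_simps)
    have "(\<integral>(v, d). (\<integral>p. \<psi> x v d p \<partial>path_law) - 1 \<partial>delayed_intensity)
        = (\<integral>z. (a (fst z) (snd z) - 1) + x * (a (fst z) (snd z) * m (fst z) (snd z)) \<partial>delayed_intensity)"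
      unfolding mean by (simp add: split_beta' algebra_simps)
    also have "\<dots> = A + x * B"
      unfolding A_def B_def m_def[symmetric] using a_int am_int by simp
    finally show ?thesis
      using integrable_mark_prod[OF \<psi>m \<psi>_int \<psi>K] expectation_mark_prod[OF \<psi>m \<psi>_int \<psi>K] by simp
  qed
  have \<psi>0: "mark_prod (\<psi> 0) = ?W" by (simp add: \<psi>_def)
  show EW: "expectation ?W = exp A" using \<psi>_E[of 0] by (simp add: \<psi>0)
  obtain K where K: "\<And>x. 0 \<le> x \<Longrightarrow> x \<le> 1 \<Longrightarrow> \<bar>exp (x * B) - 1 - x * B - x\<^sup>2 * B\<^sup>2 / 2\<bar> \<le> K * x ^ 3"
    using exp_second_order[of B 0] by auto
  have "expectation (\<lambda>\<omega>. ?W \<omega> * ?S \<omega>) - B * exp A = 0"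
  proof (rule eq_zero_if_higher_order[where n = 1 and K = "expectation ?Q + exp A * (\<bar>K\<bar> + B\<^sup>2 / 2)"])
    fix x :: real assume x: "0 < x" "x \<le> 1"
    have i: "integrable P (mark_prod (\<psi> x))" and e: "expectation (mark_prod (\<psi> x)) = exp (A + x * B)"
      using \<psi>_E[of x] x by auto
    have rem: "\<bar>mark_prod (\<psi> x) \<omega> - ?W \<omega> - x * (?W \<omega> * ?S \<omega>)\<bar> \<le> x\<^sup>2 * ?Q \<omega>" for \<omega>
    proof -
      let ?y = "\<lambda>k. y (real_of_ereal (T k \<omega>)) (D k \<omega>) (cluster k \<omega>)"
      have "mark_prod (\<psi> x) \<omega> = ?W \<omega> * (\<Prod>k<num_early \<omega>. 1 + x * ?y k)"
        by (simp add: \<psi>_def prod.distrib)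
      then have "mark_prod (\<psi> x) \<omega> - ?W \<omega> - x * (?W \<omega> * ?S \<omega>)
          = ?W \<omega> * ((\<Prod>k<num_early \<omega>. 1 + x * ?y k) - 1 - x * (\<Sum>k<num_early \<omega>. ?y k))"
        by (simp add: right_diff_distrib mult.left_commute)
      moreover have "\<bar>?W \<omega>\<bar> * \<bar>(\<Prod>k<num_early \<omega>. 1 + x * ?y k) - 1 - x * (\<Sum>k<num_early \<omega>. ?y k)\<bar>
          \<le> 1 * (x\<^sup>2 * ?Q \<omega>)"
      proof (intro mult_mono W1)
        have "\<bar>(\<Prod>k<num_early \<omega>. 1 + x * ?y k) - 1 - x * (\<Sum>k<num_early \<omega>. ?y k)\<bar>
            \<le> x\<^sup>2 * (?Q \<omega> - 1 - (\<Sum>k<num_early \<omega>. \<bar>?y k\<bar>))"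
          using x by (intro prod_one_plus_first_order) auto
        also have "\<dots> \<le> x\<^sup>2 * ?Q \<omega>"
        proof (rule mult_left_mono)
          have "0 \<le> (\<Sum>k<num_early \<omega>. \<bar>?y k\<bar>)" by (rule sum_nonneg) simp
          then show "?Q \<omega> - 1 - (\<Sum>k<num_early \<omega>. \<bar>?y k\<bar>) \<le> ?Q \<omega>" by linarith
        qed simp
        finally show "\<bar>(\<Prod>k<num_early \<omega>. 1 + x * ?y k) - 1 - x * (\<Sum>k<num_early \<omega>. ?y k)\<bar> \<le> x\<^sup>2 * ?Q \<omega>" .
      qed auto
      ultimately show ?thesis by (simp add: abs_mult)
    qed
    have "\<bar>exp (A + x * B) - exp A - x * expectation (\<lambda>\<omega>. ?W \<omega> * ?S \<omega>)\<bar>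
        = \<bar>expectation (\<lambda>\<omega>. mark_prod (\<psi> x) \<omega> - ?W \<omega> - x * (?W \<omega> * ?S \<omega>))\<bar>"
      using i W_int WS_int by (simp add: e EW)
    also have "\<dots> \<le> expectation (\<lambda>\<omega>. \<bar>mark_prod (\<psi> x) \<omega> - ?W \<omega> - x * (?W \<omega> * ?S \<omega>)\<bar>)"
      by (rule integral_abs_bound)
    also have "\<dots> \<le> expectation (\<lambda>\<omega>. x\<^sup>2 * ?Q \<omega>)"
      using i W_int WS_int Q_int rem by (intro integral_mono) auto
    finally have 1: "\<bar>exp (A + x * B) - exp A - x * expectation (\<lambda>\<omega>. ?W \<omega> * ?S \<omega>)\<bar> \<le> x\<^sup>2 * expectation ?Q"
      by simp
    have x3: "K * x ^ 3 \<le> \<bar>K\<bar> * x\<^sup>2"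
      using x power_decreasing[of 2 3 x] by (intro mult_mono) auto
    have "\<bar>exp (x * B) - 1 - x * B\<bar> \<le> \<bar>K\<bar> * x\<^sup>2 + x\<^sup>2 * B\<^sup>2 / 2"
    proof -
      have "0 \<le> x\<^sup>2 * B\<^sup>2" by simp
      then show ?thesis using K[of x] x x3 by linarith
    qed
    then have le: "exp A * \<bar>exp (x * B) - 1 - x * B\<bar> \<le> exp A * (\<bar>K\<bar> * x\<^sup>2 + x\<^sup>2 * B\<^sup>2 / 2)"
      by (rule mult_left_mono) simp
    have 2: "\<bar>exp (A + x * B) - exp A - x * (B * exp A)\<bar> \<le> exp A * (\<bar>K\<bar> * x\<^sup>2 + x\<^sup>2 * B\<^sup>2 / 2)"
    proof -
      have "exp (A + x * B) - exp A - x * (B * exp A) = exp A * (exp (x * B) - 1 - x * B)"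
        by (simp add: exp_add algebra_simps)
      then show ?thesis using le by (simp only: abs_mult abs_exp_cancel)
    qed
    have "x * \<bar>expectation (\<lambda>\<omega>. ?W \<omega> * ?S \<omega>) - B * exp A\<bar>
        = \<bar>(exp (A + x * B) - exp A - x * (B * exp A)) - (exp (A + x * B) - exp A - x * expectation (\<lambda>\<omega>. ?W \<omega> * ?S \<omega>))\<bar>"
    proof -
      have "x * (expectation (\<lambda>\<omega>. ?W \<omega> * ?S \<omega>) - B * exp A)
          = (exp (A + x * B) - exp A - x * (B * exp A)) - (exp (A + x * B) - exp A - x * expectation (\<lambda>\<omega>. ?W \<omega> * ?S \<omega>))"
        by (simp add: right_diff_distrib)
      from arg_cong[OF this, of abs] show ?thesis using x by (simp only: abs_mult abs_of_pos)
    qed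
    also have "\<dots> \<le> exp A * (\<bar>K\<bar> * x\<^sup>2 + x\<^sup>2 * B\<^sup>2 / 2) + x\<^sup>2 * expectation ?Q"
      using 1 2 by linarith
    also have "\<dots> = (expectation ?Q + exp A * (\<bar>K\<bar> + B\<^sup>2 / 2)) * x ^ Suc 1"
      by (simp add: algebra_simps power2_eq_square)
    finally show "x ^ 1 * \<bar>expectation (\<lambda>\<omega>. ?W \<omega> * ?S \<omega>) - B * exp A\<bar>
        \<le> (expectation ?Q + exp A * (\<bar>K\<bar> + B\<^sup>2 / 2)) * x ^ Suc 1" by simp
  qed
  then show "expectation (\<lambda>\<omega>. ?W \<omega> * ?S \<omega>) = B * exp A" by simp
qed

text \<open>The same comparison one order higher. The factors contain only \<open>y\<close> and \<open>y\<^sup>2\<close>, so that finite second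
moments suffice although the square of the sum contains all mixed products.\<close>

lemma second_moment_marks:
  fixes y :: "real \<Rightarrow> real \<Rightarrow> (real \<Rightarrow> real) \<Rightarrow> real" and a :: "real \<Rightarrow> real \<Rightarrow> real"
  assumes y: "mark_measurable y"
    and y_int: "\<And>v d. integrable path_law (y v d)"
    and C: "\<And>v d. (\<integral>p. \<bar>y v d p\<bar> \<partial>path_law) \<le> C"
    and y2_int: "\<And>v d. integrable path_law (\<lambda>p. (y v d p)\<^sup>2)"
    and C2: "\<And>v d. (\<integral>p. (y v d p)\<^sup>2 \<partial>path_law) \<le> C2"
    and a: "(\<lambda>z. a (fst z) (snd z)) \<in> borel_measurable (borel \<Otimes>\<^sub>M borel)"
    and a1: "\<And>v d. \<bar>a v d\<bar> \<le> 1"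
  defines "A \<equiv> \<integral>z. a (fst z) (snd z) - 1 \<partial>delayed_intensity"
    and "B \<equiv> \<integral>z. a (fst z) (snd z) * (\<integral>p. y (fst z) (snd z) p \<partial>path_law) \<partial>delayed_intensity"
    and "B2 \<equiv> \<integral>z. a (fst z) (snd z) * (\<integral>p. (y (fst z) (snd z) p)\<^sup>2 \<partial>path_law) \<partial>delayed_intensity"
  shows "integrable P (\<lambda>\<omega>. (mark_sum y \<omega>)\<^sup>2)"
    and "expectation (\<lambda>\<omega>. mark_prod (\<lambda>v d p. a v d) \<omega> * (mark_sum y \<omega>)\<^sup>2) = (B2 + B\<^sup>2) * exp A"
proof -
  interpret path_law: prob_space path_law by (rule prob_space_path_law)
  have am[measurable]: "(\<lambda>z. a (fst z) (fst (snd z))) \<in> borel_measurable (borel \<Otimes>\<^sub>M borel \<Otimes>\<^sub>M path_space)"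
  proof -
    have "(\<lambda>z. (fst z, fst (snd z))) \<in> measurable (borel \<Otimes>\<^sub>M borel \<Otimes>\<^sub>M path_space) (borel \<Otimes>\<^sub>M borel)"
      by measurable
    from measurable_compose[OF this a] show ?thesis by simp
  qed
  have ym[measurable]: "(\<lambda>z. y (fst z) (fst (snd z)) (snd (snd z))) \<in> borel_measurable (borel \<Otimes>\<^sub>M borel \<Otimes>\<^sub>M path_space)"
    using y unfolding mark_measurable_iff .
  have y2m: "mark_measurable (\<lambda>v d p. (y v d p)\<^sup>2)"
    unfolding mark_measurable_iff by measurable
  define m where "m v d = (\<integral>p. y v d p \<partial>path_law)" for v d
  define m2 where "m2 v d = (\<integral>p. (y v d p)\<^sup>2 \<partial>path_law)" for v d
  have m_meas: "(\<lambda>z. m (fst z) (snd z)) \<in> borel_measurable (borel \<Otimes>\<^sub>M borel)"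
    using mark_measurable_mean[OF y] by (simp add: m_def split_beta')
  have m2_meas: "(\<lambda>z. m2 (fst z) (snd z)) \<in> borel_measurable (borel \<Otimes>\<^sub>M borel)"
    using mark_measurable_mean[OF y2m] by (simp add: m2_def split_beta')
  have m_bound: "\<bar>m v d\<bar> \<le> C" for v d
    unfolding m_def using integral_abs_bound[of path_law "y v d"] C[of v d] by linarith
  have m2_bound: "\<bar>m2 v d\<bar> \<le> C2" for v d
    unfolding m2_def using C2[of v d] by (simp add: abs_of_nonneg)
  have am_int: "integrable delayed_intensity (\<lambda>z. a (fst z) (snd z) * m (fst z) (snd z))"
  proof (rule integrable_delayed_intensity_bounded)
    show "\<bar>a (fst z) (snd z) * m (fst z) (snd z)\<bar> \<le> 1 * C" for z
      unfolding abs_mult by (intro mult_mono a1 m_bound) auto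
  qed (intro borel_measurable_times a m_meas)
  have am2_int: "integrable delayed_intensity (\<lambda>z. a (fst z) (snd z) * m2 (fst z) (snd z))"
  proof (rule integrable_delayed_intensity_bounded)
    show "\<bar>a (fst z) (snd z) * m2 (fst z) (snd z)\<bar> \<le> 1 * C2" for z
      unfolding abs_mult by (intro mult_mono a1 m2_bound) auto
  qed (intro borel_measurable_times a m2_meas)
  have a_int: "integrable delayed_intensity (\<lambda>z. a (fst z) (snd z) - 1)"
  proof (rule integrable_delayed_intensity_bounded)
    show "\<bar>a (fst z) (snd z) - 1\<bar> \<le> 2" for z using a1[of "fst z" "snd z"] by linarith
  qed (intro borel_measurable_diff a borel_measurable_const)
  let ?W = "mark_prod (\<lambda>v d p. a v d)"
  let ?S = "mark_sum y"
  let ?q = "\<lambda>v d p. 1 + \<bar>y v d p\<bar> + (y v d p)\<^sup>2 / 2"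
  let ?Q = "mark_prod ?q"
  note first = first_moment_marks[OF y y_int C a a1, folded A_def B_def]
  have S_int: "integrable P ?S" by (rule first(1))
  have EW: "expectation ?W = exp A" by (rule first(2))
  have EWS: "expectation (\<lambda>\<omega>. ?W \<omega> * ?S \<omega>) = B * exp A" by (rule first(3))
  have W_meas: "?W \<in> borel_measurable P"
    by (rule mark_prod_measurable) (simp add: mark_measurable_iff am)
  have S_meas: "?S \<in> borel_measurable P" by (rule mark_sum_measurable[OF y])
  have W1: "\<bar>?W \<omega>\<bar> \<le> 1" for \<omega>
    unfolding abs_prod by (intro prod_le_1 conjI abs_ge_zero a1)
  have q_int: "integrable path_law (?q v d)" for v d
    using y_int[of v d] y2_int[of v d] by simp
  have q_le: "(\<integral>p. ?q v d p \<partial>path_law) \<le> 1 + C + C2 / 2" for v d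
    using y_int[of v d] y2_int[of v d] C[of v d] C2[of v d] by (simp add: path_law.prob_space)
  have Q_int: "integrable P ?Q"
  proof (rule integrable_mark_prod[where K = "1 + C + C2 / 2"])
    show "mark_measurable ?q" unfolding mark_measurable_iff by measurable
    show "integrable path_law (?q v d)" for v d by (rule q_int)
    have "\<bar>?q v d p\<bar> = ?q v d p" for v d p by (rule abs_of_nonneg) simp
    then show "(\<integral>p. \<bar>?q v d p\<bar> \<partial>path_law) \<le> 1 + C + C2 / 2" for v d
      using q_le[of v d] by (simp only:)
  qed
  have S2_le_Q: "(?S \<omega>)\<^sup>2 \<le> 2 * ?Q \<omega>" for \<omega>
  proof -
    let ?A = "mark_sum (\<lambda>v d p. \<bar>y v d p\<bar>) \<omega>"
    have "0 \<le> ?Q \<omega> - 1 - ?A - ?A\<^sup>2 / 2"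
      using prod_one_plus_second_order[of "{..<num_early \<omega>}" 1
          "\<lambda>k. y (real_of_ereal (T k \<omega>)) (D k \<omega>) (cluster k \<omega>)"]
      by (simp add: order_trans[OF abs_ge_zero])
    moreover have "\<bar>?S \<omega>\<bar> \<le> ?A" by (rule sum_abs)
    moreover from this have "(?S \<omega>)\<^sup>2 \<le> ?A\<^sup>2" by (rule power2_le_iff_abs_le[THEN iffD2, rotated]) (simp add: sum_nonneg)
    ultimately show ?thesis by linarith
  qed
  show S2_int: "integrable P (\<lambda>\<omega>. (?S \<omega>)\<^sup>2)"
  proof (rule Bochner_Integration.integrable_bound)
    show "integrable P (\<lambda>\<omega>. 2 * ?Q \<omega>)" using Q_int by simp
    show "AE \<omega> in P. norm ((?S \<omega>)\<^sup>2) \<le> norm (2 * ?Q \<omega>)"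
      using S2_le_Q by (intro AE_I2) (auto intro: order_trans[OF _ abs_ge_self])
  qed (intro borel_measurable_power S_meas)
  have W_int: "integrable P ?W"
    by (rule integrable_const_bound[where B = 1]) (use W1 W_meas in auto)
  have WS_int: "integrable P (\<lambda>\<omega>. ?W \<omega> * ?S \<omega>)"
  proof (rule Bochner_Integration.integrable_bound[OF S_int])
    show "AE \<omega> in P. norm (?W \<omega> * ?S \<omega>) \<le> norm (?S \<omega>)"
      using W1 by (intro AE_I2) (simp add: abs_mult mult_left_le_one_le)
  qed (intro borel_measurable_times W_meas S_meas)
  have WS2_int: "integrable P (\<lambda>\<omega>. ?W \<omega> * (?S \<omega>)\<^sup>2)"
  proof (rule Bochner_Integration.integrable_bound[OF S2_int])
    show "AE \<omega> in P. norm (?W \<omega> * (?S \<omega>)\<^sup>2) \<le> norm ((?S \<omega>)\<^sup>2)"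
      using W1 by (intro AE_I2) (simp add: abs_mult mult_left_le_one_le)
  qed (intro borel_measurable_times borel_measurable_power W_meas S_meas)
  define \<psi> where "\<psi> x v d p = a v d * (1 + x * y v d p + x\<^sup>2 * (y v d p)\<^sup>2 / 2)" for x v d p
  have \<psi>_int: "integrable path_law (\<psi> x v d)" for x v d
    unfolding \<psi>_def using y_int[of v d] y2_int[of v d] by simp
  have \<psi>_E: "integrable P (mark_prod (\<psi> x)) \<and> expectation (mark_prod (\<psi> x)) = exp (A + (x * B + x\<^sup>2 * B2 / 2))"
    if x: "0 \<le> x" "x \<le> 1" for x
  proof -
    have \<psi>m: "mark_measurable (\<psi> x)" unfolding mark_measurable_iff \<psi>_def by measurable
    have \<psi>K: "(\<integral>p. \<bar>\<psi> x v d p\<bar> \<partial>path_law) \<le> 1 + C + C2 / 2" for v d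
    proof -
      have "(\<integral>p. \<bar>\<psi> x v d p\<bar> \<partial>path_law) \<le> (\<integral>p. ?q v d p \<partial>path_law)"
      proof (rule integral_mono)
        fix p
        have "\<bar>x * y v d p\<bar> \<le> 1 * \<bar>y v d p\<bar>" unfolding abs_mult using x by (intro mult_mono) auto
        moreover have "x\<^sup>2 * (y v d p)\<^sup>2 \<le> 1 * (y v d p)\<^sup>2"
          using x by (intro mult_right_mono) (auto simp: power_le_one)
        moreover have "0 \<le> x\<^sup>2 * (y v d p)\<^sup>2" by simp
        ultimately have "\<bar>1 + x * y v d p + x\<^sup>2 * (y v d p)\<^sup>2 / 2\<bar> \<le> ?q v d p" by linarith
        then have "\<bar>a v d\<bar> * \<bar>1 + x * y v d p + x\<^sup>2 * (y v d p)\<^sup>2 / 2\<bar> \<le> 1 * ?q v d p"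
          by (intro mult_mono a1) auto
        then show "\<bar>\<psi> x v d p\<bar> \<le> ?q v d p" by (simp add: \<psi>_def abs_mult)
      qed (use \<psi>_int[of x v d] q_int[of v d] in auto)
      also have "\<dots> \<le> 1 + C + C2 / 2" by (rule q_le)
      finally show ?thesis .
    qed
    have mean: "(\<integral>p. \<psi> x v d p \<partial>path_law) = a v d + x * (a v d * m v d) + x\<^sup>2 / 2 * (a v d * m2 v d)" for v d
      unfolding \<psi>_def m_def m2_def using y_int[of v d] y2_int[of v d]
      by (simp add: path_law.prob_space algebra_simps)
    have "(\<integral>(v, d). (\<integral>p. \<psi> x v d p \<partial>path_law) - 1 \<partial>delayed_intensity)
        = (\<integral>z. (a (fst z) (snd z) - 1) + x * (a (fst z) (snd z) * m (fst z) (snd z))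
            + x\<^sup>2 / 2 * (a (fst z) (snd z) * m2 (fst z) (snd z)) \<partial>delayed_intensity)"
      unfolding mean by (simp add: split_beta' algebra_simps)
    also have "\<dots> = A + (x * B + x\<^sup>2 * B2 / 2)"
      unfolding A_def B_def B2_def m_def[symmetric] m2_def[symmetric] using a_int am_int am2_int by simp
    finally show ?thesis
      using integrable_mark_prod[OF \<psi>m \<psi>_int \<psi>K] expectation_mark_prod[OF \<psi>m \<psi>_int \<psi>K] by simp
  qed
  obtain K where K: "\<And>x. 0 \<le> x \<Longrightarrow> x \<le> 1 \<Longrightarrow>
      \<bar>exp (x * B + x\<^sup>2 * B2 / 2) - 1 - x * B - x\<^sup>2 * (B2 + B\<^sup>2) / 2\<bar> \<le> K * x ^ 3"
    using exp_second_order[of B B2] by auto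
  have "(expectation (\<lambda>\<omega>. ?W \<omega> * (?S \<omega>)\<^sup>2) - (B2 + B\<^sup>2) * exp A) / 2 = 0"
  proof (rule eq_zero_if_higher_order[where n = 2 and K = "expectation ?Q + exp A * K"])
    fix x :: real assume x: "0 < x" "x \<le> 1"
    define r where "r = exp (x * B + x\<^sup>2 * B2 / 2) - 1 - x * B - x\<^sup>2 * (B2 + B\<^sup>2) / 2"
    define R where "R \<omega> = mark_prod (\<psi> x) \<omega> - ?W \<omega> - x * (?W \<omega> * ?S \<omega>) - x\<^sup>2 / 2 * (?W \<omega> * (?S \<omega>)\<^sup>2)" for \<omega>
    have i: "integrable P (mark_prod (\<psi> x))"
      and e: "expectation (mark_prod (\<psi> x)) = exp (A + (x * B + x\<^sup>2 * B2 / 2))"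
      using \<psi>_E[of x] x by auto
    have rem: "\<bar>R \<omega>\<bar> \<le> x ^ 3 * ?Q \<omega>" for \<omega>
    proof -
      let ?y = "\<lambda>k. y (real_of_ereal (T k \<omega>)) (D k \<omega>) (cluster k \<omega>)"
      let ?s = "\<Sum>k<num_early \<omega>. \<bar>?y k\<bar>"
      let ?r = "(\<Prod>k<num_early \<omega>. 1 + x * ?y k + x\<^sup>2 * (?y k)\<^sup>2 / 2) - 1 - x * (\<Sum>k<num_early \<omega>. ?y k)
          - x\<^sup>2 * (\<Sum>k<num_early \<omega>. ?y k)\<^sup>2 / 2"
      have "mark_prod (\<psi> x) \<omega> = ?W \<omega> * (\<Prod>k<num_early \<omega>. 1 + x * ?y k + x\<^sup>2 * (?y k)\<^sup>2 / 2)"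
        by (simp add: \<psi>_def prod.distrib)
      then have R: "R \<omega> = ?W \<omega> * ?r"
        unfolding R_def by (simp add: right_diff_distrib mult.left_commute)
      have "\<bar>?W \<omega>\<bar> * \<bar>?r\<bar> \<le> 1 * (x ^ 3 * ?Q \<omega>)"
      proof (intro mult_mono W1)
        have "\<bar>?r\<bar> \<le> x ^ 3 * (?Q \<omega> - 1 - ?s - ?s\<^sup>2 / 2)"
          using x by (intro prod_one_plus_second_order) auto
        also have "\<dots> \<le> x ^ 3 * ?Q \<omega>"
        proof (rule mult_left_mono)
          have "0 \<le> ?s" "0 \<le> ?s\<^sup>2" by (simp_all add: sum_nonneg)
          then show "?Q \<omega> - 1 - ?s - ?s\<^sup>2 / 2 \<le> ?Q \<omega>" by linarith
        qed (use x in simp)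
        finally show "\<bar>?r\<bar> \<le> x ^ 3 * ?Q \<omega>" .
      qed auto
      then show ?thesis by (simp only: R abs_mult mult_1)
    qed
    have R_int: "integrable P R"
      unfolding R_def using i W_int WS_int WS2_int by simp
    have ER: "expectation R = exp A * r - x\<^sup>2 * ((expectation (\<lambda>\<omega>. ?W \<omega> * (?S \<omega>)\<^sup>2) - (B2 + B\<^sup>2) * exp A) / 2)"
    proof -
      have "expectation R = exp (A + (x * B + x\<^sup>2 * B2 / 2)) - exp A - x * (B * exp A)
          - x\<^sup>2 / 2 * expectation (\<lambda>\<omega>. ?W \<omega> * (?S \<omega>)\<^sup>2)"
        unfolding R_def using i W_int WS_int WS2_int by (simp add: e EW EWS)
      also have "\<dots> = exp A * r - x\<^sup>2 * ((expectation (\<lambda>\<omega>. ?W \<omega> * (?S \<omega>)\<^sup>2) - (B2 + B\<^sup>2) * exp A) / 2)"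
        unfolding r_def exp_add[of A] by (simp add: field_simps)
      finally show ?thesis .
    qed
    have "\<bar>expectation R\<bar> \<le> expectation (\<lambda>\<omega>. \<bar>R \<omega>\<bar>)"
      by (rule integral_abs_bound)
    also have "\<dots> \<le> expectation (\<lambda>\<omega>. x ^ 3 * ?Q \<omega>)"
      using R_int Q_int rem by (intro integral_mono) auto
    finally have 1: "\<bar>expectation R\<bar> \<le> x ^ 3 * expectation ?Q" by simp
    have "\<bar>r\<bar> \<le> K * x ^ 3" unfolding r_def using K[of x] x by simp
    then have 2: "\<bar>exp A * r\<bar> \<le> exp A * (K * x ^ 3)"
      unfolding abs_mult by simp
    have "\<bar>x\<^sup>2 * ((expectation (\<lambda>\<omega>. ?W \<omega> * (?S \<omega>)\<^sup>2) - (B2 + B\<^sup>2) * exp A) / 2)\<bar>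
        \<le> exp A * (K * x ^ 3) + x ^ 3 * expectation ?Q"
      using 1 2 ER by linarith
    also have "\<dots> = (expectation ?Q + exp A * K) * x ^ Suc 2"
      by (simp add: algebra_simps)
    finally show "x ^ 2 * \<bar>(expectation (\<lambda>\<omega>. ?W \<omega> * (?S \<omega>)\<^sup>2) - (B2 + B\<^sup>2) * exp A) / 2\<bar>
        \<le> (expectation ?Q + exp A * K) * x ^ Suc 2"
      unfolding abs_mult by simp
  qed
  then show "expectation (\<lambda>\<omega>. ?W \<omega> * (?S \<omega>)\<^sup>2) = (B2 + B\<^sup>2) * exp A" by simp
qed


section \<open>The increments of the clusters\<close>

text \<open>The contribution of a cluster with path \<open>p\<close>, point \<open>v\<close> and delay \<open>d\<close> to the increment over \<open>(t, t + s]\<close>.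
It is cut off for \<open>v + d < 0\<close>, which has probability zero: otherwise clusters
would be evaluated after time \<open>t + s\<close>, and the moments need not be bounded over all \<open>v\<close> and \<open>d\<close>.\<close>

definition cluster_incr :: "real \<Rightarrow> real \<Rightarrow> real \<Rightarrow> real \<Rightarrow> (real \<Rightarrow> real) \<Rightarrow> real" where
  "cluster_incr t s v d p =
     (if 0 \<le> v + d then path_value (t + s - (v + d)) p - path_value (t - (v + d)) p else 0)"

definition incr_moment :: "real \<Rightarrow> real \<Rightarrow> nat \<Rightarrow> real \<Rightarrow> real" where
  "incr_moment t s i w = expectation (\<lambda>\<omega>. incr L (t - w) (t + s - w) \<omega> ^ i)"

lemma path_value_L: "\<omega> \<in> space P \<Longrightarrow> path_value u (\<lambda>t. L t \<omega>) = L u \<omega>"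
  using L_additive by (intro path_value_eq) (auto simp: additive_process_def cadlag_def)

lemma path_value_Lc: "\<omega> \<in> space P \<Longrightarrow> path_value u (cluster k \<omega>) = Lc k u \<omega>"
  using Lc_additive[of k] by (intro path_value_eq) (auto simp: additive_process_def cadlag_def)

text \<open>The assumption on negative times concerns the clusters; it passes to the generic copy because each fixed time
is an event of the path law.\<close>

lemma L_nonpos:
  assumes "u \<le> 0"
  shows "AE \<omega> in P. L u \<omega> = 0"
proof -
  have pm: "{p \<in> space path_space. p u = 0} \<in> sets path_space" by measurable
  have "AE \<omega> in P. cluster 0 \<omega> u = 0" using Lc_nonpos[OF assms] by simp
  then have "AE p in distr P path_space (cluster 0). p u = 0"
    by (subst AE_distr_iff[OF cluster_measurable pm])
  then have "AE p in distr P path_space (\<lambda>\<omega> t. L t \<omega>). p u = 0"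
    unfolding Lc_copy .
  then show ?thesis
    by (subst (asm) AE_distr_iff[OF L_path_measurable pm])
qed

lemma path_incr_measurable:
  "(\<lambda>z. path_value (t + s - fst z) (snd z) - path_value (t - fst z) (snd z))
    \<in> borel_measurable (borel \<Otimes>\<^sub>M path_space)"
proof -
  have "(\<lambda>z. path_value (c - fst z) (snd z)) \<in> borel_measurable (borel \<Otimes>\<^sub>M path_space)" for c
  proof -
    have "(\<lambda>z. (c - fst z, snd z)) \<in> measurable (borel \<Otimes>\<^sub>M path_space) (borel \<Otimes>\<^sub>M path_space)"
      by measurable
    from measurable_compose[OF this path_value_measurable] show ?thesis by simp
  qed
  then show ?thesis by (intro borel_measurable_diff)
qed

lemma cluster_incr_measurable: "mark_measurable (cluster_incr t s)"
proof -
  have "(\<lambda>z. (fst z + fst (snd z), snd (snd z))) \<in>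
      measurable ((borel :: real measure) \<Otimes>\<^sub>M (borel :: real measure) \<Otimes>\<^sub>M path_space) (borel \<Otimes>\<^sub>M path_space)"
    by measurable
  from measurable_compose[OF this path_incr_measurable[of t s]]
  show ?thesis
    unfolding mark_measurable_iff cluster_incr_def
    by (intro measurable_If borel_measurable_const) simp_all
qed

lemma incr_moment_eq:
  "incr_moment t s i w = (\<integral>p. (path_value (t + s - w) p - path_value (t - w) p) ^ i \<partial>path_law)"
proof -
  have [measurable]: "(\<lambda>p. path_value (t + s - w) p - path_value (t - w) p) \<in> borel_measurable path_space"
    using measurable_compose[OF measurable_Pair1'[of w borel path_space] path_incr_measurable[of t s]]
    by simp
  show ?thesis
    unfolding path_law_def incr_moment_def
    by (subst integral_distr)
      (auto simp: path_value_L incr_def intro!: Bochner_Integration.integral_cong)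
qed

lemma incr_moment_measurable [measurable]: "incr_moment t s i \<in> borel_measurable borel"
proof -
  interpret path_law: prob_space path_law by (rule prob_space_path_law)
  have "(\<lambda>w. \<integral>p. (path_value (t + s - w) p - path_value (t - w) p) ^ i \<partial>path_law) \<in> borel_measurable borel"
    using borel_measurable_power[OF path_incr_measurable[of t s], of i]
    by (intro path_law.borel_measurable_lebesgue_integral)
      (simp add: split_beta' cong: measurable_cong_sets sets_pair_measure_cong)
  then show ?thesis by (simp only: incr_moment_eq[symmetric])
qed

lemma mean_cluster_incr_power:
  assumes "0 < i"
  shows "(\<integral>p. (cluster_incr t s v d p) ^ i \<partial>path_law) = (if 0 \<le> v + d then incr_moment t s i (v + d) else 0)"
  using assms by (simp add: cluster_incr_def incr_moment_eq zero_power)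

lemma cluster_incr_moment_bounded:
  assumes int: "\<And>u. 0 \<le> u \<Longrightarrow> integrable P (\<lambda>\<omega>. \<bar>L u \<omega>\<bar> ^ i)" and i: "0 < i" and ts: "0 \<le> t" "0 \<le> s"
  shows "\<exists>C. \<forall>v d. integrable path_law (\<lambda>p. \<bar>cluster_incr t s v d p\<bar> ^ i) \<and>
    (\<integral>p. \<bar>cluster_incr t s v d p\<bar> ^ i \<partial>path_law) \<le> C"
proof -
  interpret path_law: prob_space path_law by (rule prob_space_path_law)
  have "0 \<le> t + s" using ts by simp
  then obtain C0 where "\<forall>u\<in>{0..t + s}. expectation (\<lambda>\<omega>. \<bar>L u \<omega>\<bar> ^ i) \<le> C0"
    using additive_process_moment_bounded[OF L_additive _ int, of "t + s"] by blast
  then have C0: "expectation (\<lambda>\<omega>. \<bar>L u \<omega>\<bar> ^ i) \<le> C0" if "u \<in> {0..t + s}" for u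
    using that by (rule bspec)
  have C0_0: "0 \<le> C0"
    using C0[of 0] ts order_trans[OF Bochner_Integration.integral_nonneg, of P "\<lambda>\<omega>. \<bar>L 0 \<omega>\<bar> ^ i" C0] by simp
  have L_int: "integrable P (\<lambda>\<omega>. \<bar>L u \<omega>\<bar> ^ i) \<and> expectation (\<lambda>\<omega>. \<bar>L u \<omega>\<bar> ^ i) \<le> C0" if "u \<le> t + s" for u
  proof (cases "0 \<le> u")
    case True then show ?thesis using int C0 that by auto
  next
    case False
    then have ae: "AE \<omega> in P. \<bar>L u \<omega>\<bar> ^ i = 0"
      using L_nonpos[of u] i by (auto elim!: eventually_mono)
    have "integrable P (\<lambda>\<omega>. \<bar>L u \<omega>\<bar> ^ i) \<longleftrightarrow> integrable P (\<lambda>\<omega>. 0 :: real)"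
      by (rule integrable_cong_AE) (use ae in auto)
    moreover have "expectation (\<lambda>\<omega>. \<bar>L u \<omega>\<bar> ^ i) = expectation (\<lambda>\<omega>. 0)"
      by (rule integral_cong_AE) (use ae in auto)
    ultimately show ?thesis using C0_0 by simp
  qed
  show ?thesis
  proof (intro exI allI)
    fix v d
    show "integrable path_law (\<lambda>p. \<bar>cluster_incr t s v d p\<bar> ^ i) \<and>
        (\<integral>p. \<bar>cluster_incr t s v d p\<bar> ^ i \<partial>path_law) \<le> 2 ^ i * (C0 + C0)"
    proof (cases "0 \<le> v + d")
      case False
      then show ?thesis using i C0_0 by (simp add: cluster_incr_def zero_power)
    next
      case True
      define a b where "a = t + s - (v + d)" and "b = t - (v + d)"
      have ab: "a \<le> t + s" "b \<le> t + s" using True ts by (auto simp: a_def b_def)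
      have ym: "cluster_incr t s v d \<in> borel_measurable path_space"
        by (rule mark_measurable_fix[OF cluster_incr_measurable])
      have eq: "cluster_incr t s v d (\<lambda>t. L t \<omega>) = L a \<omega> - L b \<omega>" if "\<omega> \<in> space P" for \<omega>
        using True that by (simp add: cluster_incr_def a_def b_def path_value_L)
      have le: "\<bar>L a \<omega> - L b \<omega>\<bar> ^ i \<le> 2 ^ i * (\<bar>L a \<omega>\<bar> ^ i + \<bar>L b \<omega>\<bar> ^ i)" for \<omega>
      proof -
        have "\<bar>L a \<omega> - L b \<omega>\<bar> ^ i \<le> (\<bar>L a \<omega>\<bar> + \<bar>L b \<omega>\<bar>) ^ i" by (intro power_mono) auto
        also have "\<dots> \<le> 2 ^ i * (\<bar>L a \<omega>\<bar> ^ i + \<bar>L b \<omega>\<bar> ^ i)" by (rule power_add_le) auto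
        finally show ?thesis .
      qed
      have bint: "integrable P (\<lambda>\<omega>. 2 ^ i * (\<bar>L a \<omega>\<bar> ^ i + \<bar>L b \<omega>\<bar> ^ i))"
        using L_int[OF ab(1)] L_int[OF ab(2)] by simp
      have dint: "integrable P (\<lambda>\<omega>. \<bar>L a \<omega> - L b \<omega>\<bar> ^ i)"
        by (rule Bochner_Integration.integrable_bound[OF bint])
          (use le in \<open>auto intro!: AE_I2 intro: order_trans[OF _ abs_ge_self]\<close>)
      have "integrable path_law (\<lambda>p. \<bar>cluster_incr t s v d p\<bar> ^ i)"
        unfolding path_law_def
        by (subst integrable_distr_eq)
          (use ym dint eq in \<open>auto cong: Bochner_Integration.integrable_cong\<close>)
      moreover have "(\<integral>p. \<bar>cluster_incr t s v d p\<bar> ^ i \<partial>path_law) = expectation (\<lambda>\<omega>. \<bar>L a \<omega> - L b \<omega>\<bar> ^ i)"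
        unfolding path_law_def
        by (subst integral_distr)
          (use ym eq in \<open>auto cong: Bochner_Integration.integral_cong\<close>)
      moreover have "expectation (\<lambda>\<omega>. \<bar>L a \<omega> - L b \<omega>\<bar> ^ i) \<le> 2 ^ i * (C0 + C0)"
      proof (rule order_trans)
        show "expectation (\<lambda>\<omega>. \<bar>L a \<omega> - L b \<omega>\<bar> ^ i) \<le> expectation (\<lambda>\<omega>. 2 ^ i * (\<bar>L a \<omega>\<bar> ^ i + \<bar>L b \<omega>\<bar> ^ i))"
          using dint bint le by (rule integral_mono)
        show "expectation (\<lambda>\<omega>. 2 ^ i * (\<bar>L a \<omega>\<bar> ^ i + \<bar>L b \<omega>\<bar> ^ i)) \<le> 2 ^ i * (C0 + C0)"
          using L_int[OF ab(1)] L_int[OF ab(2)] by (simp add: add_mono)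
      qed
      ultimately show ?thesis by simp
    qed
  qed
qed

definition reported :: "real \<Rightarrow> real \<Rightarrow> real \<Rightarrow> bool" where
  "reported t v d \<longleftrightarrow> v + d \<le> t"

lemma reported_count_measurable [measurable]:
  "reported_count T D t \<in> measurable P (count_space UNIV)"
  unfolding reported_count_def[abs_def] by measurable

text \<open>Almost surely the series defining the cluster process is a finite sum over the early points, so its increment,
the reported count and powers of the reported count are sums and products over the marked points.\<close>

lemma AE_point_sums:
  assumes "0 \<le> t"
  shows "AE \<omega> in P. incr (cluster_process T Lc D) t (t + s) \<omega> = mark_sum (cluster_incr t s) \<omega> \<and>
    real (reported_count T D t \<omega>) = mark_sum (\<lambda>v d p. if reported t v d then 1 else 0) \<omega> \<and>
    (\<forall>z. z ^ reported_count T D t \<omega> = mark_prod (\<lambda>v d p. if reported t v d then z else 1) \<omega>)"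
proof -
  have "AE \<omega> in P. \<forall>k. 0 < D k \<omega>" using D_pos by (simp add: AE_all_countable)
  then show ?thesis
    using AE_early_points[OF points] AE_space
  proof eventually_elim
    case (elim \<omega>)
    let ?n = "num_early \<omega>"
    define r where "r k = real_of_ereal (T k \<omega>)" for k
    have early: "T k \<omega> \<le> 1 \<longleftrightarrow> k < ?n" for k using elim by auto
    have T_eq: "T k \<omega> = ereal (r k)" "0 < r k" "r k \<le> 1" if "k < ?n" for k
    proof -
      have "0 < T k \<omega>" "T k \<omega> \<le> 1" using elim that early by auto
      then show "T k \<omega> = ereal (r k)" "0 < r k" "r k \<le> 1"
        by (cases "T k \<omega>"; simp add: r_def one_ereal_def)+
    qed
    have cp: "cluster_process T Lc D u \<omega> = (\<Sum>k<?n. Lc k (u - (r k + D k \<omega>)) \<omega>)" for u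
      unfolding cluster_process_def
      by (subst suminf_finite[of "{..<?n}"]) (auto simp: early r_def)
    have "incr (cluster_process T Lc D) t (t + s) \<omega> = mark_sum (cluster_incr t s) \<omega>"
      unfolding incr_def cp sum_subtractf[symmetric]
    proof (rule sum.cong[OF refl])
      fix k assume "k \<in> {..<?n}"
      then have "0 < r k + D k \<omega>" using T_eq(2)[of k] elim by (auto intro: add_pos_pos)
      then show "Lc k (t + s - (r k + D k \<omega>)) \<omega> - Lc k (t - (r k + D k \<omega>)) \<omega>
          = cluster_incr t s (real_of_ereal (T k \<omega>)) (D k \<omega>) (cluster k \<omega>)"
        using elim by (simp add: cluster_incr_def path_value_Lc r_def)
    qed
    moreover have set: "{k. T k \<omega> + ereal (D k \<omega>) \<le> ereal t \<and> T k \<omega> \<in> {0..1}}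
        = {k\<in>{..<?n}. reported t (r k) (D k \<omega>)}"
    proof (intro set_eqI iffI)
      fix k assume "k \<in> {k. T k \<omega> + ereal (D k \<omega>) \<le> ereal t \<and> T k \<omega> \<in> {0..1}}"
      then have "k < ?n" "T k \<omega> + ereal (D k \<omega>) \<le> ereal t" using early by auto
      then show "k \<in> {k\<in>{..<?n}. reported t (r k) (D k \<omega>)}"
        using T_eq(1)[of k] by (simp add: reported_def)
    next
      fix k assume "k \<in> {k\<in>{..<?n}. reported t (r k) (D k \<omega>)}"
      then show "k \<in> {k. T k \<omega> + ereal (D k \<omega>) \<le> ereal t \<and> T k \<omega> \<in> {0..1}}"
        using T_eq[of k] by (simp add: reported_def one_ereal_def zero_ereal_def)
    qed
    then have rc: "reported_count T D t \<omega> = card {k\<in>{..<?n}. reported t (r k) (D k \<omega>)}"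
      by (simp add: reported_count_def)
    moreover have "real (reported_count T D t \<omega>) = mark_sum (\<lambda>v d p. if reported t v d then 1 else 0) \<omega>"
      unfolding rc by (simp add: r_def[symmetric] sum.inter_filter[symmetric])
    moreover have "z ^ reported_count T D t \<omega> = mark_prod (\<lambda>v d p. if reported t v d then z else 1) \<omega>" for z
      unfolding rc r_def[symmetric] by (subst prod.inter_filter[symmetric]) simp_all
    ultimately show ?case by blast
  qed
qed


lemma AE_increment_eq_mark_sum:
  assumes "0 \<le> t"
  shows "AE \<omega> in P. incr (cluster_process T Lc D) t (t + s) \<omega> = mark_sum (cluster_incr t s) \<omega>"
  using AE_point_sums[OF assms, of s] by (rule eventually_mono) blast

lemma AE_reported_count_eq_mark_sum:
  assumes "0 \<le> t"
  shows "AE \<omega> in P. real (reported_count T D t \<omega>) = mark_sum (\<lambda>v d p. if reported t v d then 1 else 0) \<omega>"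
  using AE_point_sums[OF assms] by (rule eventually_mono) blast

lemma AE_power_reported_count_eq_mark_prod:
  assumes "0 \<le> t"
  shows "AE \<omega> in P. z ^ reported_count T D t \<omega> = mark_prod (\<lambda>v d p. if reported t v d then z else 1) \<omega>"
  using AE_point_sums[OF assms] by (rule eventually_mono) blast

section \<open>Moments given the reported count\<close>

definition reported_mass :: "real \<Rightarrow> real" where
  "reported_mass t = (\<integral>z. (if reported t (fst z) (snd z) then 1 else 0) \<partial>delayed_intensity)"

text \<open>The convolution integral in \<open>J\<close> before its normalisation, and \<open>H\<close>, both in terms of the marked points.\<close>

definition reported_moment :: "real \<Rightarrow> real \<Rightarrow> nat \<Rightarrow> real" where
  "reported_moment t s i = (\<integral>z. (if reported t (fst z) (snd z)
     then \<integral>p. cluster_incr t s (fst z) (snd z) p ^ i \<partial>path_law else 0) \<partial>delayed_intensity)"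

definition unreported_moment :: "real \<Rightarrow> real \<Rightarrow> nat \<Rightarrow> real" where
  "unreported_moment t s i = (\<integral>z. (if reported t (fst z) (snd z)
     then 0 else \<integral>p. cluster_incr t s (fst z) (snd z) p ^ i \<partial>path_law) \<partial>delayed_intensity)"

lemma reported_measurable [measurable]:
  "Measurable.pred (borel \<Otimes>\<^sub>M borel) (\<lambda>z. reported t (fst z) (snd z))"
  unfolding reported_def by measurable

lemma reported_weight_measurable:
  "(\<lambda>z. if reported t (fst z) (snd z) then x else (y :: real)) \<in> borel_measurable (borel \<Otimes>\<^sub>M borel)"
  by measurable

lemma cluster_incr_mean_measurable:
  "(\<lambda>z. \<integral>p. cluster_incr t s (fst z) (snd z) p ^ i \<partial>path_law) \<in> borel_measurable (borel \<Otimes>\<^sub>M borel)"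
proof -
  have "mark_measurable (\<lambda>v d p. cluster_incr t s v d p ^ i)"
    using borel_measurable_power[OF cluster_incr_measurable[of t s, unfolded mark_measurable_iff], of i]
    unfolding mark_measurable_iff .
  from mark_measurable_mean[OF this] show ?thesis by (simp add: split_beta')
qed

lemma integral_reported_weight:
  fixes f :: "real \<times> real \<Rightarrow> real"
  assumes f: "f \<in> borel_measurable (borel \<Otimes>\<^sub>M borel)" and c: "\<And>z. \<bar>f z\<bar> \<le> c"
  shows "(\<integral>z. (if reported t (fst z) (snd z) then x else 1) * f z \<partial>delayed_intensity)
    = x * (\<integral>z. (if reported t (fst z) (snd z) then f z else 0) \<partial>delayed_intensity)
      + (\<integral>z. (if reported t (fst z) (snd z) then 0 else f z) \<partial>delayed_intensity)"
proof -
  note [measurable] = f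
  have c0: "0 \<le> c" using c[of undefined] by linarith
  have i1: "integrable delayed_intensity (\<lambda>z. if reported t (fst z) (snd z) then f z else 0)"
    by (rule integrable_delayed_intensity_bounded[where c = c]) (use c c0 in \<open>auto intro!: measurable_If f\<close>)
  have i2: "integrable delayed_intensity (\<lambda>z. if reported t (fst z) (snd z) then 0 else f z)"
    by (rule integrable_delayed_intensity_bounded[where c = c]) (use c c0 in \<open>auto intro!: measurable_If f\<close>)
  have "(\<integral>z. (if reported t (fst z) (snd z) then x else 1) * f z \<partial>delayed_intensity)
      = (\<integral>z. x * (if reported t (fst z) (snd z) then f z else 0)
          + (if reported t (fst z) (snd z) then 0 else f z) \<partial>delayed_intensity)"
    by (intro Bochner_Integration.integral_cong) auto
  then show ?thesis using i1 i2 by simp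
qed

lemma integral_reported_weight_minus_one:
  "(\<integral>z. (if reported t (fst z) (snd z) then x else 1) - 1 \<partial>delayed_intensity) = (x - 1) * reported_mass t"
proof -
  have "(\<integral>z. (if reported t (fst z) (snd z) then x else 1) - 1 \<partial>delayed_intensity)
      = (\<integral>z. (x - 1) * (if reported t (fst z) (snd z) then 1 else 0) \<partial>delayed_intensity)"
    by (intro Bochner_Integration.integral_cong) auto
  then show ?thesis by (simp add: reported_mass_def)
qed

lemma expectation_reported_count:
  assumes "0 \<le> t"
  shows "expectation (\<lambda>\<omega>. real (reported_count T D t \<omega>)) = reported_mass t"
proof -
  interpret path_law: prob_space path_law by (rule prob_space_path_law)
  let ?y = "\<lambda>v d p :: real \<Rightarrow> real. if reported t v d then 1 else 0 :: real"
  have ym: "mark_measurable ?y"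
    unfolding mark_measurable_iff reported_def by measurable
  have "expectation (\<lambda>\<omega>. mark_prod (\<lambda>v d p. 1) \<omega> * mark_sum ?y \<omega>)
      = (\<integral>z. 1 * (\<integral>p. ?y (fst z) (snd z) p \<partial>path_law) \<partial>delayed_intensity) * exp (\<integral>z. 1 - 1 \<partial>delayed_intensity)"
    by (rule first_moment_marks(3)[OF ym, where C = 1]) auto
  then have "expectation (mark_sum ?y) = reported_mass t"
    by (simp add: reported_mass_def path_law.prob_space)
  moreover have "expectation (\<lambda>\<omega>. real (reported_count T D t \<omega>)) = expectation (mark_sum ?y)"
    by (rule integral_cong_AE[OF _ mark_sum_measurable[OF ym] AE_reported_count_eq_mark_sum[OF assms]])
      measurable
  ultimately show ?thesis by simp
qed

lemma prob_reported_count: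
  assumes "0 \<le> t" and m: "0 < reported_mass t"
  shows "prob {\<omega>\<in>space P. reported_count T D t \<omega> = l}
    = reported_mass t ^ l / fact l * exp (- reported_mass t)"
proof -
  have "expectation (\<lambda>\<omega>. x ^ reported_count T D t \<omega> * 1) = (1 + 0 * x + 0 * x\<^sup>2) * exp ((x - 1) * reported_mass t)"
    if x: "\<bar>x\<bar> < 1" for x
  proof -
    let ?a = "\<lambda>v d. if reported t v d then x else 1"
    have "expectation (mark_prod (\<lambda>v d p. ?a v d)) = exp (\<integral>z. ?a (fst z) (snd z) - 1 \<partial>delayed_intensity)"
      by (rule first_moment_marks(2)[where y = "\<lambda>v d p. 0" and C = 0])
        (use x in \<open>auto simp: split_beta' reported_weight_measurable\<close>)
    moreover have "expectation (\<lambda>\<omega>. x ^ reported_count T D t \<omega>) = expectation (mark_prod (\<lambda>v d p. ?a v d))"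
    proof (rule integral_cong_AE)
      show "mark_prod (\<lambda>v d p. ?a v d) \<in> borel_measurable P"
        by (rule mark_prod_measurable) (unfold mark_measurable_iff reported_def, measurable)
      show "AE \<omega> in P. x ^ reported_count T D t \<omega> = mark_prod (\<lambda>v d p. ?a v d) \<omega>"
        by (rule AE_power_reported_count_eq_mark_prod[OF assms(1)])
    qed measurable
    ultimately show ?thesis by (simp add: integral_reported_weight_minus_one)
  qed
  from expectation_on_level_from_genfun[OF reported_count_measurable _ m this, of l]
  have "expectation (\<lambda>\<omega>. indicator {\<omega>\<in>space P. reported_count T D t \<omega> = l} \<omega> * 1)
      = reported_mass t ^ l / fact l * exp (- reported_mass t)"
    by simp
  then show ?thesis by (simp add: Int_absorb2 subset_eq)
qed

text \<open>The first moment with weight \<open>z\<close> for reported points is the generating function of the contributions of the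
events that the reported count equals \<open>l\<close>.\<close>

lemma first_moment_given_count:
  assumes ts: "0 \<le> t" "0 \<le> s" and m: "0 < reported_mass t"
    and int: "\<And>u. 0 \<le> u \<Longrightarrow> integrable P (L u)"
  defines "X \<equiv> mark_sum (cluster_incr t s)"
  shows "integrable P X"
    and "expectation (\<lambda>\<omega>. indicator {\<omega>\<in>space P. reported_count T D t \<omega> = l} \<omega> * X \<omega>)
      = reported_mass t ^ l / fact l * exp (- reported_mass t)
        * (unreported_moment t s 1 + reported_moment t s 1 * (real l / reported_mass t))"
proof -
  note ym = cluster_incr_measurable[of t s]
  obtain C where C: "\<And>v d. integrable path_law (\<lambda>p. \<bar>cluster_incr t s v d p\<bar>)"
    "\<And>v d. (\<integral>p. \<bar>cluster_incr t s v d p\<bar> \<partial>path_law) \<le> C"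
    using cluster_incr_moment_bounded[of 1 t s] int ts by (auto simp: integrable_abs_iff)
  have y_int: "integrable path_law (cluster_incr t s v d)" for v d
    using C(1)[of v d] mark_measurable_fix[OF ym, of v d]
    by (subst (asm) integrable_abs_iff) (simp_all cong: measurable_cong_sets)
  have mean_bound: "\<bar>\<integral>p. cluster_incr t s v d p \<partial>path_law\<bar> \<le> C" for v d
    using integral_abs_bound[of path_law "cluster_incr t s v d"] C(2)[of v d] by linarith
  have a0: "(\<lambda>z. 1 :: real) \<in> borel_measurable (borel \<Otimes>\<^sub>M borel)" by simp
  show X_int: "integrable P X"
    unfolding X_def by (rule first_moment_marks(1)[OF ym y_int C(2) a0]) simp
  have gf: "expectation (\<lambda>\<omega>. x ^ reported_count T D t \<omega> * X \<omega>)
      = (unreported_moment t s 1 + reported_moment t s 1 * x + 0 * x\<^sup>2) * exp ((x - 1) * reported_mass t)"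
    if x: "\<bar>x\<bar> < 1" for x
  proof -
    let ?a = "\<lambda>v d. if reported t v d then x else 1"
    have "expectation (\<lambda>\<omega>. x ^ reported_count T D t \<omega> * X \<omega>)
        = expectation (\<lambda>\<omega>. mark_prod (\<lambda>v d p. ?a v d) \<omega> * mark_sum (cluster_incr t s) \<omega>)"
    proof (rule integral_cong_AE)
      show "(\<lambda>\<omega>. mark_prod (\<lambda>v d p. ?a v d) \<omega> * mark_sum (cluster_incr t s) \<omega>) \<in> borel_measurable P"
        by (intro borel_measurable_times mark_prod_measurable mark_sum_measurable ym)
          (unfold mark_measurable_iff reported_def, measurable)
      show "(\<lambda>\<omega>. x ^ reported_count T D t \<omega> * X \<omega>) \<in> borel_measurable P"
        by (intro borel_measurable_times borel_measurable_integrable[OF X_int]) measurable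
      show "AE \<omega> in P. x ^ reported_count T D t \<omega> * X \<omega> = mark_prod (\<lambda>v d p. ?a v d) \<omega> * mark_sum (cluster_incr t s) \<omega>"
        using AE_power_reported_count_eq_mark_prod[OF ts(1), of x] by eventually_elim (simp add: X_def)
    qed
    also have "\<dots> = (\<integral>z. ?a (fst z) (snd z) * (\<integral>p. cluster_incr t s (fst z) (snd z) p \<partial>path_law) \<partial>delayed_intensity)
        * exp (\<integral>z. ?a (fst z) (snd z) - 1 \<partial>delayed_intensity)"
      by (rule first_moment_marks(3)[OF ym y_int C(2) reported_weight_measurable]) (use x in auto)
    also have "(\<integral>z. ?a (fst z) (snd z) * (\<integral>p. cluster_incr t s (fst z) (snd z) p \<partial>path_law) \<partial>delayed_intensity)
        = x * reported_moment t s 1 + unreported_moment t s 1"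
      using integral_reported_weight[OF cluster_incr_mean_measurable[of t s 1, unfolded power_one_right], of C t x]
        mean_bound
      by (simp add: reported_moment_def unreported_moment_def power_one_right del: One_nat_def cong: if_cong)
    finally show ?thesis
      by (simp add: integral_reported_weight_minus_one algebra_simps)
  qed
  show "expectation (\<lambda>\<omega>. indicator {\<omega>\<in>space P. reported_count T D t \<omega> = l} \<omega> * X \<omega>)
      = reported_mass t ^ l / fact l * exp (- reported_mass t)
        * (unreported_moment t s 1 + reported_moment t s 1 * (real l / reported_mass t))"
    using expectation_on_level_from_genfun[OF reported_count_measurable X_int m gf, of l] by simp
qed

text \<open>The coefficients of \<open>z\<close> come from \<open>z J\<^sub>2 + H\<^sub>2 + (z J\<^sub>1 + H\<^sub>1)\<^sup>2\<close>.\<close>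

lemma second_moment_given_count:
  assumes ts: "0 \<le> t" "0 \<le> s" and m: "0 < reported_mass t"
    and int: "\<And>u. 0 \<le> u \<Longrightarrow> integrable P (\<lambda>\<omega>. (L u \<omega>)\<^sup>2)"
  defines "X \<equiv> mark_sum (cluster_incr t s)"
    and "J \<equiv> reported_moment t s" and "H \<equiv> unreported_moment t s"
  shows "integrable P (\<lambda>\<omega>. (X \<omega>)\<^sup>2)"
    and "expectation (\<lambda>\<omega>. indicator {\<omega>\<in>space P. reported_count T D t \<omega> = l} \<omega> * (X \<omega>)\<^sup>2)
      = reported_mass t ^ l / fact l * exp (- reported_mass t)
        * (H 2 + (H 1)\<^sup>2 + (J 2 + 2 * J 1 * H 1) * (real l / reported_mass t)
           + (J 1)\<^sup>2 * (real l * (real l - 1) / (reported_mass t)\<^sup>2))"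
proof -
  note ym = cluster_incr_measurable[of t s]
  have int1: "integrable P (L u)" if "0 \<le> u" for u
    by (rule square_integrable_imp_integrable[OF _ int[OF that]]) measurable
  obtain C where C: "\<And>v d. integrable path_law (\<lambda>p. \<bar>cluster_incr t s v d p\<bar>)"
    "\<And>v d. (\<integral>p. \<bar>cluster_incr t s v d p\<bar> \<partial>path_law) \<le> C"
    using cluster_incr_moment_bounded[of 1 t s] int1 ts by (auto simp: integrable_abs_iff)
  have y_int: "integrable path_law (cluster_incr t s v d)" for v d
    using C(1)[of v d] mark_measurable_fix[OF ym, of v d]
    by (subst (asm) integrable_abs_iff) (simp_all cong: measurable_cong_sets)
  obtain C2 where C2: "\<And>v d. integrable path_law (\<lambda>p. (cluster_incr t s v d p)\<^sup>2)"
    "\<And>v d. (\<integral>p. (cluster_incr t s v d p)\<^sup>2 \<partial>path_law) \<le> C2"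
    using cluster_incr_moment_bounded[of 2 t s] int ts by auto
  have mean_bound: "\<bar>\<integral>p. cluster_incr t s v d p \<partial>path_law\<bar> \<le> C" for v d
    using integral_abs_bound[of path_law "cluster_incr t s v d"] C(2)[of v d] by linarith
  have mean2_bound: "\<bar>\<integral>p. (cluster_incr t s v d p)\<^sup>2 \<partial>path_law\<bar> \<le> C2" for v d
    using C2(2)[of v d] by simp
  have a0: "(\<lambda>z. 1 :: real) \<in> borel_measurable (borel \<Otimes>\<^sub>M borel)" by simp
  show X2_int: "integrable P (\<lambda>\<omega>. (X \<omega>)\<^sup>2)"
    unfolding X_def by (rule second_moment_marks(1)[OF ym y_int C(2) C2 a0]) simp
  have Xm: "X \<in> borel_measurable P"
    unfolding X_def by (rule mark_sum_measurable[OF ym])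
  have gf: "expectation (\<lambda>\<omega>. x ^ reported_count T D t \<omega> * (X \<omega>)\<^sup>2)
      = (H 2 + (H 1)\<^sup>2 + (J 2 + 2 * J 1 * H 1) * x + (J 1)\<^sup>2 * x\<^sup>2) * exp ((x - 1) * reported_mass t)"
    if x: "\<bar>x\<bar> < 1" for x
  proof -
    let ?a = "\<lambda>v d. if reported t v d then x else 1"
    have "expectation (\<lambda>\<omega>. x ^ reported_count T D t \<omega> * (X \<omega>)\<^sup>2)
        = expectation (\<lambda>\<omega>. mark_prod (\<lambda>v d p. ?a v d) \<omega> * (mark_sum (cluster_incr t s) \<omega>)\<^sup>2)"
    proof (rule integral_cong_AE)
      show "(\<lambda>\<omega>. mark_prod (\<lambda>v d p. ?a v d) \<omega> * (mark_sum (cluster_incr t s) \<omega>)\<^sup>2) \<in> borel_measurable P"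
        by (intro borel_measurable_times borel_measurable_power mark_prod_measurable mark_sum_measurable ym)
          (unfold mark_measurable_iff reported_def, measurable)
      show "(\<lambda>\<omega>. x ^ reported_count T D t \<omega> * (X \<omega>)\<^sup>2) \<in> borel_measurable P"
        by (intro borel_measurable_times borel_measurable_power[OF Xm]) measurable
      show "AE \<omega> in P. x ^ reported_count T D t \<omega> * (X \<omega>)\<^sup>2
          = mark_prod (\<lambda>v d p. ?a v d) \<omega> * (mark_sum (cluster_incr t s) \<omega>)\<^sup>2"
        using AE_power_reported_count_eq_mark_prod[OF ts(1), of x] by eventually_elim (simp add: X_def)
    qed
    also have "\<dots> = ((\<integral>z. ?a (fst z) (snd z) * (\<integral>p. (cluster_incr t s (fst z) (snd z) p)\<^sup>2 \<partial>path_law) \<partial>delayed_intensity)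
          + (\<integral>z. ?a (fst z) (snd z) * (\<integral>p. cluster_incr t s (fst z) (snd z) p \<partial>path_law) \<partial>delayed_intensity)\<^sup>2)
        * exp (\<integral>z. ?a (fst z) (snd z) - 1 \<partial>delayed_intensity)"
      by (rule second_moment_marks(2)[OF ym y_int C(2) C2 reported_weight_measurable]) (use x in auto)
    also have "(\<integral>z. ?a (fst z) (snd z) * (\<integral>p. cluster_incr t s (fst z) (snd z) p \<partial>path_law) \<partial>delayed_intensity)
        = x * J 1 + H 1"
      using integral_reported_weight[OF cluster_incr_mean_measurable[of t s 1, unfolded power_one_right], of C t x]
        mean_bound
      by (simp add: reported_moment_def unreported_moment_def J_def H_def power_one_right del: One_nat_def cong: if_cong)
    also have "(\<integral>z. ?a (fst z) (snd z) * (\<integral>p. (cluster_incr t s (fst z) (snd z) p)\<^sup>2 \<partial>path_law) \<partial>delayed_intensity)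
        = x * J 2 + H 2"
      using integral_reported_weight[OF cluster_incr_mean_measurable[of t s 2], of C2 t x] mean2_bound
      by (simp add: reported_moment_def unreported_moment_def J_def H_def power_one_right del: One_nat_def cong: if_cong)
    finally show ?thesis
      by (simp add: integral_reported_weight_minus_one algebra_simps power2_eq_square)
  qed
  show "expectation (\<lambda>\<omega>. indicator {\<omega>\<in>space P. reported_count T D t \<omega> = l} \<omega> * (X \<omega>)\<^sup>2)
      = reported_mass t ^ l / fact l * exp (- reported_mass t)
        * (H 2 + (H 1)\<^sup>2 + (J 2 + 2 * J 1 * H 1) * (real l / reported_mass t)
           + (J 1)\<^sup>2 * (real l * (real l - 1) / (reported_mass t)\<^sup>2))"
    by (rule expectation_on_level_from_genfun[OF reported_count_measurable X2_int m gf])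
qed

section \<open>The integrals over reported and unreported points\<close>

text \<open>A line \<open>v + d = t\<close> is a null set: \<open>\<Lambda>\<close> has no atoms, and for each \<open>d\<close> the line contains a single \<open>v\<close>.\<close>

lemma AE_delayed_intensity:
  "AE z in delayed_intensity. 0 \<le> fst z \<and> 0 < snd z \<and> fst z + snd z \<noteq> t"
proof -
  interpret FD: prob_space F\<^sub>D by (rule prob_space_F\<^sub>D)
  interpret EI: finite_measure early_intensity by (rule finite_early_intensity)
  interpret EF: pair_sigma_finite early_intensity F\<^sub>D ..
  have sp: "space early_intensity = UNIV" "space F\<^sub>D = UNIV"
    using sets_early_intensity[THEN sets_eq_imp_space_eq] sets_F\<^sub>D[THEN sets_eq_imp_space_eq] by auto
  have v: "AE v in early_intensity. 0 \<le> v"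
    unfolding early_intensity_def
    by (subst AE_density) (auto simp: sets_\<Lambda> indicator_def intro!: AE_I2 measurable_If split: if_splits cong: measurable_cong_sets)
  have d: "AE d in F\<^sub>D. 0 < d"
    unfolding D_law[of 0, symmetric] by (subst AE_distr_iff) (use D_pos in auto)
  have 1: "AE z in early_intensity \<Otimes>\<^sub>M F\<^sub>D. 0 \<le> fst z \<and> 0 < snd z"
  proof (rule EF.AE_pair_measure)
    show "{z \<in> space (early_intensity \<Otimes>\<^sub>M F\<^sub>D). 0 \<le> fst z \<and> 0 < snd z} \<in> sets (early_intensity \<Otimes>\<^sub>M F\<^sub>D)"
      by measurable
    show "AE v in early_intensity. AE d in F\<^sub>D. 0 \<le> fst (v, d) \<and> 0 < snd (v, d)"
      using v by eventually_elim (use d in auto)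
  qed
  have atom: "emeasure early_intensity {x} = 0" for x
  proof -
    note [measurable_cong] = sets_\<Lambda>
    have "emeasure early_intensity {x} = (\<integral>\<^sup>+y. indicator {0..1} y * indicator {x} y \<partial>\<Lambda>)"
      unfolding early_intensity_def by (rule emeasure_density) (simp_all add: sets_\<Lambda>)
    also have "\<dots> \<le> (\<integral>\<^sup>+y. indicator {x} y \<partial>\<Lambda>)"
      by (intro nn_integral_mono) (simp add: indicator_def)
    also have "\<dots> = emeasure \<Lambda> {x}" by (simp add: sets_\<Lambda>)
    finally have "emeasure early_intensity {x} \<le> emeasure \<Lambda> {x}" .
    then show ?thesis using \<Lambda>_no_atoms[of x] by simp
  qed
  have meas: "{z. fst z + snd z = t} \<in> sets (early_intensity \<Otimes>\<^sub>M F\<^sub>D)"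
  proof -
    have "{z \<in> space (early_intensity \<Otimes>\<^sub>M F\<^sub>D). fst z + snd z = t} \<in> sets (early_intensity \<Otimes>\<^sub>M F\<^sub>D)" by measurable
    then show ?thesis by (simp add: space_pair_measure sp)
  qed
  have "emeasure (early_intensity \<Otimes>\<^sub>M F\<^sub>D) {z. fst z + snd z = t}
      = (\<integral>\<^sup>+d. emeasure early_intensity ((\<lambda>v. (v, d)) -` {z. fst z + snd z = t}) \<partial>F\<^sub>D)"
    by (rule EF.emeasure_pair_measure_alt2[OF meas])
  also have "\<dots> = (\<integral>\<^sup>+d. emeasure early_intensity {t - d} \<partial>F\<^sub>D)"
    by (intro nn_integral_cong arg_cong[where f = "emeasure early_intensity"]) auto
  finally have "emeasure (early_intensity \<Otimes>\<^sub>M F\<^sub>D) {z. fst z + snd z = t} = 0"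
    by (simp add: atom)
  then have "AE z in early_intensity \<Otimes>\<^sub>M F\<^sub>D. z \<notin> {z. fst z + snd z = t}"
    using meas by (intro AE_not_in null_setsI)
  with 1 show ?thesis unfolding delayed_intensity_def by eventually_elim auto
qed

text \<open>Integration against the convolution is integration of a function of \<open>v + d\<close> against the product measure.\<close>

lemma J_int_eq:
  assumes "0 < i"
  shows "J_int P \<Lambda> L F\<^sub>D e i t s = reported_moment t s i / e"
proof -
  have "(LINT u:{0..t}|(density \<Lambda> (indicator {0..1}) \<star> F\<^sub>D). incr_moment t s i u)
      = (\<integral>u. indicator {0..t} u * incr_moment t s i u \<partial>distr delayed_intensity borel (\<lambda>(x, y). x + y))"
    by (simp add: set_lebesgue_integral_def convolution_def delayed_intensity_def early_intensity_def)
  also have "\<dots> = (\<integral>z. indicator {0..t} (fst z + snd z) * incr_moment t s i (fst z + snd z) \<partial>delayed_intensity)"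
    by (subst integral_distr) (auto simp: split_beta')
  also have "\<dots> = reported_moment t s i"
    unfolding reported_moment_def mean_cluster_incr_power[OF assms]
  proof (rule integral_cong_AE)
    show "AE z in delayed_intensity. indicator {0..t} (fst z + snd z) * incr_moment t s i (fst z + snd z)
        = (if reported t (fst z) (snd z) then if 0 \<le> fst z + snd z then incr_moment t s i (fst z + snd z) else 0 else 0)"
      using AE_delayed_intensity[of t] by eventually_elim (auto simp: reported_def indicator_def)
  qed measurable
  finally show ?thesis
    unfolding J_int_def incr_moment_def by simp
qed

text \<open>An unreported cluster starts after time \<open>t\<close>, so its value at \<open>t\<close> vanishes and its increment is its value
at \<open>t + s\<close>, which vanishes in turn if the cluster starts after \<open>t + s\<close>. The integrals in \<open>H\<close> include
the points with \<open>v + d = t\<close>, which form a null set.\<close>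

lemma H_int_eq:
  assumes i: "0 < i" and ts: "0 \<le> t" "0 \<le> s"
    and C: "\<And>v d. \<bar>\<integral>p. cluster_incr t s v d p ^ i \<partial>path_law\<bar> \<le> C"
  shows "H_int P \<Lambda> L F\<^sub>D i t s = unreported_moment t s i"
proof -
  interpret FD: prob_space F\<^sub>D by (rule prob_space_F\<^sub>D)
  interpret EI: finite_measure early_intensity by (rule finite_early_intensity)
  interpret EF: pair_sigma_finite early_intensity F\<^sub>D ..
  define f where "f w = indicator {t..t + s} w * incr_moment t s i w" for w
  have [measurable]: "f \<in> borel_measurable borel" unfolding f_def by measurable
  have after: "incr_moment t s i w = expectation (\<lambda>\<omega>. L (t + s - w) \<omega> ^ i)" if "t \<le> w" for w
    unfolding incr_moment_def
  proof (rule integral_cong_AE)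
    show "AE \<omega> in P. incr L (t - w) (t + s - w) \<omega> ^ i = L (t + s - w) \<omega> ^ i"
      using L_nonpos[of "t - w"] that by (auto simp: incr_def elim!: eventually_mono)
  qed (auto simp: incr_def[abs_def])
  have late: "incr_moment t s i w = 0" if "t + s < w" for w
  proof -
    have "incr_moment t s i w = expectation (\<lambda>\<omega>. L (t + s - w) \<omega> ^ i)"
      using that ts by (intro after) auto
    also have "\<dots> = expectation (\<lambda>\<omega>. 0)"
      by (rule integral_cong_AE)
        (use L_nonpos[of "t + s - w"] that i in \<open>auto simp: zero_power elim!: eventually_mono\<close>)
    finally show ?thesis by simp
  qed
  have f_bound: "\<bar>f w\<bar> \<le> C" for w
  proof (cases "w \<in> {t..t + s}")
    case True
    then show ?thesis
      using C[of 0 w] ts unfolding mean_cluster_incr_power[OF i] by (simp add: f_def)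
  next
    case False
    then show ?thesis using order_trans[OF abs_ge_zero C[of 0 0]] by (simp add: f_def)
  qed
  have f_int: "integrable (early_intensity \<Otimes>\<^sub>M F\<^sub>D) (\<lambda>z. f (fst z + snd z))"
    using integrable_delayed_intensity_bounded[of "\<lambda>z. f (fst z + snd z)" C] f_bound
    by (simp add: delayed_intensity_def)
  have inner: "indicator {t - v..t + s - v} r * expectation (\<lambda>\<omega>. L (t + s - v - r) \<omega> ^ i) = f (v + r)" for v r
    using after[of "v + r"] by (auto simp: f_def indicator_def algebra_simps)
  have "H_int P \<Lambda> L F\<^sub>D i t s = (\<integral>v. indicator {0..1} v * (\<integral>r. f (v + r) \<partial>F\<^sub>D) \<partial>\<Lambda>)"
    unfolding H_int_def set_lebesgue_integral_def real_scaleR_def inner ..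
  also have "\<dots> = (\<integral>v. \<integral>r. f (v + r) \<partial>F\<^sub>D \<partial>early_intensity)"
  proof -
    note [measurable_cong] = sets_\<Lambda>
    have "(\<integral>v. (\<integral>r. f (v + r) \<partial>F\<^sub>D) \<partial>density \<Lambda> (\<lambda>v. ennreal (indicator {0..1} v)))
        = (\<integral>v. indicator {0..1} v * (\<integral>r. f (v + r) \<partial>F\<^sub>D) \<partial>\<Lambda>)"
      by (rule integral_real_density) auto
    then show ?thesis by (simp only: early_intensity_def ennreal_indicator)
  qed
  also have "\<dots> = (\<integral>z. f (fst z + snd z) \<partial>delayed_intensity)"
    using EF.integral_fst'[OF f_int] by (simp add: delayed_intensity_def)
  also have "\<dots> = unreported_moment t s i"
    unfolding unreported_moment_def mean_cluster_incr_power[OF i]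
  proof (rule integral_cong_AE)
    show "AE z in delayed_intensity. f (fst z + snd z)
        = (if reported t (fst z) (snd z) then 0 else if 0 \<le> fst z + snd z then incr_moment t s i (fst z + snd z) else 0)"
      using AE_delayed_intensity[of t]
    proof eventually_elim
      case (elim z)
      then show ?case using late[of "fst z + snd z"] by (auto simp: f_def reported_def indicator_def)
    qed
  qed measurable
  finally show ?thesis .
qed

lemma increment_measurable: "incr (cluster_process T Lc D) t u \<in> borel_measurable P"
proof -
  have "cluster_process T Lc D u \<in> borel_measurable P" for u
  proof -
    have Lc_at: "(\<lambda>\<omega>. Lc k (u - (real_of_ereal (T k \<omega>) + D k \<omega>)) \<omega>) \<in> borel_measurable P" for k
    proof -
      have "(\<lambda>\<omega>. (u - (real_of_ereal (T k \<omega>) + D k \<omega>), cluster k \<omega>)) \<in> measurable P (borel \<Otimes>\<^sub>M path_space)"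
        by measurable
      from measurable_compose[OF this path_value_measurable]
      have "(\<lambda>\<omega>. path_value (u - (real_of_ereal (T k \<omega>) + D k \<omega>)) (cluster k \<omega>)) \<in> borel_measurable P"
        by simp
      then show ?thesis
        by (rule measurable_cong[THEN iffD1, rotated]) (simp add: path_value_Lc)
    qed
    show ?thesis
      unfolding cluster_process_def[abs_def]
      by (intro borel_measurable_suminf measurable_If Lc_at borel_measurable_const) measurable
  qed
  then show ?thesis unfolding incr_def[abs_def] by (intro borel_measurable_diff)
qed

end

section \<open>The conditional mean and variance of the increment\<close>

theorem theorem3p2:
  fixes P :: "'a measure"
    and T :: "nat \<Rightarrow> 'a \<Rightarrow> ereal"
    and \<Lambda> :: "real measure"
    and L :: "real \<Rightarrow> 'a \<Rightarrow> real"
    and \<nu> :: "(real \<times> real) measure"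
    and Lc :: "nat \<Rightarrow> real \<Rightarrow> 'a \<Rightarrow> real"
    and D :: "nat \<Rightarrow> 'a \<Rightarrow> real"
    and F\<^sub>D :: "real measure"
    and t s :: real and l :: nat
  defines "EN \<equiv> (LINT \<omega>|P. real (reported_count T D t \<omega>))"
  defines "J \<equiv> (\<lambda>i. J_int P \<Lambda> L F\<^sub>D EN i t s)"
    and "H \<equiv> (\<lambda>i. H_int P \<Lambda> L F\<^sub>D i t s)"
    and "X \<equiv> incr (cluster_process T Lc D) t (t + s)"
    and "A \<equiv> {\<omega> \<in> space P. reported_count T D t \<omega> = l}"
  assumes "delayed_poisson_cluster P T \<Lambda> L \<nu> Lc D F\<^sub>D"
    and "1 \<le> t" and "0 < s"
    and "0 < EN"
  shows "((\<forall>u\<ge>0. integrable P (L u)) \<longrightarrow>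
            integrable (uniform_measure P A) X \<and>
            cond_expectation P A X = real l * J 1 + H 1)
       \<and> ((\<forall>u\<ge>0. integrable P (\<lambda>\<omega>. (L u \<omega>)\<^sup>2)) \<longrightarrow>
            integrable (uniform_measure P A) X \<and>
            integrable (uniform_measure P A) (\<lambda>\<omega>. (X \<omega>)\<^sup>2) \<and>
            cond_variance P A X = real l * J 2 - real l * (J 1)\<^sup>2 + H 2)"
proof -
  interpret delayed_poisson_cluster P T \<Lambda> L \<nu> Lc D F\<^sub>D by fact
  have ts: "0 \<le> t" "0 \<le> s" using \<open>1 \<le> t\<close> \<open>0 < s\<close> by auto
  have EN: "EN = reported_mass t"
    unfolding EN_def by (rule expectation_reported_count[OF ts(1)])
  have m: "0 < reported_mass t" using \<open>0 < EN\<close> by (simp add: EN)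
  define S where "S = mark_sum (cluster_incr t s)"
  define p where "p = reported_mass t ^ l / fact l * exp (- reported_mass t)"
  have p: "0 < p" using m by (simp add: p_def)
  have A: "A \<in> events" unfolding A_def by measurable
  have pA: "prob A = p"
    unfolding A_def p_def by (rule prob_reported_count[OF ts(1) m])
  then have pA0: "0 < prob A" using p by simp
  have X_meas: "X \<in> borel_measurable P" unfolding X_def by (rule increment_measurable)
  have S_meas: "S \<in> borel_measurable P"
    unfolding S_def by (rule mark_sum_measurable[OF cluster_incr_measurable])
  have XS: "AE \<omega> in P. X \<omega> = S \<omega>"
    unfolding X_def S_def by (rule AE_increment_eq_mark_sum[OF ts(1)])
  have ind_meas: "(\<lambda>\<omega>. indicator A \<omega> :: real) \<in> borel_measurable P" using A by simp
  have J: "J i = reported_moment t s i / reported_mass t" if "0 < i" for i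
    unfolding J_def EN by (rule J_int_eq[OF that])
  have first: "integrable P X \<and> integrable (uniform_measure P A) X \<and> H 1 = unreported_moment t s 1 \<and>
      cond_expectation P A X = real l * J 1 + H 1"
    if int: "\<And>u. 0 \<le> u \<Longrightarrow> integrable P (L u)"
  proof -
    have "integrable P S" unfolding S_def by (rule first_moment_given_count(1)[OF ts m int])
    then have X: "integrable P X"
      by (rule integrable_cong_AE_imp[OF _ X_meas]) (use XS in \<open>auto elim!: eventually_mono\<close>)
    have "expectation (\<lambda>\<omega>. indicator A \<omega> * X \<omega>) = expectation (\<lambda>\<omega>. indicator A \<omega> * S \<omega>)"
      by (rule integral_cong_AE)
        (use XS in \<open>auto elim!: eventually_mono intro: borel_measurable_times ind_meas X_meas S_meas\<close>)
    also have "\<dots> = p * (unreported_moment t s 1 + reported_moment t s 1 * (real l / reported_mass t))"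
      unfolding A_def S_def p_def by (rule first_moment_given_count(2)[OF ts m int])
    finally have e: "expectation (\<lambda>\<omega>. indicator A \<omega> * X \<omega>)
        = p * (unreported_moment t s 1 + reported_moment t s 1 * (real l / reported_mass t))" .
    have H: "H 1 = unreported_moment t s 1"
    proof -
      obtain C where C: "\<And>v d. integrable path_law (\<lambda>p. \<bar>cluster_incr t s v d p\<bar>)"
        "\<And>v d. (\<integral>p. \<bar>cluster_incr t s v d p\<bar> \<partial>path_law) \<le> C"
        using cluster_incr_moment_bounded[of 1 t s] int ts by (auto simp: integrable_abs_iff)
      have "\<bar>\<integral>p. cluster_incr t s v d p ^ 1 \<partial>path_law\<bar> \<le> C" for v d
        using integral_abs_bound[of path_law "cluster_incr t s v d"] C(2)[of v d]
        unfolding power_one_right by linarith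
      then show ?thesis unfolding H_def by (intro H_int_eq[OF _ ts]) auto
    qed
    have "cond_expectation P A X = real l * J 1 + H 1"
      unfolding cond_expectation_def uniform_measure_expectation(2)[OF A pA0 X] e pA H
      using p by (simp add: J)
    then show ?thesis
      using X H uniform_measure_expectation(1)[OF A pA0 X] by blast
  qed
  have second: "integrable (uniform_measure P A) (\<lambda>\<omega>. (X \<omega>)\<^sup>2) \<and>
      cond_variance P A X = real l * J 2 - real l * (J 1)\<^sup>2 + H 2"
    if int: "\<And>u. 0 \<le> u \<Longrightarrow> integrable P (\<lambda>\<omega>. (L u \<omega>)\<^sup>2)"
  proof -
    have int1: "integrable P (L u)" if "0 \<le> u" for u
      by (rule square_integrable_imp_integrable[OF L_measurable int[OF that]])
    note X = first[OF int1]
    have "integrable P (\<lambda>\<omega>. (S \<omega>)\<^sup>2)"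
      unfolding S_def by (rule second_moment_given_count(1)[OF ts m int])
    then have X2: "integrable P (\<lambda>\<omega>. (X \<omega>)\<^sup>2)"
      by (rule integrable_cong_AE_imp[OF _ borel_measurable_power[OF X_meas]])
        (use XS in \<open>auto elim!: eventually_mono\<close>)
    have "expectation (\<lambda>\<omega>. indicator A \<omega> * (X \<omega>)\<^sup>2) = expectation (\<lambda>\<omega>. indicator A \<omega> * (S \<omega>)\<^sup>2)"
    proof (rule integral_cong_AE)
      show "AE \<omega> in P. indicator A \<omega> * (X \<omega>)\<^sup>2 = indicator A \<omega> * (S \<omega>)\<^sup>2"
        using XS by eventually_elim simp
    qed (intro borel_measurable_times borel_measurable_power ind_meas X_meas S_meas)+
    also have "\<dots> = p * (unreported_moment t s 2 + (unreported_moment t s 1)\<^sup>2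
        + (reported_moment t s 2 + 2 * reported_moment t s 1 * unreported_moment t s 1) * (real l / reported_mass t)
        + (reported_moment t s 1)\<^sup>2 * (real l * (real l - 1) / (reported_mass t)\<^sup>2))"
      unfolding A_def S_def p_def by (rule second_moment_given_count(2)[OF ts m int])
    finally have e: "(\<integral>\<omega>. (X \<omega>)\<^sup>2 \<partial>uniform_measure P A) = unreported_moment t s 2 + (unreported_moment t s 1)\<^sup>2
        + (reported_moment t s 2 + 2 * reported_moment t s 1 * unreported_moment t s 1) * (real l / reported_mass t)
        + (reported_moment t s 1)\<^sup>2 * (real l * (real l - 1) / (reported_mass t)\<^sup>2)"
      unfolding uniform_measure_expectation(2)[OF A pA0 X2] pA using p by simp
    have H: "H 2 = unreported_moment t s 2"
    proof -
      obtain C where C: "\<And>v d. (\<integral>p. (cluster_incr t s v d p)\<^sup>2 \<partial>path_law) \<le> C"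
        using cluster_incr_moment_bounded[of 2 t s] int ts by auto
      then show ?thesis unfolding H_def by (intro H_int_eq[OF _ ts]) auto
    qed
    have U: "prob_space (uniform_measure P A)"
      using pA0 by (intro prob_space_uniform_measure) (auto simp: emeasure_eq_measure)
    have U2: "integrable (uniform_measure P A) (\<lambda>\<omega>. (X \<omega>)\<^sup>2)"
      by (rule uniform_measure_expectation(1)[OF A pA0 X2])
    have "cond_variance P A X = (\<integral>\<omega>. (X \<omega>)\<^sup>2 \<partial>uniform_measure P A) - (cond_expectation P A X)\<^sup>2"
      unfolding cond_variance_def cond_expectation_def
      by (rule prob_space.variance_eq[OF U]) (use X U2 in auto)
    also have "\<dots> = real l * J 2 - real l * (J 1)\<^sup>2 + H 2"
    proof -
      have X1: "cond_expectation P A X = real l * (reported_moment t s 1 / reported_mass t) + unreported_moment t s 1"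
        using X by (simp add: J)
      show ?thesis
        unfolding e X1 H using m by (simp add: J field_simps power2_eq_square)
    qed
    finally show ?thesis using U2 by blast
  qed
  show ?thesis using first second
  proof (intro conjI impI)
    assume sq: "\<forall>u\<ge>0. integrable P (\<lambda>\<omega>. (L u \<omega>)\<^sup>2)"
    have "integrable P (L u)" if "0 \<le> u" for u
      using sq that by (intro square_integrable_imp_integrable[OF L_measurable]) auto
    then show "integrable (uniform_measure P A) X" using first by blast
  qed blast+
qed

end
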